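(* Assume that there exist positive constants $c_0,\kappa_0,c_1,\kappa_1$ such that $\inf_{|\delta|\le c_0}U'(\theta+\delta)\ge\kappa_0$, $\sup_{|\delta|\le c_1}|U''(\theta+\delta)|\le\kappa_1$, and that $\sup_{t\in\mathbb{R}}|f(t)|<\infty$. Let $\{\delta_n\}_{n\ge1}$ be a sequence of positive numbers satisfying $\sqrt n\,\delta_n\to\infty$. Then $$\left|\frac{\mathbb{P}\{\sqrt n(\hat\theta-\theta)/\sigma_\theta>z\}}{1-\Phi(z)}-1\right|\le C\left\{\frac{1+z^3}{\sqrt n}+(1+z)\delta_n+2(z\vee1)\sqrt{2\pi}\exp\left(\frac{z^2}{2}-\sqrt n\,\delta_n\right)\right\},$$ uniformly for $0<z\le o(\delta_n^{-1}\wedge n^{1/4}\sqrt{\delta_n})$ (that is, for every sequence $a_n=o(\delta_n^{-1}\wedge n^{1/4}\sqrt{\delta_n})$ the bound holds for all $0<z\le a_n$), where $C<\infty$ is a positive constant independent of $z$ and $n$, and $\sigma_\theta^2=4\,\mathrm{Var}\{F(-\xi_1)\}/\{U'(\theta)\}^2$. In particular, when $\delta_n\asymp n^{-1/6}$, $$\left|\frac{\mathbb{P}\{\sqrt n(\hat\theta-\theta)/\sigma_\theta>z\}}{1-\Phi(z)}-1\right|\to0$$ uniformly for $0<z\le o(n^{1/6})$.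
   Context: For $n\ge2$, $[n]=\{1,\dots,n\}$. Let $X_i=\theta+\xi_i$, $i\in[n]$, be real random variables, where $\theta\in\mathbb{R}$ is an unknown location parameter and $\xi_1,\dots,\xi_n$ are i.i.d. with cumulative distribution function $F(t)=\mathbb{P}(\xi_1\le t)$ and density $f=F'$ (a distribution not depending on $n$). The distribution of $\xi_1$ has pseudomedian zero, i.e. the median of $(\xi_1+\xi_2)/2$ is $0$. Put $U(t)=\mathbb{P}\{(X_1+X_2)/2\le t\}$, so that $\theta=\inf\{t\in\mathbb{R}:U(t)\ge1/2\}$. Let $U_n(t)=\{n(n-1)\}^{-1}\sum_{i\ne j\in[n]}\mathbb{I}\{(X_i+X_j)/2\le t\}$. The Hodges–Lehmann estimator is $\hat\theta=\inf\{t\in\mathbb{R}:U_n(t)\ge1/2\}$. $\Phi$ is the standard normal distribution function, $a\wedge b=\min(a,b)$, $a\vee b=\max(a,b)$, and $a_n\asymp b_n$ means that $a_n/b_n$ is bounded above and below by positive constants. *)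

theory Defs
  imports "HOL-Probability.Probability" "HOL-Library.Landau_Symbols"
begin

text \<open>The median convention used both for the population pseudomedian and for the
  Hodges--Lehmann estimator: the lower 1/2-quantile of a distribution function.\<close>

definition lower_median :: "(real \<Rightarrow> real) \<Rightarrow> real" where
  "lower_median G = Inf {t. G t \<ge> 1 / 2}"

text \<open>Samples are indexed by \<open>1, 2, \<dots>\<close>; a sample of size \<open>n\<close> consists of the
  indices \<open>{1..n}\<close> and index 0 is never used.\<close>

definition walsh_cdf :: "'a measure \<Rightarrow> (nat \<Rightarrow> 'a \<Rightarrow> real) \<Rightarrow> real \<Rightarrow> real" where
  "walsh_cdf M X t = measure M {\<omega> \<in> space M. (X 1 \<omega> + X 2 \<omega>) / 2 \<le> t}"

definition walsh_ecdf :: "nat \<Rightarrow> (nat \<Rightarrow> real) \<Rightarrow> real \<Rightarrow> real" where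
  "walsh_ecdf n x t =
     (\<Sum>(i, j) \<in> {(i, j). i \<in> {1..n} \<and> j \<in> {1..n} \<and> i \<noteq> j}.
        of_bool ((x i + x j) / 2 \<le> t)) / (real n * (real n - 1))"

definition hodges_lehmann :: "nat \<Rightarrow> (nat \<Rightarrow> real) \<Rightarrow> real" where
  "hodges_lehmann n x = lower_median (walsh_ecdf n x)"

definition hl_tail_error ::
  "'a measure \<Rightarrow> (nat \<Rightarrow> 'a \<Rightarrow> real) \<Rightarrow> real \<Rightarrow> real \<Rightarrow> nat \<Rightarrow> real \<Rightarrow> real" where
  "hl_tail_error M X \<theta> \<sigma> n z =
     \<bar>measure M {\<omega> \<in> space M.
          sqrt (real n) * (hodges_lehmann n (\<lambda>i. X i \<omega>) - \<theta>) / \<sigma> > z}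
        / (1 - cdf std_normal_distribution z) - 1\<bar>"

end

theory Submission
  imports Defs "HOL-Real_Asymp.Real_Asymp"
begin

text \<open>
  The estimator exceeds \<open>\<theta> + t\<close> exactly when the empirical distribution function of the
  pairwise averages is below 1/2 at \<open>\<theta> + t\<close>
  (\<open>less_hodges_lehmann_iff\<close>). At a fixed threshold this is an
  event about a U-statistic of degree two with a bounded kernel, and the Hoeffding decomposition
  turns it into \<open>W > x + D\<close>, where \<open>W\<close> is a normalised sum of bounded
  i.i.d. variables, \<open>x\<close> is the standardised distance of \<open>U(\<theta> + t)\<close> from
  1/2, and \<open>D\<close> is a degenerate double sum
  (\<open>less_hodges_lehmann_iff_lin_part\<close>).  For
  \<open>t = \<sigma> z / sqrt n\<close> the Taylor expansion of \<open>U\<close> gives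
  \<open>x = z + O(z\<^sup>2 / sqrt n)\<close> (\<open>threshold_close\<close>), and in the given range
  of \<open>z\<close> this shift is \<open>O(\<delta>\<^sub>n)\<close>.

  The sum \<open>W\<close> satisfies a Cramer-type estimate with relative error
  \<open>O((1 + z\<^sup>3) / sqrt n)\<close> (\<open>bounded_sum_moderate_deviation\<close>).
  It comes from Stein's equation \<open>f' - w f = T(z) - 1{w > z}\<close> for the normal tail
  \<open>T\<close>: boundedness of the summands confines each of them to a window of width
  \<open>d = O(n\<^sup>-\<^sup>1\<^sup>/\<^sup>2)\<close>, so that replacing
  \<open>W\<close> by a leave-one-out sum moves the indicator by at most \<open>d\<close> and changes
  \<open>w f(w)\<close> by at most \<open>d\<close> times its slope. The slope is at most
  \<open>T(z) (1 + w\<^sup>2) exp (w\<^sup>2 / 2)\<close> up to a constant for \<open>0 \<le> w \<le> z\<close>,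
  and the moment generating function of \<open>W\<close> shows that its mean over unit intervals
  contributes \<open>O(T(z) (1 + z\<^sup>2))\<close> each, hence \<open>O(T(z) (1 + z\<^sup>3))\<close> in total.
  The error is relative from the start, and neither exponential tilting nor Fourier inversion is
  involved.

  The double sum \<open>D\<close> has exponential tails at scale \<open>n\<^sup>-\<^sup>1\<^sup>/\<^sup>2\<close>
  (\<open>degenerate_sum_tail\<close>): averaging over all ways of splitting the indices
  in two decouples it, conditionally on one half it is a sum of centred variables, and the inequality
  \<open>exp y \<le> y + exp (y\<^sup>2)\<close> together with a Gaussian linearisation of the square bounds its
  exponential moment.  So \<open>\<bar>D\<bar> \<le> const \<cdot> \<delta>\<^sub>n\<close> outside an event of
  probability \<open>4 exp (- sqrt n \<delta>\<^sub>n)\<close>. Dividing this by the normal tail gives the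
  third term of the bound, and shifting the argument of the normal tail by
  \<open>O(\<delta>\<^sub>n)\<close> gives the second (\<open>normal_tail_shift\<close>).
  \<close>

section \<open>The tail of the standard normal distribution\<close>

abbreviation \<phi> :: "real \<Rightarrow> real" where "\<phi> \<equiv> std_normal_density"

definition normal_tail :: "real \<Rightarrow> real" where
  "normal_tail z = 1 - cdf std_normal_distribution z"

lemma std_normal_density_pos: "\<phi> x > 0"
  by (simp add: std_normal_density_def)

lemma std_normal_density_deriv:
  "(\<phi> has_real_derivative - x * \<phi> x) (at x)"
  unfolding std_normal_density_def
  by (auto intro!: derivative_eq_intros simp: field_simps power2_eq_square)

text \<open>Any antiderivative of the density differs from the distribution function by a constant,
  because both have the same increments.\<close>
lemma cdf_std_normal_deriv:
  "(cdf std_normal_distribution has_real_derivative \<phi> x) (at x)"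
proof -
  interpret N: real_distribution std_normal_distribution by (rule real_dist_normal_dist)
  obtain G where "\<forall>x::real. -\<infinity> < ereal x \<longrightarrow> ereal x < \<infinity> \<longrightarrow>
      (G has_vector_derivative \<phi> x) (at x)"
    by (rule exE[OF einterval_antiderivative[of "-\<infinity>" \<infinity> \<phi>]])
       (use std_normal_density_deriv in \<open>auto intro: DERIV_isCont\<close>)
  then have G: "(G has_real_derivative \<phi> x) (at x)" for x
    by (simp add: has_real_derivative_iff_has_vector_derivative)
  have diff: "cdf std_normal_distribution b - cdf std_normal_distribution a = G b - G a"
    if "a < b" for a b
  proof -
    have le: "G a \<le> G b"
      using that G by (intro DERIV_nonneg_imp_nondecreasing[of a b G])
        (auto intro: less_imp_le std_normal_density_pos)
    have "emeasure std_normal_distribution {a<..b} =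
        (\<integral>\<^sup>+x. ennreal (\<phi> x) * indicator {a<..b} x \<partial>lborel)"
      by (subst emeasure_density) auto
    also have "\<dots> = (\<integral>\<^sup>+x. ennreal (\<phi> x) * indicator {a..b} x \<partial>lborel)"
    proof (intro nn_integral_cong_AE, use AE_lborel_singleton[of a] in eventually_elim)
      case (elim x)
      then show ?case by (auto simp: indicator_def)
    qed
    also have "\<dots> = ennreal (G b - G a)"
      using that G by (intro nn_integral_FTC_Icc) auto
    finally show ?thesis
      using that le by (subst N.cdf_diff_eq) (auto simp: measure_def)
  qed
  have "cdf std_normal_distribution u = G u + (cdf std_normal_distribution 0 - G 0)" for u
    using diff[of u 0] diff[of 0 u] by (cases u "0::real" rule: linorder_cases) auto
  then have "cdf std_normal_distribution = (\<lambda>u. G u + (cdf std_normal_distribution 0 - G 0))"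
    by blast
  then show ?thesis
    using DERIV_add[OF G DERIV_const] by (metis add.right_neutral)
qed

lemma normal_tail_deriv:
  "(normal_tail has_real_derivative - \<phi> x) (at x)"
  unfolding normal_tail_def using cdf_std_normal_deriv[of x]
  by (auto intro!: derivative_eq_intros)

lemma normal_tail_nonneg: "0 \<le> normal_tail z"
  and normal_tail_le_1: "normal_tail z \<le> 1"
  and normal_tail_tendsto_0: "(normal_tail \<longlongrightarrow> 0) at_top"
  and normal_tail_tendsto_1: "(normal_tail \<longlongrightarrow> 1) at_bot"
proof -
  interpret N: real_distribution std_normal_distribution by (rule real_dist_normal_dist)
  show "0 \<le> normal_tail z" "normal_tail z \<le> 1"
    by (auto simp: normal_tail_def N.cdf_bounded_prob N.cdf_nonneg)
  show "(normal_tail \<longlongrightarrow> 0) at_top"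
    unfolding normal_tail_def using tendsto_diff[OF tendsto_const N.cdf_lim_at_top_prob, of 1] by simp
  show "(normal_tail \<longlongrightarrow> 1) at_bot"
    unfolding normal_tail_def using tendsto_diff[OF tendsto_const N.cdf_lim_at_bot, of 1] by simp
qed

lemma normal_tail_antimono: "a \<le> b \<Longrightarrow> normal_tail b \<le> normal_tail a"
  using DERIV_nonpos_imp_nonincreasing[of a b normal_tail] normal_tail_deriv std_normal_density_pos
  by (metis less_imp_le neg_le_0_iff_le)

lemma std_normal_density_tendsto_0: "(\<phi> \<longlongrightarrow> 0) at_top"
proof -
  have "((\<lambda>x::real. (1 / sqrt (2 * pi)) * exp (- x\<^sup>2 / 2)) \<longlongrightarrow> (1 / sqrt (2 * pi)) * 0) at_top"
  proof (intro tendsto_mult tendsto_const filterlim_compose[OF exp_at_bot])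
    have "filterlim (\<lambda>x::real. x\<^sup>2 / 2) at_top at_top"
    proof (rule filterlim_at_top_mono[OF filterlim_ident])
      show "\<forall>\<^sub>F x in at_top. x \<le> x\<^sup>2 / (2::real)"
        using eventually_ge_at_top[of "2::real"]
        by eventually_elim (simp add: power2_eq_square)
    qed
    then show "filterlim (\<lambda>x::real. - x\<^sup>2 / 2) at_bot at_top"
      by (simp add: filterlim_uminus_at_bot)
  qed
  then show ?thesis by (simp add: std_normal_density_def[abs_def])
qed

lemma nonneg_if_decreasing_to_0:
  fixes D D' :: "real \<Rightarrow> real"
  assumes "\<And>x. x \<ge> a \<Longrightarrow> (D has_real_derivative D' x) (at x)" "\<And>x. x \<ge> a \<Longrightarrow> D' x \<le> 0"
    and "(D \<longlongrightarrow> 0) at_top"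
  shows "0 \<le> D a"
proof (rule tendsto_upperbound[OF assms(3)])
  show "\<forall>\<^sub>F x in at_top. D x \<le> D a"
    using eventually_ge_at_top[of a]
  proof eventually_elim
    case (elim x)
    then show ?case
      using assms by (intro DERIV_nonpos_imp_nonincreasing[of a x D]) auto
  qed
qed simp

text \<open>The two Mills bounds: both differences tend to 0 at infinity and have an explicit
  nonpositive derivative, hence are nonnegative.\<close>
lemma normal_tail_ge: "0 \<le> z \<Longrightarrow> z / (1 + z\<^sup>2) * \<phi> z \<le> normal_tail z"
proof -
  assume z: "0 \<le> z"
  have "0 \<le> normal_tail z - z / (1 + z\<^sup>2) * \<phi> z"
  proof (rule nonneg_if_decreasing_to_0[where a = z and
      D = "\<lambda>z. normal_tail z - z / (1 + z\<^sup>2) * \<phi> z" and D' = "\<lambda>x. - 2 * \<phi> x / (1 + x\<^sup>2)\<^sup>2"])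
    fix x :: real assume "z \<le> x"
    have nz: "1 + x\<^sup>2 \<noteq> 0" by (metis add.commute sum_power2_eq_zero_iff one_power2 zero_neq_one)
    have "((\<lambda>x. x / (1 + x\<^sup>2)) has_real_derivative (1 - x\<^sup>2) / (1 + x\<^sup>2)\<^sup>2) (at x)"
      using nz by (auto intro!: derivative_eq_intros simp: field_simps power2_eq_square)
    from DERIV_diff[OF normal_tail_deriv DERIV_mult[OF this std_normal_density_deriv]]
    moreover have "- \<phi> x - ((1 - x\<^sup>2) / (1 + x\<^sup>2)\<^sup>2 * \<phi> x +
         - x * \<phi> x * (x / (1 + x\<^sup>2))) = - 2 * \<phi> x / (1 + x\<^sup>2)\<^sup>2"
      using nz by (simp add: divide_simps) (simp add: algebra_simps power2_eq_square)
    ultimately show "((\<lambda>z. normal_tail z - z / (1 + z\<^sup>2) * \<phi> z) has_real_derivative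
        - 2 * \<phi> x / (1 + x\<^sup>2)\<^sup>2) (at x)" by metis
    show "- 2 * \<phi> x / (1 + x\<^sup>2)\<^sup>2 \<le> 0"
      by (simp add: divide_le_0_iff)
  next
    have "((\<lambda>x. x / (1 + x\<^sup>2) * \<phi> x) \<longlongrightarrow> 0) at_top"
    proof (rule tendsto_sandwich[OF _ _ tendsto_const std_normal_density_tendsto_0])
      show "\<forall>\<^sub>F x in at_top. 0 \<le> x / (1 + x\<^sup>2) * \<phi> x"
        using eventually_ge_at_top[of "0::real"]
        by eventually_elim (simp add: divide_nonneg_nonneg)
      show "\<forall>\<^sub>F x in at_top. x / (1 + x\<^sup>2) * \<phi> x \<le> \<phi> x"
        using eventually_ge_at_top[of "1::real"]
      proof eventually_elim
        case (elim x)
        then have "x \<le> 1 + x\<^sup>2" by (smt (verit) self_le_power pos2)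
        then have "x / (1 + x\<^sup>2) \<le> 1" by (simp add: divide_le_eq_1 add_pos_nonneg)
        then show ?case by (intro mult_left_le_one_le) (use elim in \<open>auto simp: divide_nonneg_nonneg\<close>)
      qed
    qed
    from tendsto_diff[OF normal_tail_tendsto_0 this]
    show "((\<lambda>x. normal_tail x - x / (1 + x\<^sup>2) * \<phi> x) \<longlongrightarrow> 0) at_top" by simp
  qed
  then show ?thesis by simp
qed

lemma normal_tail_le: "0 < z \<Longrightarrow> normal_tail z \<le> \<phi> z / z"
proof -
  assume z: "0 < z"
  have "0 \<le> \<phi> z / z - normal_tail z"
  proof (rule nonneg_if_decreasing_to_0[where a = z and
      D = "\<lambda>z. \<phi> z / z - normal_tail z" and D' = "\<lambda>x. - \<phi> x / x\<^sup>2"])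
    fix x :: real assume "z \<le> x"
    then have x: "x > 0" using z by simp
    from DERIV_diff[OF DERIV_divide[OF std_normal_density_deriv DERIV_ident] normal_tail_deriv, of x] x
    have "((\<lambda>x. \<phi> x / x - normal_tail x) has_real_derivative
      (- x * \<phi> x * x - \<phi> x * 1) / (x * x) - - \<phi> x) (at x)" by simp
    moreover have "(- x * \<phi> x * x - \<phi> x * 1) / (x * x) - - \<phi> x =
        - \<phi> x / x\<^sup>2"
      using x by (simp add: field_simps power2_eq_square)
    ultimately show "((\<lambda>z. \<phi> z / z - normal_tail z) has_real_derivative
        - \<phi> x / x\<^sup>2) (at x)" by metis
    show "- \<phi> x / x\<^sup>2 \<le> 0" by (simp add: divide_le_0_iff)
  next
    have "((\<lambda>x. \<phi> x * inverse x) \<longlongrightarrow> 0 * 0) at_top"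
      by (intro tendsto_mult std_normal_density_tendsto_0 tendsto_inverse_0_at_top filterlim_ident)
    from tendsto_diff[OF this normal_tail_tendsto_0]
    show "((\<lambda>x. \<phi> x / x - normal_tail x) \<longlongrightarrow> 0) at_top"
      by (simp add: divide_inverse)
  qed
  then show ?thesis by simp
qed

lemma std_normal_density_antimono: "0 \<le> a \<Longrightarrow> a \<le> b \<Longrightarrow> \<phi> b \<le> \<phi> a"
  unfolding std_normal_density_def by (intro mult_left_mono) (auto intro: power_mono)

lemma exp_half_le: "exp (1/2) \<le> (2::real)"
proof (rule power2_le_imp_le)
  have "(exp (1/2))\<^sup>2 = exp (1::real)" by (simp flip: exp_of_nat_mult)
  then show "(exp (1/2::real))\<^sup>2 \<le> 2\<^sup>2" using exp_le by simp
qed simp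

lemma density_le_normal_tail:
  assumes "0 \<le> z" shows "\<phi> z \<le> 4 * max z 1 * normal_tail z"
proof (cases "z \<le> 1")
  case True
  have "\<phi> z \<le> \<phi> 0"
    by (rule std_normal_density_antimono) (use assms in auto)
  also have "\<phi> 0 = exp (1/2) * \<phi> 1"
    by (simp add: std_normal_density_def flip: exp_add)
  also have "\<dots> \<le> 2 * \<phi> 1"
    using exp_half_le by (intro mult_right_mono) auto
  also have "\<dots> \<le> 4 * normal_tail 1" using normal_tail_ge[of 1] by simp
  also have "\<dots> \<le> 4 * normal_tail z" using normal_tail_antimono[OF True] by simp
  finally show ?thesis using True by (simp add: max_def)
next
  case False
  then have "1 \<le> z * z" by (metis less_eq_real_def linorder_not_le mult_ge1_I)
  then have "1 / (2 * z) \<le> z / (1 + z\<^sup>2)"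
    using False by (simp add: field_simps power2_eq_square)
  from mult_right_mono[OF this, of "\<phi> z"] normal_tail_ge[of z] assms
  have "1 / (2 * z) * \<phi> z \<le> normal_tail z" by simp
  then have "\<phi> z \<le> 2 * z * normal_tail z" using False by (simp add: field_simps)
  also have "\<dots> \<le> 4 * z * normal_tail z" using assms normal_tail_nonneg[of z] by (intro mult_right_mono) auto
  finally show ?thesis using False by (simp add: max_def)
qed

lemma normal_tail_pos: "normal_tail z > 0"
proof -
  have "0 < normal_tail (max z 0)"
    using density_le_normal_tail[of "max z 0"] std_normal_density_pos[of "max z 0"]
      normal_tail_nonneg[of "max z 0"]
    by (cases "normal_tail (max z 0) = 0") auto
  also have "\<dots> \<le> normal_tail z" by (rule normal_tail_antimono) simp
  finally show ?thesis .
qed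

lemma inverse_normal_tail_le:
  assumes "0 \<le> z" shows "1 / normal_tail z \<le> 4 * max z 1 * sqrt (2 * pi) * exp (z\<^sup>2 / 2)"
proof -
  have "1 = \<phi> z * (sqrt (2 * pi) * exp (z\<^sup>2 / 2))"
    by (simp add: std_normal_density_def flip: exp_add)
  also have "\<dots> \<le> (4 * max z 1 * normal_tail z) * (sqrt (2 * pi) * exp (z\<^sup>2 / 2))"
    using density_le_normal_tail[OF assms] by (intro mult_right_mono) auto
  finally show ?thesis using normal_tail_pos[of z] by (simp add: field_simps)
qed

text \<open>Between \<open>z - h\<close> and \<open>z\<close> the density grows at most by
  \<open>exp (h z)\<close>, and the density itself is at most \<open>4 (1 + z)\<close> times the
  tail. So shifts of size \<open>h = O(1 / z)\<close> change the tail by a relative \<open>O((1 + z) h)\<close>.\<close>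
lemma normal_tail_shift:
  assumes z: "0 \<le> z" and h: "0 \<le> h" "h * z \<le> b"
  shows "normal_tail (z - h) \<le> normal_tail z * (1 + 4 * exp b * (1 + z) * h)"
    and "normal_tail z * (1 - 4 * (1 + z) * h) \<le> normal_tail (z + h)"
proof -
  have m: "4 * max z 1 * normal_tail z \<le> 4 * (1 + z) * normal_tail z"
    using z normal_tail_nonneg[of z] by (intro mult_right_mono) auto
  have "normal_tail (z - h) - normal_tail z \<le> exp b * \<phi> z * h"
  proof (cases "h = 0")
    case False
    then obtain w where w: "z - h < w" "w < z"
      "normal_tail z - normal_tail (z - h) = (z - (z - h)) * (- \<phi> w)"
      using MVT2[of "z - h" z normal_tail "\<lambda>x. - \<phi> x"] normal_tail_deriv h by auto
    have "z\<^sup>2 / 2 - w\<^sup>2 / 2 = (z - w) * (z + w) / 2" by (simp add: field_simps power2_eq_square)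
    also have "\<dots> \<le> h * (2 * z) / 2"
    proof (cases "z + w \<ge> 0")
      case True then show ?thesis using w h by (intro divide_right_mono mult_mono) auto
    next
      case False
      then have "(z - w) * (z + w) \<le> 0" using w by (intro mult_nonneg_nonpos) auto
      then show ?thesis using z h by (smt (verit) divide_right_mono mult_nonneg_nonneg)
    qed
    finally have "z\<^sup>2 / 2 - w\<^sup>2 / 2 \<le> b" using h by simp
    then have "\<phi> w \<le> exp b * \<phi> z"
      by (simp add: std_normal_density_def divide_right_mono flip: exp_add)
    then have "h * \<phi> w \<le> h * (exp b * \<phi> z)" by (rule mult_left_mono) (rule h)
    with w(3) have "normal_tail (z - h) - normal_tail z \<le> h * (exp b * \<phi> z)" by (simp add: mult_ac)
    then show ?thesis by (simp add: mult_ac)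
  qed simp
  also have "\<dots> \<le> exp b * (4 * (1 + z) * normal_tail z) * h"
    using density_le_normal_tail[OF z] m h by (intro mult_right_mono mult_left_mono) auto
  finally show "normal_tail (z - h) \<le> normal_tail z * (1 + 4 * exp b * (1 + z) * h)"
    by (simp add: algebra_simps)
  have "normal_tail z - normal_tail (z + h) \<le> \<phi> z * h"
  proof (cases "h = 0")
    case False
    then obtain w where w: "z < w" "w < z + h"
      "normal_tail (z + h) - normal_tail z = (z + h - z) * (- \<phi> w)"
      using MVT2[of z "z + h" normal_tail "\<lambda>x. - \<phi> x"] normal_tail_deriv h by auto
    then have "\<phi> w \<le> \<phi> z"
      using z by (intro std_normal_density_antimono) auto
    then have "h * \<phi> w \<le> h * (\<phi> z)" by (rule mult_left_mono) (rule h)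
    with w(3) have "normal_tail z - normal_tail (z + h) \<le> h * (\<phi> z)" by (simp add: mult_ac)
    then show ?thesis by (simp add: mult_ac)
  qed simp
  also have "\<dots> \<le> (4 * (1 + z) * normal_tail z) * h"
    using density_le_normal_tail[OF z] m h by (intro mult_right_mono) auto
  finally show "normal_tail z * (1 - 4 * (1 + z) * h) \<le> normal_tail (z + h)"
    by (simp add: algebra_simps)
qed

section \<open>Stein's equation for a half-line\<close>

lemma std_normal_density_minus: "\<phi> (- x) = \<phi> x"
  by (simp add: std_normal_density_def)

lemma normal_tail_minus: "normal_tail (- w) = 1 - normal_tail w"
proof -
  define c where "c = normal_tail w + normal_tail (- w)"
  have "((\<lambda>x. normal_tail x + normal_tail (- x)) has_real_derivative
      - \<phi> x + - \<phi> (- x) * (- 1)) (at x)" for x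
    by (intro DERIV_add normal_tail_deriv DERIV_chain2[OF normal_tail_deriv])
       (auto intro!: derivative_eq_intros)
  then have "((\<lambda>x. normal_tail x + normal_tail (- x)) has_real_derivative 0) (at x)" for x
    by (simp add: std_normal_density_minus)
  then have "normal_tail x + normal_tail (- x) = c" for x
    unfolding c_def by (rule DERIV_isconst_all[rule_format])
  moreover have "((\<lambda>x. normal_tail x + normal_tail (- x)) \<longlongrightarrow> 0 + 1) at_top"
    by (intro tendsto_add normal_tail_tendsto_0
        filterlim_compose[OF normal_tail_tendsto_1 filterlim_uminus_at_bot_at_top])
  ultimately have "((\<lambda>x::real. c) \<longlongrightarrow> 1) at_top" by simp
  then have "c = 1" by (simp add: tendsto_const_iff)
  then show ?thesis by (simp add: c_def)
qed

definition mills :: "real \<Rightarrow> real" where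
  "mills w = normal_tail w / \<phi> w"

lemma mills_nonneg: "0 \<le> mills w"
  by (simp add: mills_def normal_tail_nonneg)

lemma mills_deriv: "(mills has_real_derivative w * mills w - 1) (at w)"
proof -
  have nz: "\<phi> w \<noteq> 0" using std_normal_density_pos[of w] by simp
  have "((\<lambda>w. normal_tail w / \<phi> w) has_real_derivative
     (- \<phi> w * \<phi> w - normal_tail w * (- w * \<phi> w)) /
     (\<phi> w * \<phi> w)) (at w)"
    by (intro DERIV_divide normal_tail_deriv std_normal_density_deriv nz)
  then show ?thesis
    unfolding mills_def[abs_def] by (rule DERIV_cong) (use nz in \<open>simp add: field_simps\<close>)
qed

lemma mills_le_exp: "mills w \<le> 3 * exp (w\<^sup>2 / 2)"
proof -
  have "sqrt (2 * pi) \<le> 3"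
    using pi_less_4 by (intro real_le_lsqrt) auto
  have "mills w \<le> 1 / \<phi> w"
    unfolding mills_def using std_normal_density_pos[of w] normal_tail_le_1[of w] by (intro divide_right_mono) auto
  also have "\<dots> = sqrt (2 * pi) * exp (w\<^sup>2 / 2)"
    by (simp add: std_normal_density_def exp_minus field_simps)
  also have "\<dots> \<le> 3 * exp (w\<^sup>2 / 2)"
    using \<open>sqrt (2 * pi) \<le> 3\<close> by (intro mult_right_mono) auto
  finally show ?thesis .
qed

text \<open>The expression is the derivative of \<open>w * mills w\<close>, the product
  whose oscillation enters the error of Stein's method. It lies in \<open>[0, 1 / w]\<close> for
  \<open>w \<ge> 1\<close> by the two Mills bounds; on \<open>[-1, 1]\<close> a crude bound is enough.\<close>
lemma mills_slope_bound:
  assumes "-1 \<le> w" shows "\<bar>(1 + w\<^sup>2) * mills w - w\<bar> \<le> 13"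
proof (cases "w \<ge> 1")
  case True
  have nz: "0 < \<phi> w" "0 < 1 + w\<^sup>2"
    using std_normal_density_pos[of w] by (simp_all add: add_pos_nonneg)
  have "w / (1 + w\<^sup>2) \<le> mills w"
    unfolding mills_def using normal_tail_ge[of w] True nz by (subst pos_le_divide_eq) auto
  then have lo: "w \<le> (1 + w\<^sup>2) * mills w" using nz by (simp add: field_simps)
  have "mills w \<le> 1 / w"
    unfolding mills_def using normal_tail_le[of w] True nz by (subst pos_divide_le_eq) auto
  then have "(1 + w\<^sup>2) * mills w \<le> (1 + w\<^sup>2) * (1 / w)" using nz by (intro mult_left_mono) auto
  also have "\<dots> = 1 / w + w" using True by (simp add: field_simps power2_eq_square)
  also have "\<dots> \<le> 1 + w" using True by simp
  finally show ?thesis using lo by simp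
next
  case False
  then have w: "\<bar>w\<bar> \<le> 1" using assms by auto
  then have w2: "w\<^sup>2 \<le> 1" by (simp add: abs_square_le_1)
  have "mills w \<le> 3 * exp (w\<^sup>2 / 2)" by (rule mills_le_exp)
  also have "\<dots> \<le> 3 * 2" using w2 exp_half_le by (intro mult_left_mono) (auto intro: order_trans[of _ "exp (1/2)"])
  finally have "(1 + w\<^sup>2) * mills w \<le> 2 * 6" using w2 mills_nonneg by (intro mult_mono) auto
  moreover have "0 \<le> (1 + w\<^sup>2) * mills w" using mills_nonneg by simp
  ultimately show ?thesis using w by auto
qed

text \<open>The mirror image for \<open>mills (- w)\<close>, the ratio of the lower
  tail to the density, which grows like \<open>exp (w\<^sup>2 / 2)\<close> on the positive half-line.\<close>
lemma mills_minus_slope_bound: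
  "\<bar>(1 + w\<^sup>2) * mills (- w) + w\<bar> \<le> 13 * ((1 + (max w 0)\<^sup>2) * exp ((max w 0)\<^sup>2 / 2))"
proof (cases "w \<le> 0")
  case True
  then show ?thesis using mills_slope_bound[of "- w"] by (simp add: max_def)
next
  case False
  have "(1 + w\<^sup>2) * mills (- w) \<le> (1 + w\<^sup>2) * (3 * exp (w\<^sup>2 / 2))"
    using mills_le_exp[of "- w"] by (intro mult_left_mono) auto
  moreover have "w \<le> (1 + w\<^sup>2) * exp (w\<^sup>2 / 2)"
  proof -
    have "0 \<le> (w - 1)\<^sup>2" by simp
    then have "w \<le> 1 + w\<^sup>2" using False by (simp add: power2_diff)
    also have "(1 + w\<^sup>2) * 1 \<le> (1 + w\<^sup>2) * exp (w\<^sup>2 / 2)" by (intro mult_left_mono) auto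
    finally show ?thesis by simp
  qed
  moreover have "0 \<le> (1 + w\<^sup>2) * mills (- w)" using mills_nonneg by simp
  moreover have "0 \<le> (1 + w\<^sup>2) * exp (w\<^sup>2 / 2)" by simp
  ultimately have "\<bar>(1 + w\<^sup>2) * mills (- w) + w\<bar> \<le> 13 * ((1 + w\<^sup>2) * exp (w\<^sup>2 / 2))"
    using False by (simp add: abs_le_iff)
  then show ?thesis using False by (simp add: max_def)
qed

text \<open>The bounded solution of Stein's equation for the half-line beyond \<open>z\<close>. The two
  branches agree at \<open>z\<close>, since \<open>mills (- w)\<close> is the lower
  tail divided by the density.\<close>
definition stein_sol :: "real \<Rightarrow> real \<Rightarrow> real" where
  "stein_sol z w = (if w \<le> z then normal_tail z * mills (- w) else (1 - normal_tail z) * mills w)"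

lemma mills_minus_deriv: "((\<lambda>w. mills (- w)) has_real_derivative 1 + w * mills (- w)) (at w)"
  using DERIV_chain2[OF mills_deriv[of "- w"] DERIV_minus[OF DERIV_ident]] by (rule DERIV_cong) simp

lemma stein_sol_eq_left: "w \<le> z \<Longrightarrow> stein_sol z w = normal_tail z * mills (- w)"
  and stein_sol_eq_right: "z \<le> w \<Longrightarrow> stein_sol z w = (1 - normal_tail z) * mills w"
  by (auto simp: stein_sol_def mills_def normal_tail_minus std_normal_density_minus)

lemma stein_sol_deriv:
  assumes "w \<noteq> z"
  shows "(stein_sol z has_real_derivative
      w * stein_sol z w + normal_tail z - of_bool (z < w)) (at w)"
proof (cases "w < z")
  case True
  have "((\<lambda>w. normal_tail z * mills (- w)) has_real_derivative
      normal_tail z * (1 + w * mills (- w))) (at w)"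
    by (rule DERIV_cmult[OF mills_minus_deriv])
  then have "(stein_sol z has_real_derivative normal_tail z * (1 + w * mills (- w))) (at w)"
    by (rule has_field_derivative_transform_within_open[of _ _ _ "{..<z}"])
       (use True in \<open>auto simp: stein_sol_eq_left\<close>)
  then show ?thesis using True by (rule_tac DERIV_cong) (auto simp: stein_sol_eq_left algebra_simps)
next
  case False
  then have w: "z < w" using assms by simp
  have "((\<lambda>w. (1 - normal_tail z) * mills w) has_real_derivative
      (1 - normal_tail z) * (w * mills w - 1)) (at w)"
    by (rule DERIV_cmult[OF mills_deriv])
  then have "(stein_sol z has_real_derivative (1 - normal_tail z) * (w * mills w - 1)) (at w)"
    by (rule has_field_derivative_transform_within_open[of _ _ _ "{z<..}"])
       (use w in \<open>auto simp: stein_sol_eq_right\<close>)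
  then show ?thesis using w by (rule_tac DERIV_cong) (auto simp: stein_sol_eq_right algebra_simps)
qed

lemma stein_sol_continuous: "continuous_on UNIV (stein_sol z)"
proof -
  have m: "continuous_on A mills" "continuous_on A (\<lambda>w. mills (- w))" for A
    using mills_deriv mills_minus_deriv
    by (meson DERIV_isCont continuous_at_imp_continuous_on)+
  have "continuous_on ({..z} \<union> {z..}) (\<lambda>w. if w \<le> z then normal_tail z * mills (- w) else (1 - normal_tail z) * mills w)"
    by (intro continuous_on_If continuous_intros m)
       (auto simp: mills_def normal_tail_minus std_normal_density_minus)
  moreover have "{..z} \<union> {z..} = UNIV" by auto
  ultimately show ?thesis by (simp add: stein_sol_def[abs_def])
qed

text \<open>A bound for the slope of \<open>w * stein_sol z w\<close> that is valid on all of
  \<open>{..y}\<close>. Left of \<open>z\<close> the slope carries the small factor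
  \<open>normal_tail z\<close>, which is what makes the final error relative; right of \<open>z\<close>
  it is only bounded, and the indicator records that this case occurs.\<close>
definition stein_env :: "real \<Rightarrow> real \<Rightarrow> real" where
  "stein_env z y = 13 * (normal_tail z * ((1 + (max 0 (min y z))\<^sup>2) * exp ((max 0 (min y z))\<^sup>2 / 2)) + of_bool (z < y))"

lemma stein_env_nonneg: "0 \<le> stein_env z y"
  unfolding stein_env_def using normal_tail_nonneg[of z] by (auto intro!: add_nonneg_nonneg mult_nonneg_nonneg)

lemma stein_slope_bound:
  assumes "-1 \<le> z" "w \<noteq> z" "w \<le> y"
  shows "\<exists>D. ((\<lambda>w. w * stein_sol z w) has_real_derivative D) (at w) \<and> \<bar>D\<bar> \<le> stein_env z y"
proof -
  have D: "((\<lambda>w. w * stein_sol z w) has_real_derivative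
      1 * stein_sol z w + (w * stein_sol z w + normal_tail z - of_bool (z < w)) * w) (at w)"
    by (intro DERIV_mult DERIV_ident stein_sol_deriv assms)
  have "\<bar>1 * stein_sol z w + (w * stein_sol z w + normal_tail z - of_bool (z < w)) * w\<bar> \<le> stein_env z y"
  proof (cases "w < z")
    case True
    define m where "m = max 0 (min y z)"
    have m: "max w 0 \<le> m" using True assms by (auto simp: m_def)
    have "1 * stein_sol z w + (w * stein_sol z w + normal_tail z - of_bool (z < w)) * w =
      normal_tail z * ((1 + w\<^sup>2) * mills (- w) + w)"
      using True by (simp add: stein_sol_eq_left algebra_simps power2_eq_square)
    also have "\<bar>\<dots>\<bar> = normal_tail z * \<bar>(1 + w\<^sup>2) * mills (- w) + w\<bar>"
      by (simp add: abs_mult normal_tail_nonneg)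
    also have "\<dots> \<le> normal_tail z * (13 * ((1 + (max w 0)\<^sup>2) * exp ((max w 0)\<^sup>2 / 2)))"
      by (intro mult_left_mono mills_minus_slope_bound normal_tail_nonneg)
    also have "\<dots> \<le> normal_tail z * (13 * ((1 + m\<^sup>2) * exp (m\<^sup>2 / 2)))"
    proof -
      have "(max w 0)\<^sup>2 \<le> m\<^sup>2" using m by (intro power_mono) auto
      then show ?thesis by (intro mult_left_mono mult_mono normal_tail_nonneg) auto
    qed
    also have "\<dots> \<le> stein_env z y" by (simp add: stein_env_def m_def)
    finally show ?thesis .
  next
    case False
    then have w: "z < w" using assms by auto
    have "1 * stein_sol z w + (w * stein_sol z w + normal_tail z - of_bool (z < w)) * w =
      (1 - normal_tail z) * ((1 + w\<^sup>2) * mills w - w)"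
      using w by (simp add: stein_sol_eq_right algebra_simps power2_eq_square)
    also have "\<bar>\<dots>\<bar> = (1 - normal_tail z) * \<bar>(1 + w\<^sup>2) * mills w - w\<bar>"
      by (simp add: abs_mult normal_tail_le_1)
    also have "\<dots> \<le> 1 * 13"
      using w assms normal_tail_nonneg[of z] normal_tail_le_1[of z]
      by (intro mult_mono mills_slope_bound) auto
    also have "\<dots> \<le> stein_env z y"
      using w assms normal_tail_nonneg[of z] by (simp add: stein_env_def)
    finally show ?thesis .
  qed
  with D show ?thesis by blast
qed

text \<open>Mean value inequality for a continuous function with one kink.\<close>
lemma increment_le_off_point:
  fixes g :: "real \<Rightarrow> real"
  assumes "a \<le> b" and cont: "continuous_on UNIV g"
    and der: "\<And>x. a < x \<Longrightarrow> x < b \<Longrightarrow> x \<noteq> z \<Longrightarrow> \<exists>D. (g has_real_derivative D) (at x) \<and> D \<le> c"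
  shows "g b - g a \<le> c * (b - a)"
proof -
  have piece: "g v - g u \<le> c * (v - u)" if "a \<le> u" "u \<le> v" "v \<le> b" "v \<le> z \<or> z \<le> u" for u v
  proof (cases "u < v")
    case True
    have dg: "\<exists>D. (g has_real_derivative D) (at x) \<and> D \<le> c" if "u < x" "x < v" for x
      using der[of x] that \<open>a \<le> u\<close> \<open>v \<le> b\<close> \<open>v \<le> z \<or> z \<le> u\<close> by auto
    then obtain l x where x: "u < x" "x < v" "(g has_real_derivative l) (at x)" "g v - g u = (v - u) * l"
      using MVT[OF True continuous_on_subset[OF cont]] by (metis real_differentiable_def subset_UNIV)
    then have "l \<le> c" using dg[of x] DERIV_unique by blast
    then show ?thesis using x True by (simp add: mult.commute mult_left_mono)
  qed (use that in auto)
  show ?thesis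
  proof (cases "a < z \<and> z < b")
    case True
    then have "g z - g a \<le> c * (z - a)" "g b - g z \<le> c * (b - z)" by (intro piece; auto)+
    then show ?thesis by (simp add: algebra_simps)
  next
    case False
    then show ?thesis using assms(1) by (intro piece) auto
  qed
qed

lemma stein_prod_lipschitz:
  assumes z: "-1 \<le> z" and uv: "u \<le> y" "v \<le> y"
  shows "\<bar>u * stein_sol z u - v * stein_sol z v\<bar> \<le> stein_env z y * \<bar>u - v\<bar>"
proof -
  have cont: "continuous_on UNIV (\<lambda>w. w * stein_sol z w)"
    by (intro continuous_intros stein_sol_continuous)
  have *: "\<bar>b * stein_sol z b - a * stein_sol z a\<bar> \<le> stein_env z y * (b - a)" if ab: "a \<le> b" "b \<le> y" for a b
  proof -
    have "b * stein_sol z b - a * stein_sol z a \<le> stein_env z y * (b - a)"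
    proof (intro increment_le_off_point[where g = "\<lambda>w. w * stein_sol z w" and z = z] cont ab(1))
      fix x assume "a < x" "x < b" "x \<noteq> z"
      then show "\<exists>D. ((\<lambda>w. w * stein_sol z w) has_real_derivative D) (at x) \<and> D \<le> stein_env z y"
        using stein_slope_bound[OF z, of x y] ab by (auto simp: abs_le_iff)
    qed
    moreover have "- (b * stein_sol z b) - - (a * stein_sol z a) \<le> stein_env z y * (b - a)"
    proof (intro increment_le_off_point[where g = "\<lambda>w. - (w * stein_sol z w)" and z = z]
        continuous_on_minus cont ab(1))
      fix x assume "a < x" "x < b" "x \<noteq> z"
      then obtain D where "((\<lambda>w. w * stein_sol z w) has_real_derivative D) (at x)" "\<bar>D\<bar> \<le> stein_env z y"
        using stein_slope_bound[OF z, of x y] ab by auto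
      then show "\<exists>D. ((\<lambda>w. - (w * stein_sol z w)) has_real_derivative D) (at x) \<and> D \<le> stein_env z y"
        by (intro exI[of _ "- D"]) (auto intro!: DERIV_minus)
    qed
    ultimately show ?thesis by (simp add: abs_le_iff)
  qed
  show ?thesis using *[of u v] *[of v u] uv by (cases "u \<le> v") (auto simp: abs_minus_commute)
qed

text \<open>Stein's equation integrated over an interval of length at most \<open>d\<close>: on that
  interval \<open>w * stein_sol z w\<close> varies by at most \<open>d\<close> times the
  envelope and the indicator of \<open>{z<..}\<close> is squeezed between the indicators of the shifted
  half-lines. The factor \<open>y\<close> makes both bounds independent of the sign of \<open>y\<close>.\<close>
lemma stein_increment:
  assumes z: "-1 \<le> z" and y: "\<bar>y\<bar> \<le> d"
  shows "y * (stein_sol z (w + y) - stein_sol z w) \<le>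
      y\<^sup>2 * (w * stein_sol z w + d * stein_env z (w + d) + normal_tail z - of_bool (z + d < w))" (is "_ \<le> y\<^sup>2 * ?U")
    and "y\<^sup>2 * (w * stein_sol z w - d * stein_env z (w + d) + normal_tail z - of_bool (z - d < w)) \<le>
      y * (stein_sol z (w + y) - stein_sol z w)" (is "y\<^sup>2 * ?L \<le> _")
proof -
  have der: "\<exists>D. (stein_sol z has_real_derivative D) (at x) \<and> ?L \<le> D \<and> D \<le> ?U"
    if x: "x \<noteq> z" "\<bar>x - w\<bar> \<le> d" for x
  proof -
    have "\<bar>x * stein_sol z x - w * stein_sol z w\<bar> \<le> stein_env z (w + d) * \<bar>x - w\<bar>"
      using x by (intro stein_prod_lipschitz z) auto
    also have "\<dots> \<le> stein_env z (w + d) * d" using x stein_env_nonneg by (intro mult_left_mono) auto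
    finally have "\<bar>x * stein_sol z x - w * stein_sol z w\<bar> \<le> d * stein_env z (w + d)" by (simp add: mult.commute)
    then have "?L \<le> x * stein_sol z x + normal_tail z - of_bool (z < x)"
      "x * stein_sol z x + normal_tail z - of_bool (z < x) \<le> ?U"
      using x by (auto simp: abs_le_iff)
    with stein_sol_deriv[OF x(1)] show ?thesis by blast
  qed
  have up: "stein_sol z b - stein_sol z a \<le> ?U * (b - a)"
    and lo: "- stein_sol z b - - stein_sol z a \<le> - ?L * (b - a)"
    if "w - d \<le> a" "a \<le> b" "b \<le> w + d" for a b
  proof -
    have d: "\<exists>D. (stein_sol z has_real_derivative D) (at x) \<and> ?L \<le> D \<and> D \<le> ?U"
      if "a < x" "x < b" "x \<noteq> z" for x
      using that \<open>w - d \<le> a\<close> \<open>b \<le> w + d\<close> by (intro der) auto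
    show "stein_sol z b - stein_sol z a \<le> ?U * (b - a)"
      using d by (intro increment_le_off_point[where z = z] stein_sol_continuous that) blast
    show "- stein_sol z b - - stein_sol z a \<le> - ?L * (b - a)"
    proof (intro increment_le_off_point[where z = z and g = "\<lambda>x. - stein_sol z x"]
        continuous_on_minus stein_sol_continuous that)
      fix x assume "a < x" "x < b" "x \<noteq> z"
      then obtain D where "(stein_sol z has_real_derivative D) (at x)" "?L \<le> D" using d by blast
      then show "\<exists>D. ((\<lambda>x. - stein_sol z x) has_real_derivative D) (at x) \<and> D \<le> - ?L"
        by (intro exI[of _ "- D"]) (auto intro!: DERIV_minus)
    qed
  qed
  have "y * (stein_sol z (w + y) - stein_sol z w) \<le> y\<^sup>2 * ?U \<and>
        y\<^sup>2 * ?L \<le> y * (stein_sol z (w + y) - stein_sol z w)"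
  proof -
    define U L where "U = ?U" and "L = ?L"
    note up = up[folded U_def] and lo = lo[folded L_def]
    have "y * (stein_sol z (w + y) - stein_sol z w) \<le> y\<^sup>2 * U \<and>
        y\<^sup>2 * L \<le> y * (stein_sol z (w + y) - stein_sol z w)"
  proof (cases "0 \<le> y")
    case True
    with y up[of w "w + y"] lo[of w "w + y"]
    have "stein_sol z (w + y) - stein_sol z w \<le> U * y" "L * y \<le> stein_sol z (w + y) - stein_sol z w"
      by simp_all
    from this[THEN mult_left_mono, OF True] show ?thesis by (simp only: power2_eq_square mult_ac)
  next
    case False
    with y up[of "w + y" w] lo[of "w + y" w]
    have "stein_sol z w - stein_sol z (w + y) \<le> U * (- y)" "L * (- y) \<le> stein_sol z w - stein_sol z (w + y)"
      by simp_all
    from this[THEN mult_left_mono, of "- y"] False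
    have "- y * (stein_sol z w - stein_sol z (w + y)) \<le> - y * (U * (- y))"
      "- y * (L * (- y)) \<le> - y * (stein_sol z w - stein_sol z (w + y))" by auto
    moreover have "- y * (stein_sol z w - stein_sol z (w + y)) = y * (stein_sol z (w + y) - stein_sol z w)"
      by (simp add: algebra_simps)
    moreover have "- y * (c * (- y)) = y\<^sup>2 * c" for c by (simp add: power2_eq_square)
    ultimately show ?thesis by metis
  qed
    then show ?thesis by (simp only: U_def L_def)
  qed
  then show "y * (stein_sol z (w + y) - stein_sol z w) \<le> y\<^sup>2 * ?U"
    "y\<^sup>2 * ?L \<le> y * (stein_sol z (w + y) - stein_sol z w)" by blast+
qed

section \<open>Moderate deviations for sums of bounded independent variables\<close>

lemma exp_le_cubic:
  fixes y :: real assumes "\<bar>y\<bar> \<le> 1" shows "exp y \<le> 1 + y + y\<^sup>2 / 2 + \<bar>y\<bar> ^ 3"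
proof -
  obtain t where t: "\<bar>t\<bar> \<le> \<bar>y\<bar>" "exp y = (\<Sum>m<3. y ^ m / fact m) + exp t / fact 3 * y ^ 3"
    using Maclaurin_exp_le[of y 3] by blast
  have "exp t \<le> exp 1" using t assms by simp
  then have "exp t \<le> 3" using exp_le by linarith
  moreover have "fact 3 = (6::real)" by (simp add: eval_nat_numeral)
  ultimately have "\<bar>exp t / fact 3\<bar> \<le> 1" by simp
  then have "\<bar>exp t / fact 3\<bar> * \<bar>y ^ 3\<bar> \<le> 1 * \<bar>y ^ 3\<bar>" by (rule mult_right_mono) simp
  then have "exp t / fact 3 * y ^ 3 \<le> \<bar>y\<bar> ^ 3"
    using abs_ge_self[of "exp t / fact 3 * y ^ 3"] by (simp only: abs_mult[of "exp t / fact 3" "y ^ 3"] power_abs)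
  moreover have "(\<Sum>m<3. y ^ m / fact m) = 1 + y + y\<^sup>2 / 2" by (simp add: eval_nat_numeral)
  ultimately show ?thesis using t(2) by linarith
qed

context prob_space
begin

abbreviation exceed :: "('a \<Rightarrow> real) \<Rightarrow> real \<Rightarrow> 'a set" where
  "exceed W c \<equiv> {\<omega> \<in> space M. c < W \<omega>}"

lemma integrable_continuous_bounded:
  fixes g :: "real \<Rightarrow> real"
  assumes V[measurable]: "random_variable borel V" and bd: "\<And>\<omega>. \<bar>V \<omega>\<bar> \<le> B" and g: "continuous_on UNIV g"
  shows "integrable M (\<lambda>\<omega>. g (V \<omega>))"
proof -
  have "compact (g ` {-B..B})" by (intro compact_continuous_image continuous_on_subset[OF g]) auto
  then obtain C where C: "\<And>x. x \<in> {-B..B} \<Longrightarrow> \<bar>g x\<bar> \<le> C"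
    by (meson bounded_real compact_imp_bounded imageI)
  have [measurable]: "g \<in> borel_measurable borel" using g by (rule borel_measurable_continuous_onI)
  show ?thesis
  proof (rule integrable_const_bound[where B = C])
    have "V \<omega> \<in> {-B..B}" for \<omega> using bd[of \<omega>] by (auto simp: abs_le_iff)
    then show "AE x in M. norm (g (V x)) \<le> C" using C by simp
  qed measurable
qed

text \<open>Third-order expansion of the exponential: the moment generating function is Gaussian up to
  \<open>exp (s\<^sup>3 d)\<close>, which stays bounded as long as \<open>s\<close> is of order
  \<open>d\<^sup>-\<^sup>1\<^sup>/\<^sup>3\<close>. This is where the cube in the moderate deviation range
  comes from.\<close>
lemma indep_sum_mgf_le:
  fixes Y :: "'i \<Rightarrow> 'a \<Rightarrow> real"
  assumes J: "finite J" and indep: "indep_vars (\<lambda>_. borel) Y J"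
    and bd: "\<And>i \<omega>. i \<in> J \<Longrightarrow> \<bar>Y i \<omega>\<bar> \<le> d"
    and mean: "\<And>i. i \<in> J \<Longrightarrow> expectation (Y i) = 0"
    and var: "(\<Sum>i\<in>J. expectation (\<lambda>\<omega>. (Y i \<omega>)\<^sup>2)) \<le> 1"
    and s: "0 \<le> s" "0 \<le> d" "s * d \<le> 1"
  shows "expectation (\<lambda>\<omega>. exp (s * (\<Sum>i\<in>J. Y i \<omega>))) \<le> exp (s\<^sup>2 / 2 + s ^ 3 * d)"
proof -
  have rv[measurable]: "random_variable borel (Y i)" if "i \<in> J" for i
    using indep that by (simp add: indep_vars_def)
  have bdd_int: "integrable M (\<lambda>\<omega>. g (Y i \<omega>))"
    if "i \<in> J" and "continuous_on UNIV g" for i and g :: "real \<Rightarrow> real"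
    using that by (intro integrable_continuous_bounded[OF rv bd])
  have one: "expectation (\<lambda>\<omega>. exp (s * Y i \<omega>)) \<le> exp (expectation (\<lambda>\<omega>. (Y i \<omega>)\<^sup>2) * (s\<^sup>2 / 2 + s ^ 3 * d))"
    if i: "i \<in> J" for i
  proof -
    have pw: "exp (s * Y i \<omega>) \<le> 1 + s * Y i \<omega> + (s\<^sup>2 / 2 + s ^ 3 * d) * (Y i \<omega>)\<^sup>2" for \<omega>
    proof -
      have "\<bar>s * Y i \<omega>\<bar> \<le> s * d" using bd[OF i] s by (simp add: abs_mult mult_left_mono)
      then have "exp (s * Y i \<omega>) \<le> 1 + s * Y i \<omega> + (s * Y i \<omega>)\<^sup>2 / 2 + \<bar>s * Y i \<omega>\<bar> ^ 3"
        using s by (intro exp_le_cubic) auto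
      also have "\<bar>s * Y i \<omega>\<bar> ^ 3 = s ^ 3 * (Y i \<omega>)\<^sup>2 * \<bar>Y i \<omega>\<bar>"
        using s by (simp add: abs_mult power_mult_distrib eval_nat_numeral)
      also have "\<dots> \<le> s ^ 3 * (Y i \<omega>)\<^sup>2 * d" using bd[OF i] s by (intro mult_left_mono) auto
      finally show ?thesis by (simp add: algebra_simps power_mult_distrib)
    qed
    have "expectation (\<lambda>\<omega>. exp (s * Y i \<omega>)) \<le> expectation (\<lambda>\<omega>. 1 + s * Y i \<omega> + (s\<^sup>2 / 2 + s ^ 3 * d) * (Y i \<omega>)\<^sup>2)"
      using pw i by (intro integral_mono bdd_int[of _ "\<lambda>y. exp (s * y)"]
          bdd_int[of _ "\<lambda>y. 1 + s * y + (s\<^sup>2 / 2 + s ^ 3 * d) * y\<^sup>2"] continuous_intros) auto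
    also have "\<dots> = 1 + s * expectation (Y i) + (s\<^sup>2 / 2 + s ^ 3 * d) * expectation (\<lambda>\<omega>. (Y i \<omega>)\<^sup>2)"
      using i bdd_int[OF i, of "\<lambda>y. y"] bdd_int[OF i, of "\<lambda>y. y\<^sup>2"]
      by (simp add: prob_space continuous_intros)
    also have "\<dots> \<le> exp (expectation (\<lambda>\<omega>. (Y i \<omega>)\<^sup>2) * (s\<^sup>2 / 2 + s ^ 3 * d))"
      using mean[OF i] exp_ge_add_one_self[of "expectation (\<lambda>\<omega>. (Y i \<omega>)\<^sup>2) * (s\<^sup>2 / 2 + s ^ 3 * d)"]
      by (simp add: mult.commute)
    finally show ?thesis .
  qed
  have ind: "indep_vars (\<lambda>_. borel) (\<lambda>i \<omega>. exp (s * Y i \<omega>)) J"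
    by (rule indep_vars_compose2[OF indep, of "\<lambda>_ y. exp (s * y)"]) simp
  have "expectation (\<lambda>\<omega>. exp (s * (\<Sum>i\<in>J. Y i \<omega>))) = expectation (\<lambda>\<omega>. \<Prod>i\<in>J. exp (s * Y i \<omega>))"
    by (simp add: sum_distrib_left exp_sum J)
  also have "\<dots> = (\<Prod>i\<in>J. expectation (\<lambda>\<omega>. exp (s * Y i \<omega>)))"
    by (intro indep_vars_lebesgue_integral J ind bdd_int[of _ "\<lambda>y. exp (s * y)"] continuous_intros)
  also have "\<dots> \<le> (\<Prod>i\<in>J. exp (expectation (\<lambda>\<omega>. (Y i \<omega>)\<^sup>2) * (s\<^sup>2 / 2 + s ^ 3 * d)))"
    using one by (intro prod_mono) auto
  also have "\<dots> = exp ((\<Sum>i\<in>J. expectation (\<lambda>\<omega>. (Y i \<omega>)\<^sup>2)) * (s\<^sup>2 / 2 + s ^ 3 * d))"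
    by (simp add: exp_sum[OF J] sum_distrib_right)
  also have "\<dots> \<le> exp (1 * (s\<^sup>2 / 2 + s ^ 3 * d))"
    using var s by (intro iffD2[OF exp_le_cancel_iff] mult_right_mono) auto
  finally show ?thesis by simp
qed

end

text \<open>The factor \<open>exp (m\<^sup>2 / 2)\<close> is the upper envelope of the exponentials
  \<open>exp (k y - k\<^sup>2 / 2)\<close>, and integer \<open>k\<close> suffice up to the factor
  \<open>exp (1 / 2)\<close>. Each exponential has a bounded mean under a
  nearly Gaussian law, whereas \<open>exp (m\<^sup>2 / 2)\<close> itself is not integrable under
  the Gaussian law.\<close>
lemma exp_square_le_sum:
  assumes "0 \<le> m" "m \<le> real K" "m \<le> max 0 y"
  shows "(1 + m\<^sup>2) * exp (m\<^sup>2 / 2) \<le> 1 + (\<Sum>k=1..K. (1 + (real k)\<^sup>2) * exp (1/2 - (real k)\<^sup>2 / 2 + real k * y))"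
proof (cases "m = 0")
  case True
  have "0 \<le> (\<Sum>k=1..K. (1 + (real k)\<^sup>2) * exp (1/2 - (real k)\<^sup>2 / 2 + real k * y))"
    by (intro sum_nonneg) auto
  with True show ?thesis by simp
next
  case False
  then have m: "0 < m" "m \<le> y" using assms by auto
  define k where "k = nat \<lceil>m\<rceil>"
  have k: "m \<le> real k" "real k < m + 1" unfolding k_def using m by linarith+
  have kK: "k \<in> {1..K}"
  proof -
    have "0 < real k" "real k < real K + 1" using k m assms(2) by linarith+
    then show ?thesis by auto
  qed
  have "(real k - m)\<^sup>2 \<le> 1\<^sup>2" using k by (intro power_mono) auto
  then have "m\<^sup>2 / 2 \<le> 1/2 - (real k)\<^sup>2 / 2 + real k * m" by (simp add: power2_eq_square algebra_simps)
  also have "\<dots> \<le> 1/2 - (real k)\<^sup>2 / 2 + real k * y" using m by (simp add: mult_left_mono)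
  finally have "exp (m\<^sup>2 / 2) \<le> exp (1/2 - (real k)\<^sup>2 / 2 + real k * y)" by simp
  moreover have "m\<^sup>2 \<le> (real k)\<^sup>2" using k m by (intro power_mono) auto
  ultimately have "(1 + m\<^sup>2) * exp (m\<^sup>2 / 2) \<le> (1 + (real k)\<^sup>2) * exp (1/2 - (real k)\<^sup>2 / 2 + real k * y)"
    by (intro mult_mono) auto
  also have "\<dots> \<le> (\<Sum>k=1..K. (1 + (real k)\<^sup>2) * exp (1/2 - (real k)\<^sup>2 / 2 + real k * y))"
    using kK by (intro member_le_sum[where f = "\<lambda>k. (1 + (real k)\<^sup>2) * exp (1/2 - (real k)\<^sup>2 / 2 + real k * y)"]) auto
  finally show ?thesis by simp
qed

lemma stein_env_le:
  fixes z y :: real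
  defines "p \<equiv> max z 0"
  assumes K: "p \<le> real K"
  shows "stein_env z y \<le> 13 * (normal_tail z * (1 + (\<Sum>k=1..K. (1 + (real k)\<^sup>2) * exp (1/2 - (real k)\<^sup>2 / 2 + real k * y)))
     + exp (p * y - p\<^sup>2))"
proof -
  have "(1 + (max 0 (min y z))\<^sup>2) * exp ((max 0 (min y z))\<^sup>2 / 2) \<le>
     1 + (\<Sum>k=1..K. (1 + (real k)\<^sup>2) * exp (1/2 - (real k)\<^sup>2 / 2 + real k * y))"
    using K by (intro exp_square_le_sum) (auto simp: p_def)
  moreover have "of_bool (z < y) \<le> exp (p * y - p\<^sup>2)"
  proof (cases "z < y")
    case True
    then have "0 \<le> p * (y - p)" by (auto simp: p_def max_def)
    then have "1 \<le> exp (p * (y - p))" by simp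
    with True show ?thesis by (simp add: power2_eq_square right_diff_distrib)
  qed simp
  ultimately show ?thesis
    unfolding stein_env_def using normal_tail_nonneg[of z] by (intro mult_left_mono add_mono) auto
qed

lemma stein_env_measurable[measurable]: "stein_env z \<in> borel_measurable borel"
  unfolding stein_env_def by measurable

lemma stein_env_bounded:
  "stein_env z y \<le> 13 * (normal_tail z * ((1 + (max 0 z)\<^sup>2) * exp ((max 0 z)\<^sup>2 / 2)) + 1)"
proof -
  have "(max 0 (min y z))\<^sup>2 \<le> (max 0 z)\<^sup>2" by (intro power_mono) auto
  then show ?thesis
    unfolding stein_env_def using normal_tail_nonneg[of z]
    by (intro mult_left_mono add_mono mult_mono) auto
qed

lemma exp_minus_le_normal_tail: "0 \<le> p \<Longrightarrow> exp (- p\<^sup>2 / 2) \<le> 12 * (1 + p) * normal_tail p"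
proof -
  assume p: "0 \<le> p"
  have "sqrt (2 * pi) \<le> 3"
    using pi_less_4 by (intro real_le_lsqrt) auto
  have "exp (- p\<^sup>2 / 2) = sqrt (2 * pi) * \<phi> p"
    by (simp add: std_normal_density_def)
  also have "\<dots> \<le> 3 * (4 * max p 1 * normal_tail p)"
    using \<open>sqrt (2 * pi) \<le> 3\<close> density_le_normal_tail[OF p] by (intro mult_mono) auto
  also have "\<dots> = (12 * max p 1) * normal_tail p" by simp
  also have "\<dots> \<le> (12 * (1 + p)) * normal_tail p"
    using p by (intro mult_right_mono normal_tail_nonneg) auto
  finally show ?thesis .
qed

context prob_space
begin

text \<open>Each of the at most \<open>z + 1\<close> exponentials in \<open>exp_square_le_sum\<close>
  contributes \<open>O((1 + z)\<^sup>2)\<close>, and the probability of exceeding \<open>z\<close> is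
  \<open>O(exp (- z\<^sup>2 / 2))\<close> by Chernoff's bound, hence \<open>O((1 + z) T(z))\<close>.\<close>
lemma expectation_stein_env_le:
  fixes V :: "'a \<Rightarrow> real"
  defines "p z \<equiv> max z 0"
  assumes V[measurable]: "random_variable borel V" and bd: "\<And>\<omega>. \<bar>V \<omega>\<bar> \<le> B"
    and mgf: "\<And>s. 0 \<le> s \<Longrightarrow> s \<le> p z + 1 \<Longrightarrow> expectation (\<lambda>\<omega>. exp (s * V \<omega>)) \<le> 9 * exp (s\<^sup>2 / 2)"
  shows "expectation (\<lambda>\<omega>. stein_env z (V \<omega>)) \<le> 2000 * (1 + p z) ^ 3 * normal_tail z"
proof -
  define P where "P = p z"
  have P0: "0 \<le> P" by (simp add: P_def p_def)
  define K where "K = nat \<lceil>P\<rceil>"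
  have K: "P \<le> real K" "real K \<le> P + 1" unfolding K_def using P0 by linarith+
  have int: "integrable M (\<lambda>\<omega>. exp (s * V \<omega>))" if "0 \<le> s" for s
  proof (rule integrable_const_bound[where B = "exp (s * B)"])
    show "AE x in M. norm (exp (s * V x)) \<le> exp (s * B)"
      using bd that by (auto intro!: mult_left_mono simp: abs_le_iff)
  qed simp
  define S where "S \<omega> = (\<Sum>k=1..K. ((1 + (real k)\<^sup>2) * exp (1/2 - (real k)\<^sup>2 / 2)) * exp (real k * V \<omega>))" for \<omega>
  have S: "integrable M S" unfolding S_def by (intro Bochner_Integration.integrable_sum integrable_mult_right int) auto
  have ES: "expectation S = (\<Sum>k=1..K. ((1 + (real k)\<^sup>2) * exp (1/2 - (real k)\<^sup>2 / 2)) * expectation (\<lambda>\<omega>. exp (real k * V \<omega>)))"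
    unfolding S_def by (subst Bochner_Integration.integral_sum) (auto intro!: integrable_mult_right int)
  define Z where "Z \<omega> = 13 * (normal_tail z * (1 + S \<omega>) + exp (- P\<^sup>2) * exp (P * V \<omega>))" for \<omega>
  have "expectation (\<lambda>\<omega>. stein_env z (V \<omega>)) \<le> expectation Z"
  proof (rule integral_mono)
    show "integrable M (\<lambda>\<omega>. stein_env z (V \<omega>))"
      using stein_env_nonneg stein_env_bounded
      by (intro integrable_const_bound[where B = "13 * (normal_tail z * ((1 + (max 0 z)\<^sup>2) * exp ((max 0 z)\<^sup>2 / 2)) + 1)"]) auto
    show "integrable M Z" unfolding Z_def using S int[OF P0] by simp
    show "stein_env z (V \<omega>) \<le> Z \<omega>" for \<omega>
    proof -
      have "exp (P * V \<omega> - P\<^sup>2) = exp (- P\<^sup>2) * exp (P * V \<omega>)" by (simp flip: exp_add)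
      with stein_env_le[of z K "V \<omega>"] K show ?thesis
        by (simp only: Z_def S_def P_def p_def exp_add mult.assoc)
    qed
  qed
  also have "expectation Z = 13 * (normal_tail z * (1 + (\<Sum>k=1..K. ((1 + (real k)\<^sup>2) * exp (1/2 - (real k)\<^sup>2 / 2)) * expectation (\<lambda>\<omega>. exp (real k * V \<omega>))))
     + exp (- P\<^sup>2) * expectation (\<lambda>\<omega>. exp (P * V \<omega>)))"
    unfolding Z_def using S int[OF P0] by (simp add: prob_space ES)
  also have "\<dots> \<le> 13 * (normal_tail z * (1 + (\<Sum>k=1..K. ((1 + (P + 1)\<^sup>2) * 18)))
     + 9 * (12 * (1 + P) * normal_tail z))"
  proof (intro mult_left_mono add_mono sum_mono normal_tail_nonneg order_refl)
    fix k assume k: "k \<in> {1..K}"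
    have "exp (1/2 - (real k)\<^sup>2 / 2) * expectation (\<lambda>\<omega>. exp (real k * V \<omega>)) \<le>
        exp (1/2 - (real k)\<^sup>2 / 2) * (9 * exp ((real k)\<^sup>2 / 2))"
      using k K by (intro mult_left_mono mgf) (auto simp: P_def)
    also have "\<dots> = 9 * exp (1 / 2)" by (simp flip: exp_add)
    also have "\<dots> \<le> 18" using exp_half_le by simp
    finally have *: "exp (1/2 - (real k)\<^sup>2 / 2) * expectation (\<lambda>\<omega>. exp (real k * V \<omega>)) \<le> 18" .
    have "(real k)\<^sup>2 \<le> (P + 1)\<^sup>2" using k K by (intro power_mono) auto
    then have "(1 + (real k)\<^sup>2) * (exp (1/2 - (real k)\<^sup>2 / 2) * expectation (\<lambda>\<omega>. exp (real k * V \<omega>))) \<le> (1 + (P + 1)\<^sup>2) * 18"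
      using * by (intro mult_mono) auto
    then show "(1 + (real k)\<^sup>2) * exp (1/2 - (real k)\<^sup>2 / 2) * expectation (\<lambda>\<omega>. exp (real k * V \<omega>)) \<le> (1 + (P + 1)\<^sup>2) * 18"
      by (simp add: mult.assoc)
  next
    have "exp (- P\<^sup>2) * expectation (\<lambda>\<omega>. exp (P * V \<omega>)) \<le> exp (- P\<^sup>2) * (9 * exp (P\<^sup>2 / 2))"
      using P0 by (intro mult_left_mono mgf) (auto simp: P_def)
    also have "\<dots> = 9 * exp (- P\<^sup>2 / 2)" by (simp flip: exp_add)
    also have "\<dots> \<le> 9 * (12 * (1 + P) * normal_tail P)" using exp_minus_le_normal_tail[OF P0] by simp
    also have "\<dots> \<le> 9 * (12 * (1 + P) * normal_tail z)"
      using P0 normal_tail_antimono[of z P] by (intro mult_left_mono) (auto simp: P_def p_def)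
    finally show "exp (- P\<^sup>2) * expectation (\<lambda>\<omega>. exp (P * V \<omega>)) \<le> 9 * (12 * (1 + P) * normal_tail z)" .
  qed simp_all
  also have "\<dots> = (13 * (1 + real K * ((1 + (P + 1)\<^sup>2) * 18) + 108 * (1 + P))) * normal_tail z"
    by (simp add: algebra_simps)
  also have "\<dots> \<le> (2000 * (1 + P) ^ 3) * normal_tail z"
  proof (intro mult_right_mono normal_tail_nonneg)
    define Q where "Q = 1 + P"
    have PQ: "1 + P = Q" "P + 1 = Q" by (simp_all add: Q_def)
    have Q: "1 \<le> Q" using P0 by (simp add: Q_def)
    then have Q2: "1 \<le> Q\<^sup>2" "Q \<le> Q ^ 3" "1 \<le> Q ^ 3" by (auto intro: self_le_power)
    have "real K * ((1 + (P + 1)\<^sup>2) * 18) \<le> Q * ((2 * Q\<^sup>2) * 18)"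
      using K Q2 Q by (intro mult_mono) (auto simp: Q_def add.commute)
    also have "\<dots> = 36 * Q ^ 3" by (simp add: eval_nat_numeral)
    finally have le36: "real K * ((1 + (P + 1)\<^sup>2) * 18) \<le> 36 * Q ^ 3" .
    show "13 * (1 + real K * ((1 + (P + 1)\<^sup>2) * 18) + 108 * (1 + P)) \<le> 2000 * (1 + P) ^ 3"
    proof -
      have "13 * (1 + t + 108 * Q) \<le> 2000 * Q ^ 3" if "t \<le> 36 * Q ^ 3" for t
        using that Q2(2,3) by argo
      then show ?thesis using le36 unfolding PQ by blast
    qed
  qed
  finally show ?thesis by (simp add: P_def)
qed

end

context prob_space
begin

text \<open>One summand \<open>Y\<close> against the sum \<open>V\<close> of all others. As \<open>Y\<close> is
  centred and independent of \<open>V\<close>, \<open>stein_sol z W\<close> may be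
  replaced by its increment from \<open>V\<close>; the weight \<open>Y\<^sup>2\<close> then
  factors out. One window \<open>d\<close> is spent on moving the indicator along the increment, and a
  second one on passing from \<open>V\<close> back to \<open>W\<close>.\<close>
lemma stein_one_step:
  fixes V Y :: "'a \<Rightarrow> real"
  assumes ind: "indep_var borel Y borel V" and z: "-1 \<le> z"
    and V: "\<And>\<omega>. \<bar>V \<omega>\<bar> \<le> B" and Y: "\<And>\<omega>. \<bar>Y \<omega>\<bar> \<le> d" and mean: "expectation Y = 0"
    and env: "expectation (\<lambda>\<omega>. stein_env z (V \<omega> + d)) \<le> h"
  defines "v \<equiv> expectation (\<lambda>\<omega>. (Y \<omega>)\<^sup>2)"
    and "W \<equiv> \<lambda>\<omega>. V \<omega> + Y \<omega>"
  shows "expectation (\<lambda>\<omega>. Y \<omega> * stein_sol z (W \<omega>)) \<le>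
      v * (expectation (\<lambda>\<omega>. W \<omega> * stein_sol z (W \<omega>)) + 2 * d * h + normal_tail z - prob (exceed W (z + 2 * d)))"
    and "v * (expectation (\<lambda>\<omega>. W \<omega> * stein_sol z (W \<omega>)) - 2 * d * h + normal_tail z - prob (exceed W (z - 2 * d)))
      \<le> expectation (\<lambda>\<omega>. Y \<omega> * stein_sol z (W \<omega>))"
proof -
  have rv[measurable]: "random_variable borel Y" "random_variable borel V"
    using indep_var_rv1[OF ind] indep_var_rv2[OF ind] by auto
  have Wm[measurable]: "random_variable borel W" unfolding W_def by measurable
  have d0: "0 \<le> d" using Y order_trans[OF abs_ge_zero] by blast
  have f[measurable]: "stein_sol z \<in> borel_measurable borel"
    by (rule borel_measurable_continuous_onI[OF stein_sol_continuous])
  have W: "\<bar>W \<omega>\<bar> \<le> B + d" for \<omega> using V[of \<omega>] Y[of \<omega>] by (auto simp: W_def)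
  note cont = stein_sol_continuous[THEN continuous_on_subset[OF _ subset_UNIV]]
  have qc: "continuous_on UNIV (\<lambda>w. w * stein_sol z w)" by (intro continuous_intros cont)
  have iV: "integrable M (\<lambda>\<omega>. V \<omega> * stein_sol z (V \<omega>))"
    and iW: "integrable M (\<lambda>\<omega>. W \<omega> * stein_sol z (W \<omega>))"
    and ifV: "integrable M (\<lambda>\<omega>. stein_sol z (V \<omega>))"
    and ifW: "integrable M (\<lambda>\<omega>. stein_sol z (W \<omega>))"
    and iY: "integrable M Y" and iY2: "integrable M (\<lambda>\<omega>. (Y \<omega>)\<^sup>2)"
    using integrable_continuous_bounded[OF rv(2) V qc] integrable_continuous_bounded[OF Wm W qc]
      integrable_continuous_bounded[OF rv(2) V cont] integrable_continuous_bounded[OF Wm W cont]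
      integrable_continuous_bounded[OF rv(1) Y, of "\<lambda>x. x"] integrable_continuous_bounded[OF rv(1) Y continuous_on_power[OF continuous_on_id], of 2]
    by (auto intro!: continuous_intros)
  have ienv: "integrable M (\<lambda>\<omega>. stein_env z (V \<omega> + d))"
    using stein_env_nonneg stein_env_bounded
    by (intro integrable_const_bound[where B = "13 * (normal_tail z * ((1 + (max 0 z)\<^sup>2) * exp ((max 0 z)\<^sup>2 / 2)) + 1)"]) auto
  have iYmul: "integrable M (\<lambda>\<omega>. Y \<omega> * g \<omega>)" if "integrable M g" for g
    using that Y by (intro Bochner_Integration.integrable_bound[of M "\<lambda>\<omega>. d * g \<omega>" "\<lambda>\<omega>. Y \<omega> * g \<omega>"])
      (auto simp: abs_mult intro!: mult_right_mono order_trans[OF Y abs_ge_self])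
  have prod0: "expectation (\<lambda>\<omega>. Y \<omega> * stein_sol z (V \<omega>)) = 0"
    using indep_var_lebesgue_integral[OF indep_var_compose[OF ind, of "\<lambda>x. x" borel "stein_sol z" borel]]
      iY ifV mean by (simp add: comp_def)
  have fac: "expectation (\<lambda>\<omega>. (Y \<omega>)\<^sup>2 * g (V \<omega>)) = v * expectation (\<lambda>\<omega>. g (V \<omega>))"
    and ifac: "integrable M (\<lambda>\<omega>. (Y \<omega>)\<^sup>2 * g (V \<omega>))"
    if "g \<in> borel_measurable borel" "integrable M (\<lambda>\<omega>. g (V \<omega>))" for g
    using indep_var_lebesgue_integral[OF indep_var_compose[OF ind, of "\<lambda>x. x\<^sup>2" borel g borel]]
      indep_var_integrable[OF indep_var_compose[OF ind, of "\<lambda>x. x\<^sup>2" borel g borel]] iY2 that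
    by (auto simp: comp_def v_def)
  have EY: "expectation (\<lambda>\<omega>. Y \<omega> * stein_sol z (W \<omega>)) =
      expectation (\<lambda>\<omega>. Y \<omega> * (stein_sol z (V \<omega> + Y \<omega>) - stein_sol z (V \<omega>)))"
    using iYmul[OF ifV] iYmul[OF ifW] prod0 by (simp add: right_diff_distrib W_def)
  have idiff: "integrable M (\<lambda>\<omega>. Y \<omega> * (stein_sol z (V \<omega> + Y \<omega>) - stein_sol z (V \<omega>)))"
    using iYmul[OF ifV] iYmul[OF ifW] by (simp add: right_diff_distrib W_def)
  have v0: "0 \<le> v" unfolding v_def by simp
  \<comment> \<open>Passing from \<open>V\<close> back to \<open>W\<close> inside \<open>w * stein_sol z w\<close>.\<close>
  have qdiff: "\<bar>expectation (\<lambda>\<omega>. W \<omega> * stein_sol z (W \<omega>)) - expectation (\<lambda>\<omega>. V \<omega> * stein_sol z (V \<omega>))\<bar> \<le> d * h"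
  proof -
    have pw: "\<bar>W \<omega> * stein_sol z (W \<omega>) - V \<omega> * stein_sol z (V \<omega>)\<bar> \<le> d * stein_env z (V \<omega> + d)" for \<omega>
    proof -
      have "\<bar>W \<omega> * stein_sol z (W \<omega>) - V \<omega> * stein_sol z (V \<omega>)\<bar> \<le> stein_env z (V \<omega> + d) * \<bar>W \<omega> - V \<omega>\<bar>"
        using Y[of \<omega>] by (intro stein_prod_lipschitz z) (auto simp: W_def)
      also have "\<dots> \<le> stein_env z (V \<omega> + d) * d"
        using Y[of \<omega>] stein_env_nonneg by (intro mult_left_mono) (auto simp: W_def)
      finally show ?thesis by (simp add: mult.commute)
    qed
    have "\<bar>expectation (\<lambda>\<omega>. W \<omega> * stein_sol z (W \<omega>)) - expectation (\<lambda>\<omega>. V \<omega> * stein_sol z (V \<omega>))\<bar> =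
      \<bar>expectation (\<lambda>\<omega>. W \<omega> * stein_sol z (W \<omega>) - V \<omega> * stein_sol z (V \<omega>))\<bar>"
      using iV iW by simp
    also have "\<dots> \<le> expectation (\<lambda>\<omega>. \<bar>W \<omega> * stein_sol z (W \<omega>) - V \<omega> * stein_sol z (V \<omega>)\<bar>)"
      by (rule integral_abs_bound)
    also have "\<dots> \<le> expectation (\<lambda>\<omega>. d * stein_env z (V \<omega> + d))"
      using iV iW ienv pw by (intro integral_mono) auto
    also have "\<dots> \<le> d * h" using env d0 ienv by (simp add: mult_left_mono)
    finally show ?thesis .
  qed
  have indic: "expectation (\<lambda>\<omega>. of_bool (c < V \<omega>)) = prob (exceed V c)"
    "integrable M (\<lambda>\<omega>. of_bool (c < V \<omega>) :: real)" for c
  proof -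
    have "expectation (\<lambda>\<omega>. of_bool (c < V \<omega>)) = expectation (indicat_real (exceed V c))"
      by (intro Bochner_Integration.integral_cong) (auto simp: indicator_def)
    then show "expectation (\<lambda>\<omega>. of_bool (c < V \<omega>)) = prob (exceed V c)" by simp
    show "integrable M (\<lambda>\<omega>. of_bool (c < V \<omega>) :: real)"
      by (intro integrable_const_bound[where B = 1]) auto
  qed
  show "expectation (\<lambda>\<omega>. Y \<omega> * stein_sol z (W \<omega>)) \<le>
      v * (expectation (\<lambda>\<omega>. W \<omega> * stein_sol z (W \<omega>)) + 2 * d * h + normal_tail z - prob (exceed W (z + 2 * d)))"
  proof -
    define g where "g w = w * stein_sol z w + d * stein_env z (w + d) + normal_tail z - of_bool (z + d < w)" for w
    have gm[measurable]: "g \<in> borel_measurable borel" unfolding g_def by measurable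
    have gi: "integrable M (\<lambda>\<omega>. g (V \<omega>))" unfolding g_def using iV ienv indic by auto
    have "prob (exceed W (z + 2 * d)) \<le> prob (exceed V (z + d))"
      using Y by (intro finite_measure_mono) (auto simp: W_def abs_le_iff intro: le_less_trans, smt (verit))
    moreover have "d * expectation (\<lambda>\<omega>. stein_env z (V \<omega> + d)) \<le> d * h" using env d0 by (rule mult_left_mono)
    moreover have "expectation (\<lambda>\<omega>. g (V \<omega>)) = expectation (\<lambda>\<omega>. V \<omega> * stein_sol z (V \<omega>))
        + d * expectation (\<lambda>\<omega>. stein_env z (V \<omega> + d)) + normal_tail z - prob (exceed V (z + d))"
      unfolding g_def using iV ienv indic by (simp add: prob_space)
    ultimately have "expectation (\<lambda>\<omega>. g (V \<omega>)) \<le> expectation (\<lambda>\<omega>. W \<omega> * stein_sol z (W \<omega>)) + 2 * d * h + normal_tail z - prob (exceed W (z + 2 * d))"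
      using qdiff unfolding abs_le_iff by linarith
    from mult_left_mono[OF this v0]
    have "v * expectation (\<lambda>\<omega>. g (V \<omega>)) \<le> v * (expectation (\<lambda>\<omega>. W \<omega> * stein_sol z (W \<omega>)) + 2 * d * h + normal_tail z - prob (exceed W (z + 2 * d)))" .
    moreover have "expectation (\<lambda>\<omega>. Y \<omega> * stein_sol z (W \<omega>)) \<le> expectation (\<lambda>\<omega>. (Y \<omega>)\<^sup>2 * g (V \<omega>))"
      unfolding EY using idiff ifac[OF gm gi] stein_increment(1)[OF z Y]
      by (intro integral_mono) (auto simp: g_def)
    ultimately show ?thesis using fac[OF gm gi] by simp
  qed
  show "v * (expectation (\<lambda>\<omega>. W \<omega> * stein_sol z (W \<omega>)) - 2 * d * h + normal_tail z - prob (exceed W (z - 2 * d)))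
      \<le> expectation (\<lambda>\<omega>. Y \<omega> * stein_sol z (W \<omega>))"
  proof -
    define g where "g w = w * stein_sol z w - d * stein_env z (w + d) + normal_tail z - of_bool (z - d < w)" for w
    have gm[measurable]: "g \<in> borel_measurable borel" unfolding g_def by measurable
    have gi: "integrable M (\<lambda>\<omega>. g (V \<omega>))" unfolding g_def using iV ienv indic by auto
    have "prob (exceed V (z - d)) \<le> prob (exceed W (z - 2 * d))"
      using Y by (intro finite_measure_mono) (auto simp: W_def abs_le_iff intro: le_less_trans, smt (verit))
    moreover have "d * expectation (\<lambda>\<omega>. stein_env z (V \<omega> + d)) \<le> d * h" using env d0 by (rule mult_left_mono)
    moreover have "expectation (\<lambda>\<omega>. g (V \<omega>)) = expectation (\<lambda>\<omega>. V \<omega> * stein_sol z (V \<omega>))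
        - d * expectation (\<lambda>\<omega>. stein_env z (V \<omega> + d)) + normal_tail z - prob (exceed V (z - d))"
      unfolding g_def using iV ienv indic by (simp add: prob_space)
    ultimately have "expectation (\<lambda>\<omega>. W \<omega> * stein_sol z (W \<omega>)) - 2 * d * h + normal_tail z - prob (exceed W (z - 2 * d)) \<le> expectation (\<lambda>\<omega>. g (V \<omega>))"
      using qdiff unfolding abs_le_iff by linarith
    from mult_left_mono[OF this v0]
    have "v * (expectation (\<lambda>\<omega>. W \<omega> * stein_sol z (W \<omega>)) - 2 * d * h + normal_tail z - prob (exceed W (z - 2 * d))) \<le> v * expectation (\<lambda>\<omega>. g (V \<omega>))" .
    moreover have "expectation (\<lambda>\<omega>. (Y \<omega>)\<^sup>2 * g (V \<omega>)) \<le> expectation (\<lambda>\<omega>. Y \<omega> * stein_sol z (W \<omega>))"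
      unfolding EY using idiff ifac[OF gm gi] stein_increment(2)[OF z Y]
      by (intro integral_mono) (auto simp: g_def)
    ultimately show ?thesis using fac[OF gm gi] by simp
  qed
qed

text \<open>Summing \<open>stein_one_step\<close> over all summands gives the mean of
  \<open>W * stein_sol z W\<close> on both sides, so that it cancels and only the
  probability, the normal tail and the envelope remain. The case \<open>-1 \<le> z < 0\<close> is included
  because thresholds near 0 are shifted to the left later.\<close>
theorem bounded_sum_moderate_deviation:
  fixes Y :: "'i \<Rightarrow> 'a \<Rightarrow> real"
  assumes I: "finite I" and indep: "indep_vars (\<lambda>_. borel) Y I"
    and bd: "\<And>i \<omega>. i \<in> I \<Longrightarrow> \<bar>Y i \<omega>\<bar> \<le> d"
    and mean: "\<And>i. i \<in> I \<Longrightarrow> expectation (Y i) = 0"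
    and var: "(\<Sum>i\<in>I. expectation (\<lambda>\<omega>. (Y i \<omega>)\<^sup>2)) = 1"
    and z: "-1 \<le> z" and d: "0 \<le> d" "d * (1 + max z 0) ^ 3 \<le> 1"
  defines "W \<equiv> \<lambda>\<omega>. \<Sum>i\<in>I. Y i \<omega>"
  shows "prob (exceed W (z + 2 * d)) \<le> normal_tail z * (1 + 4000 * d * (1 + max z 0) ^ 3)"
    and "normal_tail z * (1 - 4000 * d * (1 + max z 0) ^ 3) \<le> prob (exceed W (z - 2 * d))"
proof -
  define P where "P = max z 0"
  have P: "1 \<le> 1 + P" by (simp add: P_def)
  define h where "h = 2000 * (1 + P) ^ 3 * normal_tail z"
  define v where "v i = expectation (\<lambda>\<omega>. (Y i \<omega>)\<^sup>2)" for i
  define V where "V i \<omega> = (\<Sum>j\<in>I - {i}. Y j \<omega>)" for i \<omega>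
  define Q where "Q = expectation (\<lambda>\<omega>. W \<omega> * stein_sol z (W \<omega>))"
  have rv[measurable]: "random_variable borel (Y i)" if "i \<in> I" for i
    using indep that by (simp add: indep_vars_def)
  have Wm[measurable]: "random_variable borel W" unfolding W_def by measurable
  have Wbd: "\<bar>W \<omega>\<bar> \<le> real (card I) * d" for \<omega>
    unfolding W_def using bd by (intro order_trans[OF sum_abs] sum_bounded_above) auto
  have step: "expectation (\<lambda>\<omega>. Y i \<omega> * stein_sol z (W \<omega>)) \<le>
      v i * (Q + 2 * d * h + normal_tail z - prob (exceed W (z + 2 * d))) \<and>
      v i * (Q - 2 * d * h + normal_tail z - prob (exceed W (z - 2 * d))) \<le>
      expectation (\<lambda>\<omega>. Y i \<omega> * stein_sol z (W \<omega>))" if i: "i \<in> I" for i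
  proof -
    have ins: "insert i (I - {i}) = I" using i by auto
    have ind: "indep_var borel (Y i) borel (V i)"
      unfolding V_def using indep_vars_sum[of "I - {i}" i Y, unfolded ins] I indep by simp
    have WV: "W = (\<lambda>\<omega>. V i \<omega> + Y i \<omega>)"
      unfolding W_def V_def using I i by (simp add: sum.remove add.commute)
    have Vbd: "\<bar>V i \<omega>\<bar> \<le> real (card (I - {i})) * d" for \<omega>
      unfolding V_def using bd by (intro order_trans[OF sum_abs] sum_bounded_above) auto
    have Vm[measurable]: "random_variable borel (V i)" unfolding V_def by measurable
    have "expectation (\<lambda>\<omega>. stein_env z (V i \<omega> + d)) \<le> 2000 * (1 + max z 0) ^ 3 * normal_tail z"
    proof (rule expectation_stein_env_le)
      show "random_variable borel (\<lambda>\<omega>. V i \<omega> + d)" by measurable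
      show "\<bar>V i \<omega> + d\<bar> \<le> real (card (I - {i})) * d + d" for \<omega> using Vbd[of \<omega>] d by auto
      fix s assume s: "0 \<le> s" "s \<le> max z 0 + 1"
      have "s ^ 3 * d \<le> (1 + P) ^ 3 * d" using s d by (intro mult_right_mono power_mono) (auto simp: P_def)
      then have s3: "s ^ 3 * d \<le> 1" using d by (simp add: P_def mult.commute)
      have "s * d \<le> (1 + P) * d" using s d by (intro mult_right_mono) (auto simp: P_def)
      also have "\<dots> \<le> (1 + P) ^ 3 * d" using P d by (intro mult_right_mono self_le_power) auto
      finally have s1: "s * d \<le> 1" using d by (simp add: P_def mult.commute)
      have "(\<Sum>j\<in>I - {i}. expectation (\<lambda>\<omega>. (Y j \<omega>)\<^sup>2)) \<le> (\<Sum>j\<in>I. expectation (\<lambda>\<omega>. (Y j \<omega>)\<^sup>2))"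
        using I by (intro sum_mono2) auto
      then have "expectation (\<lambda>\<omega>. exp (s * V i \<omega>)) \<le> exp (s\<^sup>2 / 2 + s ^ 3 * d)"
        unfolding V_def using I indep bd mean var s s1 d
        by (intro indep_sum_mgf_le) (auto intro: indep_vars_subset)
      then have "exp (s * d) * expectation (\<lambda>\<omega>. exp (s * V i \<omega>)) \<le> exp (s * d) * exp (s\<^sup>2 / 2 + s ^ 3 * d)"
        by simp
      also have "\<dots> = exp (s * d + s ^ 3 * d) * exp (s\<^sup>2 / 2)" by (simp flip: exp_add add: add_ac)
      also have "\<dots> \<le> 9 * exp (s\<^sup>2 / 2)"
      proof (rule mult_right_mono)
        have "exp (s * d + s ^ 3 * d) \<le> exp (1 + 1)" using s1 s3 by simp
        also have "\<dots> = exp 1 * exp (1::real)" by (rule exp_add)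
        also have "\<dots> \<le> 3 * 3" using exp_le by (intro mult_mono) auto
        finally show "exp (s * d + s ^ 3 * d) \<le> 9" by simp
      qed simp
      finally have "exp (s * d) * expectation (\<lambda>\<omega>. exp (s * V i \<omega>)) \<le> 9 * exp (s\<^sup>2 / 2)" .
      moreover have "expectation (\<lambda>\<omega>. exp (s * (V i \<omega> + d))) = exp (s * d) * expectation (\<lambda>\<omega>. exp (s * V i \<omega>))"
        by (simp add: distrib_left exp_add mult.commute)
      ultimately show "expectation (\<lambda>\<omega>. exp (s * (V i \<omega> + d))) \<le> 9 * exp (s\<^sup>2 / 2)" by simp
    qed
    then have env: "expectation (\<lambda>\<omega>. stein_env z (V i \<omega> + d)) \<le> h" by (simp add: h_def P_def)
    from stein_one_step[OF ind z Vbd bd[OF i] mean[OF i] env]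
    show ?thesis unfolding WV Q_def v_def by simp
  qed
  have iYf: "integrable M (\<lambda>\<omega>. Y i \<omega> * stein_sol z (W \<omega>))" if i: "i \<in> I" for i
  proof -
    have [measurable]: "stein_sol z \<in> borel_measurable borel"
      by (rule borel_measurable_continuous_onI[OF stein_sol_continuous])
    show ?thesis
      using integrable_continuous_bounded[OF Wm Wbd stein_sol_continuous[of z]] bd[OF i] i
      by (intro Bochner_Integration.integrable_bound[of M "\<lambda>\<omega>. d * stein_sol z (W \<omega>)" "\<lambda>\<omega>. Y i \<omega> * stein_sol z (W \<omega>)"])
        (auto simp: abs_mult intro!: mult_right_mono order_trans[OF bd[OF i] abs_ge_self])
  qed
  have "Q = expectation (\<lambda>\<omega>. \<Sum>i\<in>I. Y i \<omega> * stein_sol z (W \<omega>))"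
    unfolding Q_def by (subst (1) W_def) (simp add: sum_distrib_right)
  also have "\<dots> = (\<Sum>i\<in>I. expectation (\<lambda>\<omega>. Y i \<omega> * stein_sol z (W \<omega>)))"
    by (rule Bochner_Integration.integral_sum) (rule iYf)
  finally have Q: "Q = (\<Sum>i\<in>I. expectation (\<lambda>\<omega>. Y i \<omega> * stein_sol z (W \<omega>)))" .
  have v1: "(\<Sum>i\<in>I. v i * c) = c" for c using var by (simp add: v_def flip: sum_distrib_right)
  have "Q \<le> (\<Sum>i\<in>I. v i * (Q + 2 * d * h + normal_tail z - prob (exceed W (z + 2 * d))))"
    by (subst Q) (intro sum_mono, use step in blast)
  then show "prob (exceed W (z + 2 * d)) \<le> normal_tail z * (1 + 4000 * d * (1 + max z 0) ^ 3)"
    unfolding v1 h_def P_def by (simp add: algebra_simps)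
  have "(\<Sum>i\<in>I. v i * (Q - 2 * d * h + normal_tail z - prob (exceed W (z - 2 * d)))) \<le> Q"
    by (subst (2) Q) (intro sum_mono, use step in blast)
  then show "normal_tail z * (1 - 4000 * d * (1 + max z 0) ^ 3) \<le> prob (exceed W (z - 2 * d))"
    unfolding v1 h_def P_def by (simp add: algebra_simps)
qed

end

section \<open>Exponential tails of degenerate double sums\<close>

lemma exp_le_add_exp_square: "exp y \<le> y + exp (y\<^sup>2)" for y :: real
proof (cases "1 < y")
  case True
  then have "y \<le> y\<^sup>2" by (simp add: power2_eq_square)
  then have "exp y \<le> exp (y\<^sup>2)" by simp
  then show ?thesis using True by linarith
next
  case False
  have sq: "1 + y + y\<^sup>2 \<le> y + exp (y\<^sup>2)" using exp_ge_add_one_self[of "y\<^sup>2"] by simp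
  show ?thesis
  proof (cases "0 \<le> y")
    case True
    then have "exp y \<le> 1 + y + y\<^sup>2" using False by (intro exp_bound) auto
    then show ?thesis using sq by linarith
  next
    case neg: False
    define x where "x = - y"
    have x: "0 < x" using neg by (simp add: x_def)
    have nn: "0 \<le> 1 - x + x\<^sup>2"
    proof -
      have "0 \<le> (x - 1/2)\<^sup>2" by simp
      then show ?thesis by (simp add: power2_eq_square algebra_simps)
    qed
    have "1 \<le> (1 - x + x\<^sup>2) * (1 + x + x\<^sup>2 / 2)"
    proof -
      have "(1 - x + x\<^sup>2) * (1 + x + x\<^sup>2 / 2) = 1 + (x\<^sup>2 / 2 + x ^ 3 / 2 + x ^ 4 / 2)"
        by (simp add: field_simps eval_nat_numeral)
      moreover have "0 \<le> x\<^sup>2 / 2 + x ^ 3 / 2 + x ^ 4 / 2" using x by simp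
      ultimately show ?thesis by linarith
    qed
    also have "\<dots> \<le> (1 - x + x\<^sup>2) * exp x"
      using x nn by (intro mult_left_mono exp_lower_Taylor_quadratic) auto
    finally have "exp (- x) \<le> 1 - x + x\<^sup>2"
      by (simp add: exp_minus divide_inverse[symmetric] pos_divide_le_eq inverse_eq_divide)
    then have "exp y \<le> 1 + y + y\<^sup>2" by (simp add: x_def)
    then show ?thesis using sq by linarith
  qed
qed

lemma (in prob_space) nn_integral_exp_centered_le:
  fixes X :: "'a \<Rightarrow> real"
  assumes [measurable]: "X \<in> borel_measurable M" and bd: "\<And>x. x \<in> space M \<Longrightarrow> \<bar>X x\<bar> \<le> B"
    and mean: "expectation X = 0"
  shows "(\<integral>\<^sup>+x. ennreal (exp (X x)) \<partial>M) \<le> (\<integral>\<^sup>+x. ennreal (exp ((X x)\<^sup>2)) \<partial>M)"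
proof -
  have iX: "integrable M X"
    using bd by (intro integrable_const_bound[where B = B]) auto
  have ie: "integrable M (\<lambda>x. exp (X x))"
  proof (rule integrable_const_bound[where B = "exp B"])
    show "AE x in M. norm (exp (X x)) \<le> exp B"
      using bd by (auto simp: abs_le_iff)
  qed simp
  have ie2: "integrable M (\<lambda>x. exp ((X x)\<^sup>2))"
  proof (rule integrable_const_bound[where B = "exp (B\<^sup>2)"])
    show "AE x in M. norm (exp ((X x)\<^sup>2)) \<le> exp (B\<^sup>2)"
      using bd by (intro AE_I2) (metis abs_ge_zero exp_le_cancel_iff norm_exp exp_ge_zero real_norm_def abs_of_nonneg power2_abs power_mono)
  qed simp
  have "expectation (\<lambda>x. exp (X x)) \<le> expectation (\<lambda>x. X x + exp ((X x)\<^sup>2))"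
    using iX ie ie2 by (intro integral_mono exp_le_add_exp_square) auto
  also have "\<dots> = expectation (\<lambda>x. exp ((X x)\<^sup>2))" using iX ie2 mean by simp
  finally show ?thesis
    using ie ie2 by (simp add: nn_integral_eq_integral)
qed

text \<open>Jensen's inequality for a power, from the tangent line of \<open>t \<mapsto> t\<^sup>n\<close> at
  the mean.\<close>
lemma (in prob_space) nn_integral_power_le:
  fixes Z :: "'a \<Rightarrow> real"
  assumes [measurable]: "Z \<in> borel_measurable M" and bd: "\<And>x. x \<in> space M \<Longrightarrow> 0 \<le> Z x \<and> Z x \<le> B"
  shows "(\<integral>\<^sup>+x. ennreal (Z x) \<partial>M) ^ n \<le> (\<integral>\<^sup>+x. ennreal (Z x ^ n) \<partial>M)"
proof -
  have iZ: "integrable M Z"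
    using bd by (intro integrable_const_bound[where B = B]) auto
  have iZn: "integrable M (\<lambda>x. Z x ^ n)"
    using bd by (intro integrable_const_bound[where B = "B ^ n"]) (auto intro!: power_mono)
  define m where "m = expectation Z"
  have m: "0 \<le> m" unfolding m_def using bd by (intro Bochner_Integration.integral_nonneg) auto
  have "m ^ n \<le> expectation (\<lambda>x. Z x ^ n)"
  proof -
    \<comment> \<open>Bernoulli's inequality, rescaled by the mean.\<close>
    have tangent: "m ^ n + real n * m ^ (n - 1) * (t - m) \<le> t ^ n" if "0 \<le> t" for t
    proof (cases "m = 0")
      case True
      then show ?thesis using that by (cases n; cases "n - 1") (auto simp: power_0_left)
    next
      case False
      have "1 + real n * ((t - m) / m) \<le> (1 + (t - m) / m) ^ n"
        using that m False by (intro Bernoulli_inequality) (simp add: field_simps)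
      from mult_left_mono[OF this, of "m ^ n"] m False
      have "m ^ n * (1 + real n * ((t - m) / m)) \<le> m ^ n * (t / m) ^ n"
        by (simp add: diff_divide_distrib)
      also have "\<dots> = t ^ n" using False by (simp add: power_divide)
      finally have "m ^ n * (1 + real n * ((t - m) / m)) \<le> t ^ n" .
      moreover have "m ^ n * (1 + real n * ((t - m) / m)) = m ^ n + real n * m ^ (n - 1) * (t - m)"
        using False by (cases n) (simp_all add: distrib_left)
      ultimately show ?thesis by simp
    qed
    have "expectation (\<lambda>x. m ^ n + real n * m ^ (n - 1) * (Z x - m)) \<le> expectation (\<lambda>x. Z x ^ n)"
      using iZ iZn bd tangent by (intro integral_mono) auto
    then show ?thesis using iZ by (simp add: prob_space m_def)
  qed
  then show ?thesis
    using iZ iZn bd m by (simp add: nn_integral_eq_integral m_def ennreal_power)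
qed

lemma nn_integral_normal_exp_linear:
  "(\<integral>\<^sup>+g. ennreal (\<phi> g * exp (a * g)) \<partial>lborel) = ennreal (exp (a\<^sup>2 / 2))"
proof -
  have "(\<integral>\<^sup>+g. ennreal (\<phi> g * exp (a * g)) \<partial>lborel) =
      (\<integral>\<^sup>+g. ennreal (exp (a\<^sup>2 / 2)) * ennreal (normal_density a 1 g) \<partial>lborel)"
    by (intro nn_integral_cong)
       (simp add: normal_density_def power2_eq_square field_simps flip: ennreal_mult exp_add)
  also have "\<dots> = ennreal (exp (a\<^sup>2 / 2))"
    by (simp add: nn_integral_cmult nn_integral_eq_integral)
  finally show ?thesis .
qed

lemma nn_integral_normal_exp_square:
  "(\<integral>\<^sup>+g. ennreal (\<phi> g * exp (3 / 8 * g\<^sup>2)) \<partial>lborel) = 2"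
proof -
  have "(\<integral>\<^sup>+g. ennreal (\<phi> g * exp (3 / 8 * g\<^sup>2)) \<partial>lborel) =
      (\<integral>\<^sup>+g. 2 * ennreal (normal_density 0 2 g) \<partial>lborel)"
  proof (intro nn_integral_cong)
    fix g :: real
    have "\<phi> g * exp (3 / 8 * g\<^sup>2) = 2 * normal_density 0 2 g"
    proof -
      have "sqrt 8 = 2 * sqrt (2::real)" using real_sqrt_mult[of 4 2] by simp
      then show ?thesis by (simp add: normal_density_def real_sqrt_mult flip: exp_add)
    qed
    then show "ennreal (\<phi> g * exp (3 / 8 * g\<^sup>2)) = 2 * ennreal (normal_density 0 2 g)"
      by (simp add: ennreal_mult)
  qed
  also have "\<dots> = 2"
    by (simp add: nn_integral_cmult nn_integral_eq_integral)
  finally show ?thesis .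
qed

abbreviation iid :: "'i set \<Rightarrow> 'b measure \<Rightarrow> ('i \<Rightarrow> 'b) measure" where
  "iid I \<nu> \<equiv> Pi\<^sub>M I (\<lambda>_. \<nu>)"

text \<open>The square is linearised by writing \<open>exp (s T\<^sup>2)\<close> as the mean of
  \<open>exp (sqrt (2 s) g T)\<close> over a standard normal \<open>g\<close>. For fixed \<open>g\<close> the
  exponential of the sum factorises, and what is left is a Gaussian integral.\<close>
lemma nn_integral_exp_square_sum_le:
  fixes g :: "'b \<Rightarrow> real"
  assumes \<nu>: "prob_space \<nu>" and J: "finite J" and g[measurable]: "g \<in> borel_measurable \<nu>"
    and bd: "\<And>x. x \<in> space \<nu> \<Longrightarrow> \<bar>g x\<bar> \<le> 1" and mean: "(\<integral>x. g x \<partial>\<nu>) = 0"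
    and s: "0 \<le> s" "2 * s * real (card J) \<le> 3 / 8"
  shows "(\<integral>\<^sup>+y. ennreal (exp (s * (\<Sum>j\<in>J. g (y j))\<^sup>2)) \<partial>iid J \<nu>) \<le> 2"
proof -
  interpret \<nu>: prob_space \<nu> by fact
  interpret P: product_prob_space "\<lambda>_. \<nu>" J by standard
  interpret PS: prob_space "iid J \<nu>" by (rule prob_space_PiM) (rule \<nu>)
  interpret PP: pair_sigma_finite "iid J \<nu>" lborel by standard
  have Tm[measurable]: "(\<lambda>y. \<Sum>j\<in>J. g (y j)) \<in> borel_measurable (iid J \<nu>)"
    by measurable
  have one: "(\<integral>\<^sup>+u. ennreal (exp (a * g u)) \<partial>\<nu>) \<le> ennreal (exp (a\<^sup>2))" for a
  proof -
    have "(\<integral>\<^sup>+u. ennreal (exp (a * g u)) \<partial>\<nu>) \<le> (\<integral>\<^sup>+u. ennreal (exp ((a * g u)\<^sup>2)) \<partial>\<nu>)"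
      using bd mean by (intro \<nu>.nn_integral_exp_centered_le[where B = "\<bar>a\<bar>"])
        (auto simp: abs_mult intro: mult_left_le)
    also have "\<dots> \<le> (\<integral>\<^sup>+u. ennreal (exp (a\<^sup>2)) \<partial>\<nu>)"
    proof (intro nn_integral_mono ennreal_leI)
      fix u assume "u \<in> space \<nu>"
      then have "(g u)\<^sup>2 \<le> 1" using bd[of u] by (simp add: abs_square_le_1)
      then show "exp ((a * g u)\<^sup>2) \<le> exp (a\<^sup>2)" by (simp add: power_mult_distrib mult_left_le)
    qed
    also have "\<dots> = ennreal (exp (a\<^sup>2))" by (simp add: \<nu>.emeasure_space_1)
    finally show ?thesis .
  qed
  have inner: "(\<integral>\<^sup>+y. ennreal (exp (a * (\<Sum>j\<in>J. g (y j)))) \<partial>iid J \<nu>) \<le> ennreal (exp (real (card J) * a\<^sup>2))" for a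
  proof -
    have "(\<integral>\<^sup>+y. ennreal (exp (a * (\<Sum>j\<in>J. g (y j)))) \<partial>iid J \<nu>) =
        (\<integral>\<^sup>+y. (\<Prod>j\<in>J. ennreal (exp (a * g (y j)))) \<partial>iid J \<nu>)"
      by (simp add: sum_distrib_left exp_sum J prod_ennreal)
    also have "\<dots> = (\<Prod>j\<in>J. \<integral>\<^sup>+u. ennreal (exp (a * g u)) \<partial>\<nu>)"
      by (rule P.product_nn_integral_prod) (use J in auto)
    also have "\<dots> \<le> (\<Prod>j\<in>J. ennreal (exp (a\<^sup>2)))" using power_mono_ennreal[OF one, of a "card J"] by simp
    also have "\<dots> = ennreal (exp (real (card J) * a\<^sup>2))" by (simp add: ennreal_power exp_of_nat_mult)
    finally show ?thesis .
  qed
  have "(\<integral>\<^sup>+y. ennreal (exp (s * (\<Sum>j\<in>J. g (y j))\<^sup>2)) \<partial>iid J \<nu>) =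
     (\<integral>\<^sup>+y. (\<integral>\<^sup>+t. ennreal (\<phi> t * exp (sqrt (2 * s) * (\<Sum>j\<in>J. g (y j)) * t)) \<partial>lborel) \<partial>iid J \<nu>)"
    using s by (subst nn_integral_normal_exp_linear) (simp add: power_mult_distrib)
  also have "\<dots> = (\<integral>\<^sup>+t. (\<integral>\<^sup>+y. ennreal (\<phi> t * exp (sqrt (2 * s) * (\<Sum>j\<in>J. g (y j)) * t)) \<partial>iid J \<nu>) \<partial>lborel)"
    by (rule PP.Fubini'[symmetric]) measurable
  also have "\<dots> = (\<integral>\<^sup>+t. ennreal (\<phi> t) * (\<integral>\<^sup>+y. ennreal (exp ((sqrt (2 * s) * t) * (\<Sum>j\<in>J. g (y j)))) \<partial>iid J \<nu>) \<partial>lborel)"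
    by (intro nn_integral_cong, subst nn_integral_cmult[symmetric]) (simp_all add: ennreal_mult mult_ac)
  also have "\<dots> \<le> (\<integral>\<^sup>+t. ennreal (\<phi> t * exp (3 / 8 * t\<^sup>2)) \<partial>lborel)"
  proof (intro nn_integral_mono)
    fix t :: real
    have "real (card J) * (sqrt (2 * s) * t)\<^sup>2 = (2 * s * real (card J)) * t\<^sup>2"
      using s by (simp add: power_mult_distrib)
    also have "\<dots> \<le> 3 / 8 * t\<^sup>2" using s by (intro mult_right_mono) auto
    finally have "ennreal (exp (real (card J) * (sqrt (2 * s) * t)\<^sup>2)) \<le> ennreal (exp (3 / 8 * t\<^sup>2))"
      by (intro ennreal_leI) simp
    with inner[of "sqrt (2 * s) * t"]
    have "(\<integral>\<^sup>+y. ennreal (exp ((sqrt (2 * s) * t) * (\<Sum>j\<in>J. g (y j)))) \<partial>iid J \<nu>) \<le> ennreal (exp (3 / 8 * t\<^sup>2))"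
      by (rule order_trans)
    then show "ennreal (\<phi> t) * (\<integral>\<^sup>+y. ennreal (exp ((sqrt (2 * s) * t) * (\<Sum>j\<in>J. g (y j)))) \<partial>iid J \<nu>)
        \<le> ennreal (\<phi> t * exp (3 / 8 * t\<^sup>2))"
      by (subst ennreal_mult) (auto intro: mult_left_mono)
  qed
  also have "\<dots> = 2" by (rule nn_integral_normal_exp_square)
  finally show ?thesis .
qed

text \<open>With the coordinates in \<open>J\<close> fixed, the double sum is a sum of independent centred
  terms over \<open>A\<close>. Passing from \<open>exp (\<mu> G)\<close> to
  \<open>exp (\<mu>\<^sup>2 G\<^sup>2)\<close> uses the degeneracy in the first argument; after
  Jensen's inequality the degeneracy in the second argument controls the square.\<close>
lemma nn_integral_exp_bipartite_le:
  fixes k :: "'b \<Rightarrow> 'b \<Rightarrow> real"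
  assumes \<nu>: "prob_space \<nu>" and fin: "finite A" "finite J" and disj: "J \<inter> A = {}"
    and k[measurable]: "(\<lambda>(x, y). k x y) \<in> borel_measurable (\<nu> \<Otimes>\<^sub>M \<nu>)"
    and bd: "\<And>x y. x \<in> space \<nu> \<Longrightarrow> y \<in> space \<nu> \<Longrightarrow> \<bar>k x y\<bar> \<le> 1"
    and deg1: "\<And>y. y \<in> space \<nu> \<Longrightarrow> (\<integral>x. k x y \<partial>\<nu>) = 0"
    and deg2: "\<And>x. x \<in> space \<nu> \<Longrightarrow> (\<integral>y. k x y \<partial>\<nu>) = 0"
    and mu: "2 * (real (card A) * \<mu>\<^sup>2) * real (card J) \<le> 3 / 8"
  shows "(\<integral>\<^sup>+\<omega>. ennreal (exp (\<mu> * (\<Sum>i\<in>A. \<Sum>j\<in>J. k (\<omega> i) (\<omega> j)))) \<partial>iid (J \<union> A) \<nu>) \<le> 2"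
proof -
  interpret \<nu>: prob_space \<nu> by fact
  interpret P: product_prob_space "\<lambda>_. \<nu>" J by standard
  interpret PJ: prob_space "iid J \<nu>" by (rule prob_space_PiM) (rule \<nu>)
  interpret PP: pair_sigma_finite \<nu> "iid J \<nu>" by standard
  define G where "G u y = (\<Sum>j\<in>J. k u (y j))" for u y
  have Gm[measurable]: "(\<lambda>(u, y). G u y) \<in> borel_measurable (\<nu> \<Otimes>\<^sub>M iid J \<nu>)"
    unfolding G_def split_def by measurable
  define c where "c = real (card J)"
  have Gbd: "\<bar>G u y\<bar> \<le> c" if "u \<in> space \<nu>" "y \<in> space (iid J \<nu>)" for u y
  proof -
    have "\<bar>G u y\<bar> \<le> (\<Sum>j\<in>J. \<bar>k u (y j)\<bar>)" unfolding G_def by (rule sum_abs)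
    also have "\<dots> \<le> (\<Sum>j\<in>J. 1)" using that bd by (intro sum_mono) (auto simp: space_PiM PiE_def)
    finally show ?thesis by (simp add: c_def)
  qed
  have km: "(\<lambda>x. k x y) \<in> borel_measurable \<nu>" "(\<lambda>x. k y x) \<in> borel_measurable \<nu>" if "y \<in> space \<nu>" for y
    using that k by (auto dest: measurable_Pair2 measurable_Pair1)
  have fm: "(\<lambda>\<omega>. ennreal (exp (\<mu> * (\<Sum>i\<in>A. \<Sum>j\<in>J. k (\<omega> i) (\<omega> j))))) \<in> borel_measurable (iid (J \<union> A) \<nu>)"
    by measurable
  have "(\<integral>\<^sup>+\<omega>. ennreal (exp (\<mu> * (\<Sum>i\<in>A. \<Sum>j\<in>J. k (\<omega> i) (\<omega> j)))) \<partial>iid (J \<union> A) \<nu>) =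
    (\<integral>\<^sup>+y. \<integral>\<^sup>+x. ennreal (exp (\<mu> * (\<Sum>i\<in>A. \<Sum>j\<in>J. k (merge J A (y, x) i) (merge J A (y, x) j)))) \<partial>iid A \<nu> \<partial>iid J \<nu>)"
    by (rule P.product_nn_integral_fold[OF disj fin(2,1) fm])
  also have "\<dots> = (\<integral>\<^sup>+y. \<integral>\<^sup>+x. (\<Prod>i\<in>A. ennreal (exp (\<mu> * G (x i) y))) \<partial>iid A \<nu> \<partial>iid J \<nu>)"
  proof (intro nn_integral_cong)
    fix x y
    have "(\<Sum>j\<in>J. k (merge J A (y, x) i) (merge J A (y, x) j)) = G (x i) y" if "i \<in> A" for i
      unfolding G_def using that disj by (intro sum.cong) (auto simp: merge_def)
    then have "(\<Sum>i\<in>A. \<Sum>j\<in>J. k (merge J A (y, x) i) (merge J A (y, x) j)) = (\<Sum>i\<in>A. G (x i) y)"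
      by (intro sum.cong) auto
    then show "ennreal (exp (\<mu> * (\<Sum>i\<in>A. \<Sum>j\<in>J. k (merge J A (y, x) i) (merge J A (y, x) j)))) =
       (\<Prod>i\<in>A. ennreal (exp (\<mu> * G (x i) y)))"
      by (simp add: sum_distrib_left exp_sum fin prod_ennreal)
  qed
  also have "\<dots> \<le> (\<integral>\<^sup>+y. \<integral>\<^sup>+u. ennreal (exp (real (card A) * \<mu>\<^sup>2 * (G u y)\<^sup>2)) \<partial>\<nu> \<partial>iid J \<nu>)"
  proof (intro nn_integral_mono)
    fix y assume y: "y \<in> space (iid J \<nu>)"
    have yj: "y j \<in> space \<nu>" if "j \<in> J" for j using y that by (auto simp: space_PiM PiE_def)
    have Gy[measurable]: "(\<lambda>u. G u y) \<in> borel_measurable \<nu>"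
      unfolding G_def using km yj by (intro borel_measurable_sum) auto
    have G0: "(\<integral>u. \<mu> * G u y \<partial>\<nu>) = 0"
    proof -
      have "integrable \<nu> (\<lambda>u. k u (y j))" if "j \<in> J" for j
        using km yj bd that by (intro \<nu>.integrable_const_bound[where B = 1]) auto
      then show ?thesis unfolding G_def using deg1 yj by (simp add: Bochner_Integration.integral_sum)
    qed
    have "(\<integral>\<^sup>+x. (\<Prod>i\<in>A. ennreal (exp (\<mu> * G (x i) y))) \<partial>iid A \<nu>) =
        (\<Prod>i\<in>A. \<integral>\<^sup>+u. ennreal (exp (\<mu> * G u y)) \<partial>\<nu>)"
      by (rule P.product_nn_integral_prod) (use fin in auto)
    also have "\<dots> = (\<integral>\<^sup>+u. ennreal (exp (\<mu> * G u y)) \<partial>\<nu>) ^ card A" by simp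
    also have "\<dots> \<le> (\<integral>\<^sup>+u. ennreal (exp ((\<mu> * G u y)\<^sup>2)) \<partial>\<nu>) ^ card A"
      using Gbd y G0
      by (intro power_mono_ennreal \<nu>.nn_integral_exp_centered_le[where B = "\<bar>\<mu>\<bar> * c"])
         (auto simp: abs_mult intro!: mult_left_mono)
    also have "\<dots> \<le> (\<integral>\<^sup>+u. ennreal (exp ((\<mu> * G u y)\<^sup>2) ^ card A) \<partial>\<nu>)"
    proof (rule \<nu>.nn_integral_power_le[where B = "exp ((\<mu> * c)\<^sup>2)"])
      fix u assume u: "u \<in> space \<nu>"
      have "\<bar>\<mu> * G u y\<bar> \<le> \<bar>\<mu> * c\<bar>"
        using Gbd[OF u y] by (simp add: abs_mult mult_left_mono order_trans[OF _ abs_ge_self])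
      then show "0 \<le> exp ((\<mu> * G u y)\<^sup>2) \<and> exp ((\<mu> * G u y)\<^sup>2) \<le> exp ((\<mu> * c)\<^sup>2)"
        by (simp add: abs_le_square_iff)
    qed simp
    also have "\<dots> = (\<integral>\<^sup>+u. ennreal (exp (real (card A) * \<mu>\<^sup>2 * (G u y)\<^sup>2)) \<partial>\<nu>)"
      by (simp add: power_mult_distrib mult.assoc flip: exp_of_nat_mult)
    finally show "(\<integral>\<^sup>+x. (\<Prod>i\<in>A. ennreal (exp (\<mu> * G (x i) y))) \<partial>iid A \<nu>) \<le>
      (\<integral>\<^sup>+u. ennreal (exp (real (card A) * \<mu>\<^sup>2 * (G u y)\<^sup>2)) \<partial>\<nu>)" .
  qed
  also have "\<dots> = (\<integral>\<^sup>+u. \<integral>\<^sup>+y. ennreal (exp (real (card A) * \<mu>\<^sup>2 * (G u y)\<^sup>2)) \<partial>iid J \<nu> \<partial>\<nu>)"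
    by (rule PP.Fubini') measurable
  also have "\<dots> \<le> (\<integral>\<^sup>+u. 2 \<partial>\<nu>)"
  proof (intro nn_integral_mono)
    fix u assume u: "u \<in> space \<nu>"
    show "(\<integral>\<^sup>+y. ennreal (exp (real (card A) * \<mu>\<^sup>2 * (G u y)\<^sup>2)) \<partial>iid J \<nu>) \<le> 2"
      unfolding G_def using u km bd deg2 mu
      by (intro nn_integral_exp_square_sum_le \<nu> fin) auto
  qed
  also have "\<dots> = 2" by (simp add: \<nu>.emeasure_space_1)
  finally show ?thesis .
qed

lemma card_subsets_separating:
  assumes I: "finite I" and ij: "i \<in> I" "j \<in> I" "i \<noteq> j"
  shows "4 * card {A \<in> Pow I. i \<in> A \<and> j \<notin> A} = 2 ^ card I"
proof -
  have "bij_betw (insert i) (Pow (I - {i, j})) {A \<in> Pow I. i \<in> A \<and> j \<notin> A}"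
    by (rule bij_betwI[where g = "\<lambda>A. A - {i}"]) (use ij in auto)
  then have "card {A \<in> Pow I. i \<in> A \<and> j \<notin> A} = 2 ^ card (I - {i, j})"
    using I by (simp add: card_Pow flip: bij_betw_same_card)
  moreover have "card I = Suc (Suc (card (I - {i, j})))"
  proof -
    have "I = insert i (insert j (I - {i, j}))" using ij by auto
    then have "card I = card (insert i (insert j (I - {i, j})))" by (rule arg_cong)
    then show ?thesis using I ij by simp
  qed
  ultimately show ?thesis by simp
qed

text \<open>A pair \<open>i \<noteq> j\<close> is separated, with \<open>i\<close> inside and \<open>j\<close> outside, by a
  quarter of all subsets.\<close>
lemma sum_over_splits:
  fixes a :: "'i \<Rightarrow> 'i \<Rightarrow> real"
  assumes I: "finite I"
  shows "(\<Sum>A\<in>Pow I. 4 * (\<Sum>i\<in>A. \<Sum>j\<in>I - A. a i j)) = 2 ^ card I * (\<Sum>i\<in>I. \<Sum>j\<in>I - {i}. a i j)"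
proof -
  have "(\<Sum>A\<in>Pow I. 4 * (\<Sum>i\<in>A. \<Sum>j\<in>I - A. a i j)) =
      (\<Sum>A\<in>Pow I. \<Sum>i\<in>I. \<Sum>j\<in>I. of_bool (i \<in> A \<and> j \<notin> A) * (4 * a i j))"
  proof (intro sum.cong refl)
    fix A assume A: "A \<in> Pow I"
    have "(\<Sum>i\<in>I. \<Sum>j\<in>I. of_bool (i \<in> A \<and> j \<notin> A) * (4 * a i j)) =
        (\<Sum>i\<in>I. if i \<in> A then (\<Sum>j\<in>I. if j \<notin> A then 4 * a i j else 0) else 0)"
      by (intro sum.cong refl) (auto intro!: sum.cong)
    also have "\<dots> = (\<Sum>i\<in>I \<inter> A. \<Sum>j\<in>I \<inter> {j. j \<notin> A}. 4 * a i j)"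
      using I by (simp add: sum.inter_restrict[symmetric] sum.If_cases)
    also have "\<dots> = (\<Sum>i\<in>A. \<Sum>j\<in>I - A. 4 * a i j)"
      using A by (intro sum.cong) auto
    finally show "4 * (\<Sum>i\<in>A. \<Sum>j\<in>I - A. a i j) = (\<Sum>i\<in>I. \<Sum>j\<in>I. of_bool (i \<in> A \<and> j \<notin> A) * (4 * a i j))"
      by (simp add: sum_distrib_left)
  qed
  also have "\<dots> = (\<Sum>i\<in>I. \<Sum>j\<in>I. (\<Sum>A\<in>Pow I. of_bool (i \<in> A \<and> j \<notin> A)) * (4 * a i j))"
    by (subst sum.swap, intro sum.cong refl, subst sum.swap) (simp add: sum_distrib_right)
  also have "\<dots> = (\<Sum>i\<in>I. \<Sum>j\<in>I. if j = i then 0 else 2 ^ card I * a i j)"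
  proof (intro sum.cong refl)
    fix i j assume ij: "i \<in> I" "j \<in> I"
    have "(\<Sum>A\<in>Pow I. of_bool (i \<in> A \<and> j \<notin> A)) = real (card {A \<in> Pow I. i \<in> A \<and> j \<notin> A})"
      using I by (subst sum_of_bool_eq) (auto intro!: arg_cong[where f = card])
    moreover have "4 * real (card {A \<in> Pow I. i \<in> A \<and> j \<notin> A}) = 2 ^ card I" if "i \<noteq> j"
      using arg_cong[OF card_subsets_separating[OF I ij that], of real] by simp
    moreover have "{A \<in> Pow I. i \<in> A \<and> j \<notin> A} = {}" if "i = j" using that by auto
    ultimately show "(\<Sum>A\<in>Pow I. of_bool (i \<in> A \<and> j \<notin> A)) * (4 * a i j) = (if j = i then 0 else 2 ^ card I * a i j)"
      by (cases "i = j") (simp_all flip: mult.assoc)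
  qed
  also have "\<dots> = (\<Sum>i\<in>I. \<Sum>j\<in>I - {i}. 2 ^ card I * a i j)"
    proof (rule sum.cong[OF refl])
    fix i assume "i \<in> I"
    have "(\<Sum>j\<in>I. if j = i then 0 else 2 ^ card I * a i j) = (\<Sum>j\<in>I - {i}. if j = i then 0 else 2 ^ card I * a i j)"
      using I by (intro sum.mono_neutral_right) auto
    then show "(\<Sum>j\<in>I. if j = i then 0 else 2 ^ card I * a i j) = (\<Sum>j\<in>I - {i}. 2 ^ card I * a i j)"
      by simp
  qed
  finally show ?thesis by (simp add: sum_distrib_left)
qed

text \<open>The double sum is an average of bipartite sums, so by convexity of the exponential its
  exponential moment is at most the average of theirs.\<close>
lemma nn_integral_exp_degenerate_le:
  fixes k :: "'b \<Rightarrow> 'b \<Rightarrow> real"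
  assumes \<nu>: "prob_space \<nu>" and I: "finite I"
    and k[measurable]: "(\<lambda>(x, y). k x y) \<in> borel_measurable (\<nu> \<Otimes>\<^sub>M \<nu>)"
    and bd: "\<And>x y. x \<in> space \<nu> \<Longrightarrow> y \<in> space \<nu> \<Longrightarrow> \<bar>k x y\<bar> \<le> 1"
    and deg1: "\<And>y. y \<in> space \<nu> \<Longrightarrow> (\<integral>x. k x y \<partial>\<nu>) = 0"
    and deg2: "\<And>x. x \<in> space \<nu> \<Longrightarrow> (\<integral>y. k x y \<partial>\<nu>) = 0"
    and lam: "\<bar>l\<bar> * real (card I) \<le> 1 / 10"
  shows "(\<integral>\<^sup>+\<omega>. ennreal (exp (l * (\<Sum>i\<in>I. \<Sum>j\<in>I - {i}. k (\<omega> i) (\<omega> j)))) \<partial>iid I \<nu>) \<le> 2"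
proof -
  define N :: real where "N = 2 ^ card I"
  have N: "0 < N" by (simp add: N_def)
  have cardP: "real (card (Pow I)) = N" using I by (simp add: card_Pow N_def)
  define S where "S A \<omega> = (\<Sum>i\<in>A. \<Sum>j\<in>I - A. k (\<omega> i) (\<omega> j))" for A \<omega>
  have Sm[measurable]: "S A \<in> borel_measurable (iid I \<nu>)" if "A \<subseteq> I" for A
    unfolding S_def using that by (intro borel_measurable_sum) (auto intro!: measurable_compose[OF _ k, of "\<lambda>\<omega>. (\<omega> _, \<omega> _)", simplified])
  have pw: "exp (l * (\<Sum>i\<in>I. \<Sum>j\<in>I - {i}. k (\<omega> i) (\<omega> j))) \<le> (\<Sum>A\<in>Pow I. (1 / N) * exp (4 * l * S A \<omega>))" for \<omega>
  proof -
    have "N * (\<Sum>i\<in>I. \<Sum>j\<in>I - {i}. k (\<omega> i) (\<omega> j)) = (\<Sum>A\<in>Pow I. 4 * S A \<omega>)"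
      unfolding S_def N_def by (rule sum_over_splits[OF I, symmetric])
    then have "l * (\<Sum>i\<in>I. \<Sum>j\<in>I - {i}. k (\<omega> i) (\<omega> j)) = (\<Sum>A\<in>Pow I. (1 / N) *\<^sub>R (4 * l * S A \<omega>))"
      using N by (simp add: sum_distrib_left[symmetric] sum_divide_distrib[symmetric] field_simps)
    moreover have "exp (\<Sum>A\<in>Pow I. (1 / N) *\<^sub>R (4 * l * S A \<omega>)) \<le> (\<Sum>A\<in>Pow I. (1 / N) * exp (4 * l * S A \<omega>))"
      using I N cardP by (intro convex_on_sum[OF _ _ exp_convex]) auto
    ultimately show ?thesis by simp
  qed
  have each: "(\<integral>\<^sup>+\<omega>. ennreal (exp (4 * l * S A \<omega>)) \<partial>iid I \<nu>) \<le> 2" if A: "A \<in> Pow I" for A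
  proof -
    have fin: "finite A" "finite (I - A)" using A I by (auto intro: finite_subset)
    have un: "(I - A) \<union> A = I" using A by auto
    have "real (card A) * real (card (I - A)) \<le> real (card I) * real (card I)"
      using A I by (intro mult_mono) (auto intro!: card_mono)
    then have "32 * l\<^sup>2 * (real (card A) * real (card (I - A))) \<le> 32 * l\<^sup>2 * (real (card I) * real (card I))"
      by (intro mult_left_mono) auto
    also have "\<dots> = 32 * (\<bar>l\<bar> * real (card I))\<^sup>2" by (simp add: power_mult_distrib power2_eq_square)
    also have "\<dots> \<le> 32 * (1 / 10)\<^sup>2" using lam by (intro mult_left_mono power_mono) auto
    also have "\<dots> \<le> 3 / 8" by (simp add: power2_eq_square)
    finally have "2 * (real (card A) * (4 * l)\<^sup>2) * real (card (I - A)) \<le> 3 / 8" by (simp add: power_mult_distrib mult_ac)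
    from nn_integral_exp_bipartite_le[OF \<nu> fin _ k bd deg1 deg2 this]
    show ?thesis unfolding S_def un by auto
  qed
  have "(\<integral>\<^sup>+\<omega>. ennreal (exp (l * (\<Sum>i\<in>I. \<Sum>j\<in>I - {i}. k (\<omega> i) (\<omega> j)))) \<partial>iid I \<nu>) \<le>
    (\<integral>\<^sup>+\<omega>. (\<Sum>A\<in>Pow I. ennreal (1 / N) * ennreal (exp (4 * l * S A \<omega>))) \<partial>iid I \<nu>)"
  proof (intro nn_integral_mono)
    fix \<omega>
    have "ennreal (\<Sum>A\<in>Pow I. (1 / N) * exp (4 * l * S A \<omega>)) = (\<Sum>A\<in>Pow I. ennreal (1 / N) * ennreal (exp (4 * l * S A \<omega>)))"
    proof -
      have "ennreal (1 / N) * ennreal (exp (4 * l * S A \<omega>)) = ennreal ((1 / N) * exp (4 * l * S A \<omega>))" for A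
        using N by (intro ennreal_mult[symmetric]) auto
      then show ?thesis using N by (simp only:) (subst sum_ennreal, auto)
    qed
    then show "ennreal (exp (l * (\<Sum>i\<in>I. \<Sum>j\<in>I - {i}. k (\<omega> i) (\<omega> j)))) \<le> (\<Sum>A\<in>Pow I. ennreal (1 / N) * ennreal (exp (4 * l * S A \<omega>)))"
      using ennreal_leI[OF pw[of \<omega>]] by simp
  qed
  also have "\<dots> = (\<Sum>A\<in>Pow I. ennreal (1 / N) * (\<integral>\<^sup>+\<omega>. ennreal (exp (4 * l * S A \<omega>)) \<partial>iid I \<nu>))"
    by (subst nn_integral_sum) (auto intro!: sum.cong nn_integral_cmult)
  also have "\<dots> \<le> (\<Sum>A\<in>Pow I. ennreal (1 / N) * 2)"
    by (intro sum_mono mult_left_mono each) auto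
  also have "\<dots> = ennreal (\<Sum>A\<in>Pow I. (1 / N) * 2)"
  proof -
    have "ennreal (1 / N) * 2 = ennreal ((1 / N) * 2)" using N by (subst ennreal_mult) auto
    then show ?thesis using N by (simp only:) (subst sum_ennreal, auto)
  qed
  also have "\<dots> = 2" using N cardP by simp
  finally show ?thesis .
qed

text \<open>Chernoff's bound for both signs, after transporting the variables to the product space.\<close>
lemma (in prob_space) degenerate_sum_tail:
  fixes \<xi> :: "'i \<Rightarrow> 'a \<Rightarrow> 'b::second_countable_topology" and k :: "'b \<Rightarrow> 'b \<Rightarrow> real"
  assumes I: "finite I" "I \<noteq> {}" and indep: "indep_vars (\<lambda>_. borel) \<xi> I"
    and distr: "\<And>i. i \<in> I \<Longrightarrow> distr M borel (\<xi> i) = \<nu>"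
    and k: "(\<lambda>(x, y). k x y) \<in> borel_measurable (borel \<Otimes>\<^sub>M borel)"
    and bd: "\<And>x y. \<bar>k x y\<bar> \<le> 1"
    and deg1: "\<And>y. (\<integral>x. k x y \<partial>\<nu>) = 0"
    and deg2: "\<And>x. (\<integral>y. k x y \<partial>\<nu>) = 0"
  shows "prob {\<omega> \<in> space M. real (card I) * r \<le> \<bar>\<Sum>i\<in>I. \<Sum>j\<in>I - {i}. k (\<xi> i \<omega>) (\<xi> j \<omega>)\<bar>} \<le> 4 * exp (- r / 10)"
proof -
  have rv[measurable]: "random_variable borel (\<xi> i)" if "i \<in> I" for i
    using indep that by (simp add: indep_vars_def)
  obtain i0 where i0: "i0 \<in> I" using I by auto
  have \<nu>: "prob_space \<nu>" using prob_space_distr[OF rv[OF i0]] distr[OF i0] by simp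
  have \<nu>s: "sets \<nu> = sets borel" using distr[OF i0] by (metis sets_distr)
  have k\<nu>: "(\<lambda>(x, y). k x y) \<in> borel_measurable (\<nu> \<Otimes>\<^sub>M \<nu>)"
    using k by (subst measurable_cong_sets[OF sets_pair_measure_cong[OF \<nu>s \<nu>s] refl])
  define S where "S \<omega> = (\<Sum>i\<in>I. \<Sum>j\<in>I - {i}. k (\<omega> i) (\<omega> j))" for \<omega>
  define \<Xi> where "\<Xi> \<omega> = (\<lambda>i\<in>I. \<xi> i \<omega>)" for \<omega>
  have \<Xi>m[measurable]: "\<Xi> \<in> measurable M (Pi\<^sub>M I (\<lambda>_. borel))" unfolding \<Xi>_def by measurable
  have Sm[measurable]: "S \<in> borel_measurable (Pi\<^sub>M I (\<lambda>_. borel))"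
    unfolding S_def
    by (intro borel_measurable_sum measurable_compose[OF _ k, where f = "\<lambda>\<omega>. (\<omega> _, \<omega> _)", simplified]) measurable
  have law: "distr M (Pi\<^sub>M I (\<lambda>_. borel)) \<Xi> = iid I \<nu>"
  proof -
    have "distr M (Pi\<^sub>M I (\<lambda>_. borel)) \<Xi> = Pi\<^sub>M I (\<lambda>i. distr M borel (\<xi> i))"
      using indep_vars_iff_distr_eq_PiM'[of I \<xi> "\<lambda>_. borel"] I rv indep by (simp add: \<Xi>_def[abs_def])
    also have "\<dots> = iid I \<nu>" by (intro PiM_cong) (auto simp: distr)
    finally show ?thesis .
  qed
  \<comment> \<open>The rate at which \<open>nn_integral_exp_degenerate_le\<close> bounds the exponential moment by 2.\<close>
  define c where "c = 1 / (10 * real (card I))"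
  have c: "0 < c" "c * real (card I) = 1 / 10" using I by (auto simp: c_def card_gt_0_iff)
  have mgf: "(\<integral>\<^sup>+\<omega>. ennreal (exp (l * S (\<Xi> \<omega>))) \<partial>M) \<le> 2" if l: "\<bar>l\<bar> = c" for l
  proof -
    have "(\<integral>\<^sup>+\<omega>. ennreal (exp (l * S (\<Xi> \<omega>))) \<partial>M) = (\<integral>\<^sup>+\<omega>. ennreal (exp (l * S \<omega>)) \<partial>distr M (Pi\<^sub>M I (\<lambda>_. borel)) \<Xi>)"
      by (subst nn_integral_distr) auto
    also have "\<dots> \<le> 2"
      unfolding law S_def using c l bd deg1 deg2
      by (intro nn_integral_exp_degenerate_le \<nu> I k\<nu>) auto
    finally show ?thesis .
  qed
  have SX: "S (\<Xi> \<omega>) = (\<Sum>i\<in>I. \<Sum>j\<in>I - {i}. k (\<xi> i \<omega>) (\<xi> j \<omega>))" for \<omega>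
    unfolding S_def \<Xi>_def by (intro sum.cong) auto
  let ?A = "{\<omega> \<in> space M. real (card I) * r \<le> \<bar>S (\<Xi> \<omega>)\<bar>}"
  have A[measurable]: "?A \<in> events" by measurable
  have "emeasure M ?A = (\<integral>\<^sup>+\<omega>. indicator ?A \<omega> \<partial>M)" by simp
  also have "\<dots> \<le> (\<integral>\<^sup>+\<omega>. ennreal (exp (- r / 10)) * (ennreal (exp (c * S (\<Xi> \<omega>))) + ennreal (exp (- c * S (\<Xi> \<omega>)))) \<partial>M)"
  proof (intro nn_integral_mono)
    fix \<omega> assume "\<omega> \<in> space M"
    show "indicator ?A \<omega> \<le> ennreal (exp (- r / 10)) * (ennreal (exp (c * S (\<Xi> \<omega>))) + ennreal (exp (- c * S (\<Xi> \<omega>))))"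
    proof (cases "\<omega> \<in> ?A")
      case True
      then have "c * (real (card I) * r) \<le> c * \<bar>S (\<Xi> \<omega>)\<bar>" using c by (intro mult_left_mono) auto
      then have "r / 10 \<le> c * \<bar>S (\<Xi> \<omega>)\<bar>" using c(2) by (simp flip: mult.assoc)
      then have "1 \<le> exp (- r / 10) * exp (c * \<bar>S (\<Xi> \<omega>)\<bar>)" by (simp flip: exp_add)
      also have "\<dots> \<le> exp (- r / 10) * (exp (c * S (\<Xi> \<omega>)) + exp (- c * S (\<Xi> \<omega>)))"
        by (intro mult_left_mono) (auto simp: abs_if)
      finally have "ennreal 1 \<le> ennreal (exp (- r / 10) * (exp (c * S (\<Xi> \<omega>)) + exp (- c * S (\<Xi> \<omega>))))"
        by (rule ennreal_leI)
      then show ?thesis using True by (simp add: ennreal_mult)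
    qed simp
  qed
  also have "\<dots> = ennreal (exp (- r / 10)) * ((\<integral>\<^sup>+\<omega>. ennreal (exp (c * S (\<Xi> \<omega>))) \<partial>M) + (\<integral>\<^sup>+\<omega>. ennreal (exp (- c * S (\<Xi> \<omega>))) \<partial>M))"
    by (subst nn_integral_cmult, simp, subst nn_integral_add) auto
  also have "\<dots> \<le> ennreal (exp (- r / 10)) * (2 + 2)"
    using mgf[of c] mgf[of "- c"] c by (intro mult_left_mono add_mono) auto
  also have "\<dots> = ennreal (4 * exp (- r / 10))" by (simp add: ennreal_mult mult.commute)
  finally show ?thesis unfolding SX by (simp add: emeasure_eq_measure)
qed

section \<open>The Hodges--Lehmann estimator as a thresholded U-statistic\<close>

lemma off_diagonal_Sigma: "{(i, j). i \<in> I \<and> j \<in> I \<and> i \<noteq> j} = Sigma I (\<lambda>i. I - {i})"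
  by auto

lemma walsh_ecdf_eq:
  "walsh_ecdf n x t = (\<Sum>i\<in>{1..n}. \<Sum>j\<in>{1..n} - {i}. of_bool ((x i + x j) / 2 \<le> t)) / (real n * (real n - 1))"
  unfolding walsh_ecdf_def off_diagonal_Sigma by (subst sum.Sigma) auto

lemma sum_off_diagonal:
  fixes g :: "'i \<Rightarrow> real"
  assumes "finite I"
  shows "(\<Sum>i\<in>I. \<Sum>j\<in>I - {i}. g i) = (real (card I) - 1) * sum g I"
    and "(\<Sum>i\<in>I. \<Sum>j\<in>I - {i}. g j) = (real (card I) - 1) * sum g I"
proof -
  have "(\<Sum>i\<in>I. \<Sum>j\<in>I - {i}. g i) = (\<Sum>i\<in>I. (real (card I) - 1) * g i)"
  proof (rule sum.cong[OF refl])
    fix i assume "i \<in> I"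
    then have "Suc (card (I - {i})) = card I" using assms by (rule_tac card_Suc_Diff1)
    then have "real (card (I - {i})) = real (card I) - 1" by (simp flip: \<open>Suc _ = _\<close>)
    then show "(\<Sum>j\<in>I - {i}. g i) = (real (card I) - 1) * g i" by simp
  qed
  then show "(\<Sum>i\<in>I. \<Sum>j\<in>I - {i}. g i) = (real (card I) - 1) * sum g I" by (simp add: sum_distrib_left)
  have "(\<Sum>i\<in>I. \<Sum>j\<in>I - {i}. g j) = (\<Sum>i\<in>I. sum g I - g i)"
    using assms by (intro sum.cong refl) (simp add: sum_diff1)
  then show "(\<Sum>i\<in>I. \<Sum>j\<in>I - {i}. g j) = (real (card I) - 1) * sum g I"
    by (simp add: sum_subtractf algebra_simps)
qed

text \<open>The second assumption is the part of right continuity that matters: it keeps the infimum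
  from being attained below the level 1/2.\<close>
lemma less_lower_median_iff:
  assumes G: "\<And>s t. s \<le> t \<Longrightarrow> G s \<le> G t"
    and right: "\<And>t. G t < 1 / 2 \<Longrightarrow> \<exists>u>t. G u < 1 / 2"
    and top: "1 / 2 \<le> G b" and bot: "\<And>t. t < a \<Longrightarrow> G t < 1 / 2"
  shows "t < lower_median G \<longleftrightarrow> G t < 1 / 2"
proof -
  have ne: "{t. 1 / 2 \<le> G t} \<noteq> {}" using top by auto
  have bdd: "bdd_below {t. 1 / 2 \<le> G t}"
  proof (rule bdd_belowI[of _ a])
    fix x assume "x \<in> {t. 1 / 2 \<le> G t}"
    then have "\<not> x < a" using bot[of x] by auto
    then show "a \<le> x" by simp
  qed
  show ?thesis
  proof
    assume "t < lower_median G"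
    then show "G t < 1 / 2"
      unfolding lower_median_def using cInf_lower[OF _ bdd, of t] by force
  next
    assume "G t < 1 / 2"
    then obtain u where u: "t < u" "G u < 1 / 2" using right by auto
    have "u \<le> Inf {t. 1 / 2 \<le> G t}"
    proof (rule cInf_greatest[OF ne])
      fix x assume "x \<in> {t. 1 / 2 \<le> G t}"
      then have "\<not> x \<le> u" using G[of x u] u by auto
      then show "u \<le> x" by simp
    qed
    then show "t < lower_median G" using u by (simp add: lower_median_def)
  qed
qed

lemma less_hodges_lehmann_iff:
  assumes n: "2 \<le> n"
  shows "t < hodges_lehmann n x \<longleftrightarrow> walsh_ecdf n x t < 1 / 2"
  unfolding hodges_lehmann_def
proof (rule less_lower_median_iff)
  let ?I = "{1..n}"
  define m where "m = (\<Sum>i\<in>?I. \<bar>x i\<bar>)"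
  have m: "\<bar>x i\<bar> \<le> m" if "i \<in> ?I" for i
    unfolding m_def using that by (intro member_le_sum[where f = "\<lambda>i. \<bar>x i\<bar>"]) auto
  have N: "0 < real n * (real n - 1)" using n by simp
  show "walsh_ecdf n x s \<le> walsh_ecdf n x t" if "s \<le> t" for s t
    unfolding walsh_ecdf_eq using N that by (intro divide_right_mono sum_mono) auto
  show "1 / 2 \<le> walsh_ecdf n x m"
  proof -
    have "(x i + x j) / 2 \<le> m" if "i \<in> ?I" "j \<in> ?I" for i j
    proof -
      have "x i + x j \<le> m + m" using m[OF that(1)] m[OF that(2)] by linarith
      then show ?thesis by simp
    qed
    then have "(\<Sum>i\<in>?I. \<Sum>j\<in>?I - {i}. of_bool ((x i + x j) / 2 \<le> m)) = (\<Sum>i\<in>?I. \<Sum>j\<in>?I - {i}. 1::real)"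
      by (intro sum.cong refl) auto
    also have "\<dots> = real n * (real n - 1)"
      by (subst sum_off_diagonal(1)[of ?I "\<lambda>_. 1"]) (simp_all add: mult.commute)
    finally have "walsh_ecdf n x m = real n * (real n - 1) / (real n * (real n - 1))"
      unfolding walsh_ecdf_eq by (rule arg_cong)
    also have "\<dots> = 1" using N by (intro divide_self) linarith
    finally show ?thesis by simp
  qed
  show "walsh_ecdf n x t < 1 / 2" if "t < - m" for t
  proof -
    have "\<not> (x i + x j) / 2 \<le> t" if "i \<in> ?I" "j \<in> ?I" for i j
    proof -
      have "t + t < x i + x j" using m[OF that(1)] m[OF that(2)] \<open>t < - m\<close> by linarith
      then show ?thesis by simp
    qed
    then have "(\<Sum>i\<in>?I. \<Sum>j\<in>?I - {i}. of_bool ((x i + x j) / 2 \<le> t)) = (\<Sum>i\<in>?I. \<Sum>j\<in>?I - {i}. 0::real)"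
      by (intro sum.cong refl) auto
    then show ?thesis unfolding walsh_ecdf_eq by simp
  qed
  show "\<exists>u>t. walsh_ecdf n x u < 1 / 2" if t: "walsh_ecdf n x t < 1 / 2" for t
  proof -
    have "\<forall>\<^sub>F u in at_right t. \<forall>i\<in>?I. \<forall>j\<in>?I. (x i + x j) / 2 \<le> u \<longrightarrow> (x i + x j) / 2 \<le> t"
    proof (intro eventually_ball_finite ballI finite_atLeastAtMost)
      fix i j
      show "\<forall>\<^sub>F u in at_right t. (x i + x j) / 2 \<le> u \<longrightarrow> (x i + x j) / 2 \<le> t"
      proof (cases "(x i + x j) / 2 \<le> t")
        case False
        then have "\<forall>\<^sub>F u in at_right t. u < (x i + x j) / 2"
          by (intro order_tendstoD(2)[OF tendsto_ident_at]) simp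
        then show ?thesis by eventually_elim auto
      qed simp
    qed
    then have "\<forall>\<^sub>F u in at_right t. t < u \<and> (\<forall>i\<in>?I. \<forall>j\<in>?I. (x i + x j) / 2 \<le> u \<longrightarrow> (x i + x j) / 2 \<le> t)"
      by (intro eventually_conj eventually_at_right_less)
    then obtain u where u: "t < u" "\<And>i j. i \<in> ?I \<Longrightarrow> j \<in> ?I \<Longrightarrow> (x i + x j) / 2 \<le> u \<Longrightarrow> (x i + x j) / 2 \<le> t"
      using eventually_happens'[OF trivial_limit_at_right_real] by blast
    have "walsh_ecdf n x u \<le> walsh_ecdf n x t"
      unfolding walsh_ecdf_eq using N u(2) by (intro divide_right_mono sum_mono) auto
    then show ?thesis using u t by auto
  qed
qed

section \<open>Distribution and variance of the linear projection\<close>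

locale iid_bounded_density = prob_space M for M :: "'a measure" +
  fixes \<xi> :: "nat \<Rightarrow> 'a \<Rightarrow> real" and f :: "real \<Rightarrow> real" and B :: real
  assumes indep: "indep_vars (\<lambda>_. borel) \<xi> {1..}"
    and density: "\<And>i. i \<ge> 1 \<Longrightarrow> distributed M lborel (\<xi> i) (\<lambda>t. ennreal (f t))"
    and f_le: "\<And>t. f t \<le> B"
begin

definition \<nu> :: "real measure" where "\<nu> = distr M borel (\<xi> 1)"
definition F :: "real \<Rightarrow> real" where "F t = measure \<nu> {..t}"

lemma rv: "i \<ge> 1 \<Longrightarrow> random_variable borel (\<xi> i)"
  using indep by (simp add: indep_vars_def)

lemma distr_xi: "i \<ge> 1 \<Longrightarrow> distr M borel (\<xi> i) = density lborel (\<lambda>t. ennreal (f t))"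
  using distributed_distr_eq_density[OF density, of i] by (metis distr_cong sets_lborel)

lemma distr_xi_eq: "i \<ge> 1 \<Longrightarrow> distr M borel (\<xi> i) = \<nu>"
  unfolding \<nu>_def by (simp add: distr_xi)

lemma \<nu>_density: "\<nu> = density lborel (\<lambda>t. ennreal (f t))"
  unfolding \<nu>_def by (simp add: distr_xi)

lemma sets_\<nu>[simp, measurable_cong]: "sets \<nu> = sets borel" and space_\<nu>[simp]: "space \<nu> = UNIV"
  by (simp_all add: \<nu>_def)

lemma prob_space_\<nu>: "prob_space \<nu>"
  unfolding \<nu>_def by (rule prob_space_distr) (simp add: rv)

sublocale \<nu>: prob_space \<nu> by (rule prob_space_\<nu>)

lemma measure_\<nu>_UNIV[simp]: "measure \<nu> UNIV = 1"
  using \<nu>.prob_space by simp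

lemma integral_xi:
  fixes g :: "real \<Rightarrow> real"
  assumes "i \<ge> 1" "g \<in> borel_measurable borel"
  shows "expectation (\<lambda>\<omega>. g (\<xi> i \<omega>)) = (\<integral>x. g x \<partial>\<nu>)"
  unfolding distr_xi_eq[OF assms(1), symmetric] using assms rv by (subst integral_distr) auto

lemma B_nonneg: "0 \<le> B"
proof (rule ccontr)
  assume "\<not> 0 \<le> B"
  then have "f t \<le> 0" for t using f_le[of t] by simp
  then have "emeasure \<nu> UNIV = 0"
    unfolding \<nu>_density using distributed_borel_measurable[OF density, of 1]
    by (subst emeasure_density) (auto simp: ennreal_neg)
  then show False using \<nu>.emeasure_space_1 by simp
qed

lemma \<nu>_Icc_le: assumes "a \<le> b" shows "measure \<nu> {a..b} \<le> B * (b - a)"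
proof -
  have "emeasure \<nu> {a..b} = (\<integral>\<^sup>+x. ennreal (f x) * indicator {a..b} x \<partial>lborel)"
    unfolding \<nu>_density using distributed_borel_measurable[OF density, of 1]
    by (subst emeasure_density) auto
  also have "\<dots> \<le> (\<integral>\<^sup>+x. ennreal B * indicator {a..b} x \<partial>lborel)"
    using f_le by (intro nn_integral_mono mult_right_mono ennreal_leI) auto
  also have "\<dots> = ennreal (B * (b - a))"
    using assms B_nonneg by (simp add: nn_integral_cmult ennreal_mult)
  finally show ?thesis using assms B_nonneg by (simp add: \<nu>.emeasure_eq_measure)
qed

lemma F_nonneg: "0 \<le> F t" and F_le_1: "F t \<le> 1"
  by (simp_all add: F_def)

lemma F_mono: "a \<le> b \<Longrightarrow> F a \<le> F b"
  unfolding F_def by (intro \<nu>.finite_measure_mono) auto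

lemma F_lipschitz: assumes "a \<le> b" shows "F b - F a \<le> B * (b - a)"
proof -
  have "F b - F a = measure \<nu> ({..b} - {..a})"
    unfolding F_def using assms by (subst \<nu>.finite_measure_Diff) auto
  also have "\<dots> \<le> measure \<nu> {a..b}" by (intro \<nu>.finite_measure_mono) auto
  also have "\<dots> \<le> B * (b - a)" by (rule \<nu>_Icc_le[OF assms])
  finally show ?thesis .
qed

lemma F_abs_lipschitz: "\<bar>F b - F a\<bar> \<le> B * \<bar>b - a\<bar>"
  using F_lipschitz[of a b] F_lipschitz[of b a] F_mono[of a b] F_mono[of b a] by (cases "a \<le> b") auto

lemma F_shift: "\<bar>F (2 * b - x) - F (2 * a - x)\<bar> \<le> 2 * B * \<bar>b - a\<bar>"
proof -
  have "(2 * b - x) - (2 * a - x) = 2 * (b - a)" by simp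
  then have "\<bar>(2 * b - x) - (2 * a - x)\<bar> = 2 * \<bar>b - a\<bar>" by (simp only: abs_mult abs_numeral)
  then show ?thesis using F_abs_lipschitz[of "2 * b - x" "2 * a - x"] by (simp only: mult_ac)
qed

lemma F_measurable[measurable]: "F \<in> borel_measurable borel"
  by (rule borel_measurable_mono) (auto intro: monoI F_mono)

lemma F_integrable: "integrable \<nu> (\<lambda>x. F (c - x))"
  by (intro \<nu>.integrable_const_bound[where B = 1]) (auto simp: F_nonneg F_le_1)

lemma F_continuous: "continuous_on UNIV F"
proof -
  have "B-lipschitz_on UNIV F"
    using F_abs_lipschitz B_nonneg by (auto simp: lipschitz_on_def dist_real_def)
  then show ?thesis by (rule lipschitz_on_continuous_on)
qed

abbreviation U :: "real \<Rightarrow> real" where "U \<equiv> walsh_cdf M \<xi>"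

lemma walsh_eq: "U t = (\<integral>x. F (2 * t - x) \<partial>\<nu>)"
proof -
  have 12: "indep_var borel (\<xi> 1) borel (\<xi> 2)"
    using indep_vars_sum[of "{2}" 1 \<xi>] indep_vars_subset[OF indep, of "{1, 2}"] by simp
  have joint: "distr M (borel \<Otimes>\<^sub>M borel) (\<lambda>\<omega>. (\<xi> 1 \<omega>, \<xi> 2 \<omega>)) = \<nu> \<Otimes>\<^sub>M \<nu>"
    using 12 unfolding indep_var_distribution_eq by (simp add: distr_xi_eq)
  define D where "D = {p :: real \<times> real. (fst p + snd p) / 2 \<le> t}"
  have D: "D \<in> sets (borel \<Otimes>\<^sub>M borel)"
  proof -
    have "Measurable.pred (borel \<Otimes>\<^sub>M borel) (\<lambda>p :: real \<times> real. (fst p + snd p) / 2 \<le> t)" by measurable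
    then show ?thesis unfolding pred_def D_def by (simp only: space_pair_measure space_borel UNIV_Times_UNIV UNIV_I simp_thms)
  qed
  have "{\<omega> \<in> space M. (\<xi> 1 \<omega> + \<xi> 2 \<omega>) / 2 \<le> t} = (\<lambda>\<omega>. (\<xi> 1 \<omega>, \<xi> 2 \<omega>)) -` D \<inter> space M"
    by (auto simp: D_def)
  then have "ennreal (U t) = emeasure (distr M (borel \<Otimes>\<^sub>M borel) (\<lambda>\<omega>. (\<xi> 1 \<omega>, \<xi> 2 \<omega>))) D"
    unfolding walsh_cdf_def using rv[of 1] rv[of 2] D
    by (subst emeasure_distr) (auto simp: emeasure_eq_measure)
  also have "\<dots> = emeasure (\<nu> \<Otimes>\<^sub>M \<nu>) D" unfolding joint ..
  also have "\<dots> = (\<integral>\<^sup>+x. emeasure \<nu> (Pair x -` D) \<partial>\<nu>)"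
    by (rule \<nu>.emeasure_pair_measure_alt) (use D in \<open>simp add: sets_pair_measure_cong[OF sets_\<nu> sets_\<nu>]\<close>)
  also have "\<dots> = (\<integral>\<^sup>+x. ennreal (F (2 * t - x)) \<partial>\<nu>)"
    unfolding F_def D_def by (intro nn_integral_cong)
      (auto simp: \<nu>.emeasure_eq_measure field_simps intro!: arg_cong[where f = "measure \<nu>"])
  also have "\<dots> = ennreal (\<integral>x. F (2 * t - x) \<partial>\<nu>)"
    by (rule nn_integral_eq_integral) (auto simp: F_integrable F_nonneg)
  finally show ?thesis by (simp add: walsh_cdf_def F_nonneg)
qed

lemma walsh_mono: "s \<le> t \<Longrightarrow> U s \<le> U t"
  unfolding walsh_eq by (intro integral_mono F_integrable F_mono) simp

lemma walsh_bounds: "0 \<le> U t" "U t \<le> 1"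
  by (simp_all add: walsh_cdf_def)

lemma walsh_lipschitz: "\<bar>U b - U a\<bar> \<le> 2 * B * \<bar>b - a\<bar>"
proof -
  define g where "g x = F (2 * b - x) - F (2 * a - x)" for x
  have gi: "integrable \<nu> g"
    unfolding g_def by (rule Bochner_Integration.integrable_diff[OF F_integrable F_integrable])
  have eq: "U b - U a = (\<integral>x. g x \<partial>\<nu>)"
    unfolding walsh_eq g_def by (simp add: F_integrable)
  have "\<bar>U b - U a\<bar> \<le> (\<integral>x. \<bar>g x\<bar> \<partial>\<nu>)"
    unfolding eq by (rule integral_abs_bound)
  also have "\<dots> \<le> (\<integral>x. 2 * B * \<bar>b - a\<bar> \<partial>\<nu>)"
    by (rule integral_mono[OF integrable_abs[OF gi] \<nu>.integrable_const]) (simp only: g_def F_shift)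
  finally show ?thesis by simp
qed

lemma walsh_continuous: "isCont (U) t"
proof -
  have "(2 * B)-lipschitz_on UNIV (U)"
    using B_nonneg walsh_lipschitz by (auto simp: lipschitz_on_def dist_real_def)
  then show ?thesis using lipschitz_on_continuous_on continuous_on_eq_continuous_at open_UNIV by blast
qed

lemma F_at_top: "(F \<longlongrightarrow> 1) at_top"
proof -
  interpret R: real_distribution \<nu> by standard auto
  have "F = cdf \<nu>" by (simp add: fun_eq_iff F_def cdf_def)
  then show ?thesis using R.cdf_lim_at_top_prob by simp
qed

text \<open>Continuity forces the value 1/2 at the lower median.\<close>
lemma walsh_half:
  assumes "lower_median (U) = 0"
  shows "U 0 = 1 / 2"
proof -
  let ?G = "U" and ?S = "{t. U t \<ge> 1 / 2}"
  interpret D: real_distribution "distr M borel (\<lambda>\<omega>. (\<xi> 1 \<omega> + \<xi> 2 \<omega>) / 2)"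
    by (intro real_distribution.intro prob_space_distr real_distribution_axioms.intro) (use rv[of 1] rv[of 2] in auto)
  have G: "?G = cdf (distr M borel (\<lambda>\<omega>. (\<xi> 1 \<omega> + \<xi> 2 \<omega>) / 2))"
    using rv[of 1] rv[of 2]
    by (auto simp: fun_eq_iff walsh_cdf_def cdf_def measure_distr intro!: arg_cong[where f = prob])
  have "\<forall>\<^sub>F t in at_top. ?G t > 1 / 2"
    using order_tendstoD(1)[OF D.cdf_lim_at_top_prob, of "1/2"] by (simp add: G)
  then have ne: "?S \<noteq> {}" by (metis (mono_tags, lifting) empty_iff eventually_at_top_linorder less_imp_le mem_Collect_eq order_refl)
  have "\<forall>\<^sub>F t in at_bot. ?G t < 1 / 2"
    using order_tendstoD(2)[OF D.cdf_lim_at_bot, of "1/2"] by (simp add: G)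
  then obtain b where b: "\<And>t. t \<le> b \<Longrightarrow> ?G t < 1 / 2" by (auto simp: eventually_at_bot_linorder)
  have bdd: "bdd_below ?S"
  proof (rule bdd_belowI[of _ b])
    fix x assume "x \<in> ?S"
    then have "\<not> x \<le> b" using b[of x] by auto
    then show "b \<le> x" by simp
  qed
  have Inf0: "Inf ?S = 0" using assms by (simp add: lower_median_def)
  have neg: "?G t < 1 / 2" if "t < 0" for t
    using cInf_lower[OF _ bdd, of t] that Inf0 by force
  have pos: "1 / 2 \<le> ?G t" if t: "0 < t" for t
  proof -
    obtain s where "s \<in> ?S" "s < t" using cInf_lessD[OF ne, of t] t Inf0 by auto
    then show ?thesis using walsh_mono[of s t] by auto
  qed
  have cont: "(?G \<longlongrightarrow> ?G 0) (at 0)" using walsh_continuous[of 0] by (simp add: isCont_def)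
  have "?G 0 \<le> 1 / 2"
  proof (rule tendsto_upperbound[OF tendsto_within_subset[OF cont subset_UNIV, of "{..<0}"]])
    show "\<forall>\<^sub>F t in at_left 0. ?G t \<le> 1 / 2"
      using neg by (auto simp: eventually_at_filter intro!: always_eventually less_imp_le)
  qed simp
  moreover have "1 / 2 \<le> ?G 0"
  proof (rule tendsto_lowerbound[OF tendsto_within_subset[OF cont subset_UNIV, of "{0<..}"]])
    show "\<forall>\<^sub>F t in at_right 0. 1 / 2 \<le> ?G t"
      using pos by (auto simp: eventually_at_filter intro!: always_eventually)
  qed simp
  ultimately show ?thesis by simp
qed

text \<open>The variance of the conditional probability of
  \<open>(\<xi>\<^sub>1 + \<xi>\<^sub>2) / 2 \<le> t\<close> given \<open>\<xi>\<^sub>1\<close>.\<close>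
definition proj_var :: "real \<Rightarrow> real" where
  "proj_var t = (\<integral>x. (F (2 * t - x) - U t)\<^sup>2 \<partial>\<nu>)"

lemma proj_var_nonneg: "0 \<le> proj_var t" by (simp add: proj_var_def)

lemma sq_integrable: "integrable \<nu> (\<lambda>x. (F (c - x) - u)\<^sup>2)"
proof (rule \<nu>.integrable_const_bound[where B = "(1 + \<bar>u\<bar>)\<^sup>2"])
  have "\<bar>F (c - x) - u\<bar> \<le> 1 + \<bar>u\<bar>" for x using F_nonneg[of "c - x"] F_le_1[of "c - x"] by linarith
  then show "AE x in \<nu>. norm ((F (c - x) - u)\<^sup>2) \<le> (1 + \<bar>u\<bar>)\<^sup>2"
    by (intro AE_I2) (simp add: power2_le_iff_abs_le)
qed simp

lemma proj_var_lipschitz: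
  assumes "0 \<le> t" shows "\<bar>proj_var t - proj_var 0\<bar> \<le> 8 * B * t"
proof -
  let ?u = "U"
  have F: "\<bar>F (2 * t - x) - F (2 * 0 - x)\<bar> \<le> 2 * B * t" for x
    using F_shift[of t x 0] assms by simp
  have u: "\<bar>?u t - ?u 0\<bar> \<le> 2 * B * t"
    using walsh_lipschitz[of t 0] assms by simp
  have pw: "\<bar>(F (2 * t - x) - ?u t)\<^sup>2 - (F (2 * 0 - x) - ?u 0)\<^sup>2\<bar> \<le> 8 * B * t" for x
  proof -
    define a b where "a = F (2 * t - x) - ?u t" and "b = F (2 * 0 - x) - ?u 0"
    have "\<bar>a\<bar> \<le> 1" "\<bar>b\<bar> \<le> 1"
      unfolding a_def b_def using F_nonneg[of "2 * t - x"] F_le_1[of "2 * t - x"] F_nonneg[of "2 * 0 - x"] F_le_1[of "2 * 0 - x"]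
        walsh_bounds[of t] walsh_bounds[of 0] by linarith+
    then have 2: "\<bar>a + b\<bar> \<le> 2" by linarith
    have 1: "\<bar>a - b\<bar> \<le> 4 * B * t" unfolding a_def b_def using F[of x] u by linarith
    have "\<bar>a\<^sup>2 - b\<^sup>2\<bar> = \<bar>a - b\<bar> * \<bar>a + b\<bar>" by (simp add: power2_eq_square algebra_simps flip: abs_mult)
    also have "\<dots> \<le> (4 * B * t) * 2" using 1 2 by (intro mult_mono) auto
    finally show ?thesis by (simp add: a_def b_def)
  qed
  define g where "g x = (F (2 * t - x) - ?u t)\<^sup>2 - (F (2 * 0 - x) - ?u 0)\<^sup>2" for x
  have gi: "integrable \<nu> g"
    unfolding g_def by (rule Bochner_Integration.integrable_diff[OF sq_integrable sq_integrable])
  have eq: "proj_var t - proj_var 0 = (\<integral>x. g x \<partial>\<nu>)"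
    unfolding proj_var_def g_def by (rule Bochner_Integration.integral_diff[OF sq_integrable sq_integrable, symmetric])
  have "\<bar>proj_var t - proj_var 0\<bar> \<le> (\<integral>x. \<bar>g x\<bar> \<partial>\<nu>)"
    unfolding eq by (rule integral_abs_bound)
  also have "\<dots> \<le> (\<integral>x. 8 * B * t \<partial>\<nu>)"
    by (rule integral_mono[OF integrable_abs[OF gi] \<nu>.integrable_const]) (use pw in \<open>simp only: g_def\<close>)
  finally show ?thesis by simp
qed

text \<open>If the projection were constant, then \<open>- \<xi>\<^sub>1\<close> would live in the
  level set \<open>{F = 1 / 2}\<close>, an interval with right end \<open>q\<close>. Moving the
  threshold by \<open>t\<close> then changes \<open>F (2 t - \<xi>\<^sub>1)\<close> only when
  \<open>- \<xi>\<^sub>1\<close> is within \<open>2 t\<close> of \<open>q\<close>, an event of probability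
  \<open>O(t)\<close> on which the change is also \<open>O(t)\<close>. The distribution function of the
  averages would be flat at 0.\<close>
lemma proj_var_pos:
  assumes half: "U 0 = 1 / 2" and der: "(U has_real_derivative c) (at 0)" and c: "0 < c"
  shows "0 < proj_var 0"
proof (rule ccontr)
  assume "\<not> 0 < proj_var 0"
  then have s0: "proj_var 0 = 0" using proj_var_nonneg[of 0] by simp
  have "AE x in \<nu>. (F (2 * 0 - x) - U 0)\<^sup>2 = 0"
    using s0 unfolding proj_var_def by (subst (asm) integral_nonneg_eq_0_iff_AE[OF sq_integrable]) auto
  then have ae: "AE x in \<nu>. F (- x) = 1 / 2" by (simp add: half)
  define N where "N = {y. F y = 1 / 2}"
  have "\<exists>x. F (- x) = 1 / 2"
  proof (rule ccontr)
    assume "\<not> ?thesis"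
    with ae have "AE x in \<nu>. False" by simp
    then show False by simp
  qed
  then have ne: "N \<noteq> {}" by (auto simp: N_def)
  have "\<forall>\<^sub>F y in at_top. F y > 1 / 2" using order_tendstoD(1)[OF F_at_top, of "1/2"] by simp
  then obtain b where "\<And>y. y \<ge> b \<Longrightarrow> F y > 1 / 2" by (auto simp: eventually_at_top_linorder)
  then have "\<not> b \<le> y" if "y \<in> N" for y using that unfolding N_def by (metis less_irrefl mem_Collect_eq)
  then have bdd: "bdd_above N" by (intro bdd_aboveI[of _ b]) (simp add: less_imp_le not_le)
  have "closed N" unfolding N_def using F_continuous by (intro closed_Collect_eq) auto
  \<comment> \<open>The level is attained at the right end of the level set because \<open>F\<close> is continuous.\<close>
  define q where "q = Sup N"
  have q: "F q = 1 / 2" using closed_contains_Sup[OF ne bdd \<open>closed N\<close>] by (simp add: q_def N_def)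
  have ub: "y \<le> q" if "F y = 1 / 2" for y
    unfolding q_def using that by (intro cSup_upper bdd) (simp add: N_def)
  have main: "U t - U 0 \<le> (2 * B * t)\<^sup>2" if t: "0 < t" for t
  proof -
    have "U t - U 0 = (\<integral>x. F (2 * t - x) - F (- x) \<partial>\<nu>)"
      unfolding walsh_eq using F_integrable[of "2 * t"] F_integrable[of 0] by simp
    also have "\<dots> \<le> (\<integral>x. 2 * B * t * indicator {-q..2 * t - q} x \<partial>\<nu>)"
    proof (rule integral_mono_AE)
      show "integrable \<nu> (\<lambda>x. F (2 * t - x) - F (- x))"
        using F_integrable[of "2 * t"] F_integrable[of 0] by simp
      show "integrable \<nu> (\<lambda>x. 2 * B * t * indicator {-q..2 * t - q} x)"
        by (intro integrable_mult_right) (simp add: \<nu>.emeasure_eq_measure)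
      show "AE x in \<nu>. F (2 * t - x) - F (- x) \<le> 2 * B * t * indicator {-q..2 * t - q} x"
        using ae
      proof eventually_elim
        case (elim x)
        show ?case
        proof (cases "2 * t - x \<le> q")
          case True
          then have "F (2 * t - x) \<le> F (- x)" using elim q F_mono by metis
          moreover have "0 \<le> 2 * B * t * indicator {-q..2 * t - q} x"
            using B_nonneg t by (intro mult_nonneg_nonneg) auto
          ultimately show ?thesis by linarith
        next
          case False
          then have "x \<in> {-q..2 * t - q}" using ub[OF elim] by auto
          then show ?thesis using F_lipschitz[of "- x" "2 * t - x"] t by simp
        qed
      qed
    qed
    also have "\<dots> = 2 * B * t * measure \<nu> {-q..2 * t - q}" by simp
    also have "\<dots> \<le> 2 * B * t * (B * (2 * t))"
      using \<nu>_Icc_le[of "- q" "2 * t - q"] t B_nonneg by (intro mult_left_mono) auto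
    finally show ?thesis by (simp add: power2_eq_square mult_ac)
  qed
  have "((\<lambda>t. (U t - U 0) / t) \<longlongrightarrow> c) (at_right 0)"
    using der tendsto_within_subset[OF _ subset_UNIV] unfolding has_field_derivative_iff by fastforce
  moreover have "((\<lambda>t. 4 * B\<^sup>2 * t) \<longlongrightarrow> 4 * B\<^sup>2 * 0) (at_right 0)" by (intro tendsto_intros)
  moreover have "\<forall>\<^sub>F t in at_right 0. (U t - U 0) / t \<le> 4 * B\<^sup>2 * t"
  proof -
    have "(U t - U 0) / t \<le> 4 * B\<^sup>2 * t" if "0 < t" for t
      using main[OF that] that by (simp add: divide_le_eq power2_eq_square mult_ac)
    then show ?thesis by (auto simp: eventually_at_filter intro!: always_eventually)
  qed
  ultimately have "c \<le> 4 * B\<^sup>2 * 0" by (intro tendsto_le[of "at_right 0"]) auto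
  then show False using c by simp
qed

end

section \<open>Hoeffding decomposition at a fixed threshold\<close>

context iid_bounded_density
begin

text \<open>The completely degenerate part of the indicator kernel; the factor 1/2 normalises it to
  values in \<open>[-1, 1]\<close>.\<close>
definition kern :: "real \<Rightarrow> real \<Rightarrow> real \<Rightarrow> real" where
  "kern t x y = (of_bool ((x + y) / 2 \<le> t) - F (2 * t - x) - F (2 * t - y) + U t) / 2"

lemma kern_le_1: "\<bar>kern t x y\<bar> \<le> 1"
proof -
  have "0 \<le> (of_bool ((x + y) / 2 \<le> t) :: real)" "of_bool ((x + y) / 2 \<le> t) \<le> (1 :: real)" by auto
  then have "\<bar>of_bool ((x + y) / 2 \<le> t) - F (2 * t - x) - F (2 * t - y) + U t\<bar> \<le> 1 + 1"
    using F_nonneg[of "2 * t - x"] F_le_1[of "2 * t - x"] F_nonneg[of "2 * t - y"]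
      F_le_1[of "2 * t - y"] walsh_bounds[of t] by linarith
  then show ?thesis unfolding kern_def abs_divide by simp
qed

lemma kern_commute: "kern t x y = kern t y x"
  by (simp add: kern_def add.commute)

lemma kern_measurable: "(\<lambda>(x, y). kern t x y) \<in> borel_measurable (borel \<Otimes>\<^sub>M borel)"
  unfolding kern_def split_def by measurable

lemma kern_degenerate: "(\<integral>y. kern t x y \<partial>\<nu>) = 0"
proof -
  have "(\<integral>y. of_bool ((x + y) / 2 \<le> t) \<partial>\<nu>) = (\<integral>y. indicator {..2 * t - x} y \<partial>\<nu>)"
    by (intro Bochner_Integration.integral_cong) (auto simp: indicator_def field_simps)
  also have "\<dots> = F (2 * t - x)" by (simp add: F_def)
  finally have 1: "(\<integral>y. of_bool ((x + y) / 2 \<le> t) \<partial>\<nu>) = F (2 * t - x)" .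
  have 2: "integrable \<nu> (\<lambda>y. of_bool ((x + y) / 2 \<le> t) :: real)"
    by (intro \<nu>.integrable_const_bound[where B = 1]) auto
  have "(\<integral>y. kern t x y \<partial>\<nu>) = (F (2 * t - x) - F (2 * t - x) - (\<integral>y. F (2 * t - y) \<partial>\<nu>) + U t) / 2"
    unfolding kern_def using 1 2 F_integrable[of "2 * t"] by simp
  then show ?thesis by (simp add: walsh_eq)
qed

text \<open>The sign is chosen so that large values of \<open>lin_part\<close> correspond to few
  averages below the threshold, that is, to a large estimator.\<close>
definition hoeffding_term :: "nat \<Rightarrow> real \<Rightarrow> nat \<Rightarrow> 'a \<Rightarrow> real" where
  "hoeffding_term n t i \<omega> = (U t - F (2 * t - \<xi> i \<omega>)) / (sqrt (real n) * sqrt (proj_var t))"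

definition lin_part :: "nat \<Rightarrow> real \<Rightarrow> 'a \<Rightarrow> real" where
  "lin_part n t \<omega> = (\<Sum>i\<in>{1..n}. hoeffding_term n t i \<omega>)"

definition deg_part :: "nat \<Rightarrow> real \<Rightarrow> 'a \<Rightarrow> real" where
  "deg_part n t \<omega> = (\<Sum>i\<in>{1..n}. \<Sum>j\<in>{1..n} - {i}. kern t (\<xi> i \<omega>) (\<xi> j \<omega>))"

lemma less_hodges_lehmann_iff_lin_part:
  assumes n: "2 \<le> n" and s: "0 < proj_var t"
  shows "\<theta> + t < hodges_lehmann n (\<lambda>i. \<theta> + \<xi> i \<omega>) \<longleftrightarrow>
     sqrt (real n) * (U t - 1 / 2) / (2 * sqrt (proj_var t))
       + deg_part n t \<omega> / (sqrt (proj_var t) * sqrt (real n) * (real n - 1)) < lin_part n t \<omega>"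
proof -
  let ?I = "{1..n}" and ?u = "U t"
  define N s r where "N = real n" and "s = sqrt (proj_var t)" and "r = sqrt (real n)"
  have pos: "0 < N - 1" "0 < s" "0 < r" using n assms(2) by (auto simp: N_def s_def r_def)
  have rN: "r * r = N" by (simp add: r_def N_def)
  define T where "T = (\<Sum>i\<in>?I. F (2 * t - \<xi> i \<omega>))"
  have W: "lin_part n t \<omega> = (N * ?u - T) / (r * s)"
    unfolding lin_part_def hoeffding_term_def T_def N_def s_def r_def
    by (simp add: sum_divide_distrib[symmetric] sum_subtractf)
  have "(\<Sum>i\<in>?I. \<Sum>j\<in>?I - {i}. of_bool ((\<xi> i \<omega> + \<xi> j \<omega>) / 2 \<le> t)) =
      (\<Sum>i\<in>?I. \<Sum>j\<in>?I - {i}. 2 * kern t (\<xi> i \<omega>) (\<xi> j \<omega>) + F (2 * t - \<xi> i \<omega>) + F (2 * t - \<xi> j \<omega>) - ?u)"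
  proof (rule sum.cong[OF refl], rule sum.cong[OF refl])
    fix i j
    show "of_bool ((\<xi> i \<omega> + \<xi> j \<omega>) / 2 \<le> t) =
      2 * kern t (\<xi> i \<omega>) (\<xi> j \<omega>) + F (2 * t - \<xi> i \<omega>) + F (2 * t - \<xi> j \<omega>) - ?u"
    proof -
      have "c = 2 * ((c - a - b + u) / 2) + a + b - u" for a b c u :: real by (simp add: field_simps)
      then show ?thesis unfolding kern_def .
    qed
  qed
  also have "\<dots> = 2 * deg_part n t \<omega> + (N - 1) * T + (N - 1) * T - (N - 1) * (N * ?u)"
    using sum_off_diagonal[of ?I "\<lambda>i. F (2 * t - \<xi> i \<omega>)"] sum_off_diagonal(1)[of ?I "\<lambda>_. ?u"]
    by (simp add: sum.distrib sum_subtractf sum_distrib_left[symmetric] deg_part_def T_def N_def)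
  finally have sum: "(\<Sum>i\<in>?I. \<Sum>j\<in>?I - {i}. of_bool ((\<xi> i \<omega> + \<xi> j \<omega>) / 2 \<le> t)) =
     2 * deg_part n t \<omega> + 2 * ((N - 1) * T) - (N - 1) * (N * ?u)" by simp
  have "((\<theta> + \<xi> i \<omega>) + (\<theta> + \<xi> j \<omega>)) / 2 \<le> \<theta> + t \<longleftrightarrow> (\<xi> i \<omega> + \<xi> j \<omega>) / 2 \<le> t" for i j
    by (simp add: field_simps)
  then have "\<theta> + t < hodges_lehmann n (\<lambda>i. \<theta> + \<xi> i \<omega>) \<longleftrightarrow>
      (2 * deg_part n t \<omega> + 2 * ((N - 1) * T) - (N - 1) * (N * ?u)) / (N * (N - 1)) < 1 / 2"
    unfolding less_hodges_lehmann_iff[OF n] walsh_ecdf_eq sum[symmetric] by (simp add: N_def)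
  also have "\<dots> \<longleftrightarrow> 2 * deg_part n t \<omega> + N * (N - 1) * (?u - 1 / 2) < 2 * (N - 1) * (N * ?u - T)"
  proof -
    have P: "0 < N * (N - 1)" using pos by simp
    have "2 * (N - 1) * (N * ?u - T) - (2 * deg_part n t \<omega> + N * (N - 1) * (?u - 1 / 2)) =
        1 / 2 * (N * (N - 1)) - (2 * deg_part n t \<omega> + 2 * ((N - 1) * T) - (N - 1) * (N * ?u))"
      by (simp add: field_simps)
    then show ?thesis unfolding pos_divide_less_eq[OF P] by linarith
  qed
  also have "\<dots> \<longleftrightarrow> (2 * deg_part n t \<omega> + N * (N - 1) * (?u - 1 / 2)) / (2 * (N - 1) * (r * s)) <
      2 * (N - 1) * (N * ?u - T) / (2 * (N - 1) * (r * s))"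
  proof -
    have "a < b \<longleftrightarrow> a / c < b / c" if "0 < c" for a b c :: real using that by (simp add: divide_less_cancel)
    moreover have "0 < 2 * (N - 1) * (r * s)" using pos by simp
    ultimately show ?thesis by blast
  qed
  also have "2 * (N - 1) * (N * ?u - T) / (2 * (N - 1) * (r * s)) = lin_part n t \<omega>"
  proof -
    have "2 * b * x / (2 * b * y) = x / y" if "0 < b" for b x y :: real using that by simp
    from this[OF pos(1)] show ?thesis by (simp only: W)
  qed
  also have "(2 * deg_part n t \<omega> + N * (N - 1) * (?u - 1 / 2)) / (2 * (N - 1) * (r * s)) =
      r * (?u - 1 / 2) / (2 * s) + deg_part n t \<omega> / (s * r * (N - 1))"
  proof -
    have "(2 * D + r * r * b * v) / (2 * b * (r * s)) = r * v / (2 * s) + D / (s * r * b)"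
      if "0 < b" for b v D using that pos by (simp add: field_simps)
    from this[OF pos(1)] show ?thesis by (simp only: rN)
  qed
  finally show ?thesis by (simp add: N_def s_def r_def)
qed

lemma xi_measurable: "i \<in> {1..n} \<Longrightarrow> random_variable borel (\<xi> i)"
  by (simp add: rv)

lemma lin_part_measurable: "random_variable borel (lin_part n t)"
  unfolding lin_part_def hoeffding_term_def
proof (rule borel_measurable_sum)
  fix i assume "i \<in> {1..n}"
  then show "random_variable borel (\<lambda>\<omega>. (U t - F (2 * t - \<xi> i \<omega>)) / (sqrt (real n) * sqrt (proj_var t)))"
    by (intro measurable_compose[OF xi_measurable, of i n "\<lambda>x. (U t - F (2 * t - x)) / (sqrt (real n) * sqrt (proj_var t))"])
      measurable
qed

lemma deg_part_measurable: "random_variable borel (deg_part n t)"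
proof -
  have "random_variable borel (\<lambda>\<omega>. kern t (\<xi> i \<omega>) (\<xi> j \<omega>))" if "i \<in> {1..n}" "j \<in> {1..n}" for i j
    using measurable_compose[OF measurable_Pair[OF xi_measurable[OF that(1)] xi_measurable[OF that(2)]] kern_measurable]
    by simp
  then show ?thesis unfolding deg_part_def by (intro borel_measurable_sum) auto
qed

text \<open>The degenerate part is at most \<open>\<eta>\<close> after normalisation unless it exceeds
  \<open>n r\<close>.\<close>
lemma hodges_lehmann_sandwich:
  fixes \<theta> :: real
  assumes n: "2 \<le> n" and s: "0 < proj_var t" and r: "0 \<le> r"
  defines "x \<equiv> sqrt (real n) * (U t - 1 / 2) / (2 * sqrt (proj_var t))"
    and "\<eta> \<equiv> 2 * r / (sqrt (proj_var t) * sqrt (real n))"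
    and "E \<equiv> {\<omega> \<in> space M. \<theta> + t < hodges_lehmann n (\<lambda>i. \<theta> + \<xi> i \<omega>)}"
  shows "prob (exceed (lin_part n t) (x + \<eta>)) - 4 * exp (- r / 10) \<le> prob E"
    and "prob E \<le> prob (exceed (lin_part n t) (x - \<eta>)) + 4 * exp (- r / 10)"
proof -
  note [measurable] = lin_part_measurable deg_part_measurable
  define R where "R = {\<omega> \<in> space M. real n * r \<le> \<bar>deg_part n t \<omega>\<bar>}"
  have Rm: "R \<in> events" unfolding R_def by measurable
  have Rp: "prob R \<le> 4 * exp (- r / 10)"
  proof -
    have "prob {\<omega> \<in> space M. real (card {1..n}) * r \<le> \<bar>\<Sum>i\<in>{1..n}. \<Sum>j\<in>{1..n} - {i}. kern t (\<xi> i \<omega>) (\<xi> j \<omega>)\<bar>} \<le> 4 * exp (- r / 10)"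
    proof (rule degenerate_sum_tail)
      show "indep_vars (\<lambda>_. borel) \<xi> {1..n}" by (rule indep_vars_subset[OF indep]) auto
      show "distr M borel (\<xi> i) = \<nu>" if "i \<in> {1..n}" for i using that by (simp add: distr_xi_eq)
      show "(\<integral>x. kern t x y \<partial>\<nu>) = 0" for y using kern_degenerate[of t y] by (simp add: kern_commute[of t _ y])
    qed (use n kern_measurable kern_le_1 kern_degenerate in auto)
    then show ?thesis by (simp add: R_def deg_part_def)
  qed
  have E: "E = {\<omega> \<in> space M. x + deg_part n t \<omega> / (sqrt (proj_var t) * sqrt (real n) * (real n - 1)) < lin_part n t \<omega>}"
    unfolding E_def x_def less_hodges_lehmann_iff_lin_part[OF n s] ..
  have Em: "E \<in> events" unfolding E by measurable
  have dev: "\<bar>deg_part n t \<omega> / (sqrt (proj_var t) * sqrt (real n) * (real n - 1))\<bar> \<le> \<eta>" if "\<omega> \<in> space M - R" for \<omega>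
  proof -
    have pos: "0 < sqrt (proj_var t) * sqrt (real n)" "0 < real n - 1" using n s by auto
    have "\<bar>deg_part n t \<omega>\<bar> \<le> real n * r" using that by (auto simp: R_def)
    also have "\<dots> \<le> (2 * (real n - 1)) * r" using n r by (intro mult_right_mono) auto
    finally have "\<bar>deg_part n t \<omega>\<bar> / (sqrt (proj_var t) * sqrt (real n) * (real n - 1)) \<le>
       (2 * (real n - 1)) * r / (sqrt (proj_var t) * sqrt (real n) * (real n - 1))"
      using pos by (intro divide_right_mono) auto
    also have "\<dots> = \<eta>"
    proof -
      have "(2 * b) * r / (a * b) = 2 * r / a" if "0 < a" "0 < b" for a b :: real using that by simp
      from this[OF pos] show ?thesis by (simp only: \<eta>_def)
    qed
    finally show ?thesis by (simp only: abs_divide abs_of_pos[OF mult_pos_pos[OF pos]])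
  qed
  have "prob (exceed (lin_part n t) (x + \<eta>)) \<le> prob (E \<union> R)"
  proof (rule finite_measure_mono)
    show "exceed (lin_part n t) (x + \<eta>) \<subseteq> E \<union> R"
    proof
      fix \<omega> assume "\<omega> \<in> exceed (lin_part n t) (x + \<eta>)"
      then show "\<omega> \<in> E \<union> R" using dev[of \<omega>] unfolding E abs_le_iff by (cases "\<omega> \<in> R") auto
    qed
  qed (use Em Rm in auto)
  also have "\<dots> \<le> prob E + prob R" by (rule measure_Un_le[OF Em Rm])
  finally show "prob (exceed (lin_part n t) (x + \<eta>)) - 4 * exp (- r / 10) \<le> prob E"
    using Rp by linarith
  have "prob E \<le> prob (exceed (lin_part n t) (x - \<eta>) \<union> R)"
  proof (rule finite_measure_mono)
    show "E \<subseteq> exceed (lin_part n t) (x - \<eta>) \<union> R"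
    proof
      fix \<omega> assume "\<omega> \<in> E"
      then show "\<omega> \<in> exceed (lin_part n t) (x - \<eta>) \<union> R"
        using dev[of \<omega>] unfolding E abs_le_iff by (cases "\<omega> \<in> R") auto
    qed
  qed (use Rm in measurable)
  also have "\<dots> \<le> prob (exceed (lin_part n t) (x - \<eta>)) + prob R"
    by (rule measure_Un_le) (use Rm in measurable)
  finally show "prob E \<le> prob (exceed (lin_part n t) (x - \<eta>)) + 4 * exp (- r / 10)"
    using Rp by linarith
qed

lemma lin_part_moderate_deviation:
  assumes n: "1 \<le> n" and s: "0 < proj_var t" and z: "-1 \<le> z"
  defines "d \<equiv> 1 / (sqrt (real n) * sqrt (proj_var t))"
  assumes d: "d * (1 + max z 0) ^ 3 \<le> 1"
  shows "prob (exceed (lin_part n t) (z + 2 * d)) \<le> normal_tail z * (1 + 4000 * d * (1 + max z 0) ^ 3)"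
    and "normal_tail z * (1 - 4000 * d * (1 + max z 0) ^ 3) \<le> prob (exceed (lin_part n t) (z - 2 * d))"
proof -
  let ?Y = "hoeffding_term n t" and ?u = "U t"
  define c where "c = sqrt (real n) * sqrt (proj_var t)"
  have c: "0 < c" "c\<^sup>2 = real n * proj_var t" using n s by (auto simp: c_def power_mult_distrib)
  have d0: "0 \<le> d" using c by (simp add: d_def c_def)
  have Y: "?Y i = (\<lambda>\<omega>. (\<lambda>x. (?u - F (2 * t - x)) / c) (\<xi> i \<omega>))" for i
    by (simp add: hoeffding_term_def c_def fun_eq_iff)
  have ind: "indep_vars (\<lambda>_. borel) ?Y {1..n}"
    unfolding Y by (rule indep_vars_compose2[OF indep_vars_subset[OF indep]]) auto
  have bd: "\<bar>?Y i \<omega>\<bar> \<le> d" for i \<omega>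
  proof -
    have "\<bar>?u - F (2 * t - \<xi> i \<omega>)\<bar> \<le> 1"
      using walsh_bounds[of t] F_nonneg[of "2 * t - \<xi> i \<omega>"] F_le_1[of "2 * t - \<xi> i \<omega>"] by linarith
    then show ?thesis using c unfolding hoeffding_term_def d_def c_def[symmetric]
      by (simp add: abs_div_pos[symmetric] divide_right_mono)
  qed
  have mean: "expectation (?Y i) = 0" if "i \<in> {1..n}" for i
  proof -
    have "expectation (?Y i) = (\<integral>x. (?u - F (2 * t - x)) / c \<partial>\<nu>)"
      unfolding Y using that by (intro integral_xi) auto
    then show ?thesis using F_integrable[of "2 * t"] by (simp add: walsh_eq)
  qed
  have "expectation (\<lambda>\<omega>. (?Y i \<omega>)\<^sup>2) = 1 / real n" if "i \<in> {1..n}" for i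
  proof -
    have "expectation (\<lambda>\<omega>. (?Y i \<omega>)\<^sup>2) = (\<integral>x. ((?u - F (2 * t - x)) / c)\<^sup>2 \<partial>\<nu>)"
      unfolding Y using that by (intro integral_xi[where g = "\<lambda>x. ((?u - F (2 * t - x)) / c)\<^sup>2"]) auto
    also have "\<dots> = proj_var t / c\<^sup>2" by (simp add: proj_var_def power_divide power2_commute)
    also have "\<dots> = 1 / real n" using c s by simp
    finally show ?thesis .
  qed
  then have var: "(\<Sum>i\<in>{1..n}. expectation (\<lambda>\<omega>. (?Y i \<omega>)\<^sup>2)) = 1" using n by simp
  from bounded_sum_moderate_deviation[OF finite_atLeastAtMost ind bd mean var z d0 d]
  show "prob (exceed (lin_part n t) (z + 2 * d)) \<le> normal_tail z * (1 + 4000 * d * (1 + max z 0) ^ 3)"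
    "normal_tail z * (1 - 4000 * d * (1 + max z 0) ^ 3) \<le> prob (exceed (lin_part n t) (z - 2 * d))"
    by (simp_all add: lin_part_def)
qed

end

section \<open>The tail ratio at a fixed sample size\<close>

context iid_bounded_density
begin

text \<open>All shifts of the threshold -- the distance \<open>x - z\<close> of the centring, the
  degenerate part and the window of Stein's method -- are collected in \<open>K \<delta>\<close>. With
  \<open>r = 10 sqrt n \<delta>\<close> in \<open>hodges_lehmann_sandwich\<close> the exceptional
  probability is \<open>4 exp (- sqrt n \<delta>)\<close>.\<close>
lemma hodges_lehmann_tail_ratio:
  fixes \<theta> \<delta> K z t :: real
  assumes n: "2 \<le> n" and s: "0 < proj_var t" and z: "0 < z" and \<delta>: "0 < \<delta>" and K: "0 \<le> K"
  defines "x \<equiv> sqrt (real n) * (U t - 1 / 2) / (2 * sqrt (proj_var t))"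
    and "d \<equiv> 1 / (sqrt (real n) * sqrt (proj_var t))"
  assumes dev: "\<bar>x - z\<bar> + 20 * \<delta> / sqrt (proj_var t) + 2 * d \<le> K * \<delta>"
    and K\<delta>: "K * \<delta> \<le> 1" and z\<delta>: "z * \<delta> \<le> 1" and dz: "d * (2 + z) ^ 3 \<le> 1"
  shows "\<bar>prob {\<omega> \<in> space M. \<theta> + t < hodges_lehmann n (\<lambda>i. \<theta> + \<xi> i \<omega>)} / normal_tail z - 1\<bar> \<le>
     16004 * exp K * K * ((1 + z) * \<delta>) + 4000 * d * (2 + z) ^ 3 + 4 * exp (- sqrt (real n) * \<delta>) / normal_tail z"
proof -
  note [measurable] = lin_part_measurable
  define p where "p = prob {\<omega> \<in> space M. \<theta> + t < hodges_lehmann n (\<lambda>i. \<theta> + \<xi> i \<omega>)}"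
  define e where "e = 4 * exp (- sqrt (real n) * \<delta>)"
  define \<eta> where "\<eta> = 20 * \<delta> / sqrt (proj_var t)"
  define c where "c = 4000 * d * (2 + z) ^ 3"
  define a where "a = 4 * exp K * (1 + z) * (K * \<delta>)"
  define T where "T = normal_tail z"
  have T: "0 < T" by (simp add: T_def normal_tail_pos)
  have d0: "0 \<le> d" using s by (simp add: d_def)
  have c: "0 \<le> c" "c \<le> 4000" using d0 z dz by (auto simp: c_def)
  have a: "0 \<le> a" using z \<delta> K by (simp add: a_def)
  have K\<delta>0: "0 \<le> K * \<delta>" using K \<delta> by simp
  have "2 * (10 * (sqrt (real n) * \<delta>)) / (sqrt (proj_var t) * sqrt (real n)) = \<eta>"
    using n by (simp add: \<eta>_def field_simps)
  with hodges_lehmann_sandwich[of n t "10 * (sqrt (real n) * \<delta>)" \<theta>, OF n s] \<delta>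
  have lo: "prob (exceed (lin_part n t) (x + \<eta>)) - e \<le> p"
    and up: "p \<le> prob (exceed (lin_part n t) (x - \<eta>)) + e"
    by (simp_all add: x_def p_def e_def)
  have shift: "K * \<delta> * z \<le> K" using mult_left_mono[OF z\<delta> K] by (simp add: mult_ac)
  have cube: "d * (1 + max y 0) ^ 3 \<le> d * (2 + z) ^ 3" if "y \<le> z + K * \<delta>" for y
    using that K\<delta> z d0 by (intro mult_left_mono power_mono) auto
  have U: "p \<le> T * (1 + 4001 * a + c) + e"
  proof -
    define y where "y = z - K * \<delta>"
    have "prob (exceed (lin_part n t) (x - \<eta>)) \<le> prob (exceed (lin_part n t) (y + 2 * d))"
    proof (rule finite_measure_mono)
      have "y + 2 * d \<le> x - \<eta>" using dev unfolding y_def \<eta>_def by linarith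
      then show "exceed (lin_part n t) (x - \<eta>) \<subseteq> exceed (lin_part n t) (y + 2 * d)" by auto
    qed measurable
    also have "\<dots> \<le> normal_tail y * (1 + 4000 * d * (1 + max y 0) ^ 3)"
    proof (rule lin_part_moderate_deviation(1)[of n t y, folded d_def])
      show "d * (1 + max y 0) ^ 3 \<le> 1" using cube[of y] dz K\<delta>0 by (simp add: y_def)
      show "-1 \<le> y" using z K\<delta> K\<delta>0 by (simp add: y_def)
    qed (use n s in auto)
    also have "\<dots> \<le> (T * (1 + a)) * (1 + c)"
    proof (rule mult_mono)
      show "normal_tail y \<le> T * (1 + a)"
        unfolding y_def T_def a_def using normal_tail_shift(1)[of z "K * \<delta>" K] z K\<delta>0 shift by simp
      show "1 + 4000 * d * (1 + max y 0) ^ 3 \<le> 1 + c"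
        using cube[of y] K\<delta>0 by (simp add: c_def y_def)
      show "0 \<le> 1 + 4000 * d * (1 + max y 0) ^ 3" using d0 by simp
    qed (use T a in simp)
    also have "\<dots> = T * (1 + a + c + a * c)" by (simp add: algebra_simps)
    also have "\<dots> \<le> T * (1 + 4001 * a + c)"
    proof (rule mult_left_mono)
      have "a * c \<le> a * 4000" using c a by (intro mult_left_mono) auto
      then show "1 + a + c + a * c \<le> 1 + 4001 * a + c" by linarith
    qed (use T in simp)
    finally show ?thesis using up by linarith
  qed
  have L: "T * (1 - a - c) - e \<le> p"
  proof -
    define y where "y = z + K * \<delta>"
    have y0: "0 \<le> y" using z K\<delta>0 by (simp add: y_def)
    have "normal_tail y * (1 - 4000 * d * (1 + max y 0) ^ 3) \<le> prob (exceed (lin_part n t) (y - 2 * d))"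
    proof (rule lin_part_moderate_deviation(2)[of n t y, folded d_def])
      show "d * (1 + max y 0) ^ 3 \<le> 1" using cube[of y] dz K\<delta>0 by (simp add: y_def)
      show "-1 \<le> y" using z K\<delta> K\<delta>0 by (simp add: y_def)
    qed (use n s in auto)
    also have "\<dots> \<le> prob (exceed (lin_part n t) (x + \<eta>))"
    proof (rule finite_measure_mono)
      have "x + \<eta> \<le> y - 2 * d" using dev unfolding y_def \<eta>_def by linarith
      then show "exceed (lin_part n t) (y - 2 * d) \<subseteq> exceed (lin_part n t) (x + \<eta>)" by auto
    qed measurable
    finally have 1: "normal_tail y * (1 - 4000 * d * (1 + max y 0) ^ 3) \<le> prob (exceed (lin_part n t) (x + \<eta>))" .
    have "T * (1 - a) \<le> normal_tail y"
    proof -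
      have "4 * 1 * (1 + z) * (K * \<delta>) \<le> a"
        unfolding a_def using K z K\<delta>0 by (intro mult_right_mono mult_left_mono) auto
      then have "T * (1 - a) \<le> T * (1 - 4 * (1 + z) * (K * \<delta>))" using T by (intro mult_left_mono) auto
      also have "\<dots> \<le> normal_tail y"
        unfolding y_def T_def using normal_tail_shift(2)[of z "K * \<delta>" K] z K\<delta>0 shift by simp
      finally show ?thesis .
    qed
    moreover have "normal_tail y * (4000 * d * (1 + max y 0) ^ 3) \<le> T * c"
    proof (rule mult_mono)
      show "normal_tail y \<le> T" unfolding T_def y_def using K\<delta>0 by (intro normal_tail_antimono) simp
      show "4000 * d * (1 + max y 0) ^ 3 \<le> c" using cube[of y] by (simp add: c_def y_def)
    qed (use T d0 in auto)
    ultimately have "T * (1 - a) - T * c \<le> normal_tail y * (1 - 4000 * d * (1 + max y 0) ^ 3)"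
      by (simp add: right_diff_distrib)
    then show ?thesis using 1 lo by (simp add: right_diff_distrib)
  qed
  have "\<bar>p - T\<bar> \<le> T * (4001 * a + c) + e"
  proof -
    have "p - T \<le> T * (4001 * a + c) + e" using U by (simp add: distrib_left)
    moreover have "- (T * (4001 * a + c) + e) \<le> p - T"
    proof -
      have "T * (a + c) \<le> T * (4001 * a + c)" using T a by simp
      moreover have "T * (1 - a - c) = T - T * (a + c)" by (simp add: algebra_simps)
      ultimately show ?thesis using L by linarith
    qed
    ultimately show ?thesis by (simp add: abs_le_iff)
  qed
  then have "\<bar>p - T\<bar> / T \<le> (T * (4001 * a + c) + e) / T" using T by (intro divide_right_mono) auto
  moreover have "\<bar>p - T\<bar> / T = \<bar>p / T - 1\<bar>"
  proof -
    have "p / T - 1 = (p - T) / T" using T by (simp add: diff_divide_distrib)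
    then show ?thesis using T by (simp only: abs_divide abs_of_pos)
  qed
  moreover have "(T * (4001 * a + c) + e) / T = 4001 * a + c + e / T" using T by (simp add: add_divide_distrib)
  ultimately have "\<bar>p / T - 1\<bar> \<le> 4001 * a + c + e / T" by simp
  moreover have "4001 * a = 16004 * exp K * K * ((1 + z) * \<delta>)" by (simp add: a_def)
  ultimately show ?thesis by (simp only: p_def T_def c_def e_def)
qed

lemma tail_ratio_trivial_bound:
  assumes "z \<le> b"
  shows "\<bar>prob E / normal_tail z - 1\<bar> \<le> 1 + 1 / normal_tail b"
proof -
  have "prob E / normal_tail z \<le> 1 / normal_tail b"
    using normal_tail_pos[of b] normal_tail_antimono[OF assms] by (intro frac_le) auto
  moreover have "0 \<le> prob E / normal_tail z" "0 \<le> 1 / normal_tail b"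
    using normal_tail_nonneg by simp_all
  ultimately show ?thesis unfolding abs_le_iff by linarith
qed

lemma proj_var_sqrt_close:
  assumes S: "0 < proj_var 0" and t: "0 \<le> t" "8 * B * t \<le> 3 / 4 * proj_var 0"
  shows "sqrt (proj_var 0) / 2 \<le> sqrt (proj_var t)" and "\<bar>sqrt (proj_var 0) - sqrt (proj_var t)\<bar> \<le> 8 * B * t / sqrt (proj_var 0)"
proof -
  have close: "\<bar>proj_var t - proj_var 0\<bar> \<le> 8 * B * t" by (rule proj_var_lipschitz[OF t(1)])
  then have "proj_var 0 / 4 \<le> proj_var t" using t(2) unfolding abs_le_iff by argo
  then have "sqrt (proj_var 0 / 4) \<le> sqrt (proj_var t)" by (rule real_sqrt_le_mono)
  then show "sqrt (proj_var 0) / 2 \<le> sqrt (proj_var t)" by (simp add: real_sqrt_divide)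
  define S s where "S = sqrt (proj_var 0)" and "s = sqrt (proj_var t)"
  have S0: "0 < S" "0 \<le> s" using S proj_var_nonneg by (auto simp: S_def s_def)
  have "\<bar>S - s\<bar> * S \<le> \<bar>S - s\<bar> * (S + s)" using S0 by (intro mult_left_mono) auto
  also have "\<dots> = \<bar>(S - s) * (S + s)\<bar>" using S0 by (simp add: abs_mult)
  also have "(S - s) * (S + s) = proj_var 0 - proj_var t"
    using proj_var_nonneg by (simp add: S_def s_def algebra_simps flip: power2_eq_square)
  finally have "\<bar>S - s\<bar> * S \<le> 8 * B * t" using close by (simp add: abs_minus_commute)
  then show "\<bar>sqrt (proj_var 0) - sqrt (proj_var t)\<bar> \<le> 8 * B * t / sqrt (proj_var 0)"
    using S0 by (simp add: pos_le_divide_eq S_def s_def)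
qed

text \<open>With \<open>t = \<sigma> z / sqrt n\<close> the linear term of the Taylor expansion contributes
  \<open>z\<close> times the ratio of the standard deviations at 0 and at \<open>t\<close>. Both the
  deviation of this ratio from 1 and the Taylor remainder give \<open>O(z\<^sup>2 / sqrt n)\<close>.\<close>
lemma threshold_close:
  fixes n :: nat
  assumes u: "\<bar>U t - 1 / 2 - u' * t\<bar> \<le> \<kappa> * t\<^sup>2" and u': "0 < u'" and S: "0 < proj_var 0"
    and n: "0 < n" and z: "0 \<le> z" and t_def: "t = \<sigma> * z / sqrt (real n)" and \<sigma>: "\<sigma> = 2 * sqrt (proj_var 0) / u'"
    and small: "8 * B * t \<le> 3 / 4 * proj_var 0" and \<delta>: "z\<^sup>2 \<le> sqrt (real n) * \<delta>" and \<kappa>: "0 \<le> \<kappa>"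
  shows "\<bar>sqrt (real n) * (U t - 1 / 2) / (2 * sqrt (proj_var t)) - z\<bar> \<le>
    (16 * B * \<sigma> / proj_var 0 + \<kappa> * \<sigma>\<^sup>2 / sqrt (proj_var 0)) * \<delta>"
proof -
  define S s r where "S = sqrt (proj_var 0)" and "s = sqrt (proj_var t)" and "r = sqrt (real n)"
  define \<rho> where "\<rho> = U t - 1 / 2 - u' * t"
  have S0: "0 < S" "S\<^sup>2 = proj_var 0" using S by (auto simp: S_def)
  have r0: "0 < r" using n by (simp add: r_def)
  have \<sigma>0: "0 < \<sigma>" using S0 u' by (simp add: \<sigma> S_def)
  have t0: "0 \<le> t" using \<sigma>0 z by (simp add: t_def)
  have s: "S / 2 \<le> s" "\<bar>S - s\<bar> \<le> 8 * B * t / S"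
    using proj_var_sqrt_close[OF S t0 small] by (simp_all add: S_def s_def)
  then have s0: "0 < s" using S0 by linarith
  have inv: "1 / s \<le> 2 / S" using s S0 by (simp add: field_simps)
  have rt: "r * (u' * t) = 2 * S * z"
    using r0 u' by (simp add: t_def \<sigma> S_def r_def)
  have z2: "z\<^sup>2 / r \<le> \<delta>" using \<delta> r0 by (simp add: r_def field_simps)
  have "r * (U t - 1 / 2) / (2 * s) - z = (2 * S * z + r * \<rho>) / (2 * s) - z"
    unfolding rt[symmetric] by (simp add: \<rho>_def algebra_simps)
  also have "\<dots> = z * (S - s) * (1 / s) + r * \<rho> / 2 * (1 / s)"
    using s0 by (simp add: field_simps)
  also have "\<bar>\<dots>\<bar> \<le> \<bar>z * (S - s) * (1 / s)\<bar> + \<bar>r * \<rho> / 2 * (1 / s)\<bar>" by (rule abs_triangle_ineq)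
  also have "\<bar>z * (S - s) * (1 / s)\<bar> = z * \<bar>S - s\<bar> * (1 / s)" using z s0 by (simp add: abs_mult)
  also have "\<bar>r * \<rho> / 2 * (1 / s)\<bar> = r * \<bar>\<rho>\<bar> / 2 * (1 / s)" using r0 s0 by (simp add: abs_mult)
  also have "z * \<bar>S - s\<bar> * (1 / s) \<le> z * (8 * B * t / S) * (2 / S)"
    using z s inv s0 S0 t0 B_nonneg by (intro mult_mono) auto
  also have "z * (8 * B * t / S) * (2 / S) = 16 * B * \<sigma> / S\<^sup>2 * (z\<^sup>2 / r)"
    using r0 S0 by (simp add: t_def r_def[symmetric] power2_eq_square field_simps)
  also have "\<dots> \<le> 16 * B * \<sigma> / S\<^sup>2 * \<delta>"
    using z2 B_nonneg \<sigma>0 by (intro mult_left_mono) auto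
  also have "r * \<bar>\<rho>\<bar> / 2 * (1 / s) \<le> r * (\<kappa> * t\<^sup>2) / 2 * (2 / S)"
    using u inv r0 s0 S0 \<kappa> unfolding \<rho>_def by (intro mult_mono divide_right_mono mult_left_mono) auto
  also have "r * (\<kappa> * t\<^sup>2) / 2 * (2 / S) = \<kappa> * \<sigma>\<^sup>2 / S * (z\<^sup>2 / r)"
    using r0 S0 by (simp add: t_def r_def[symmetric] power2_eq_square field_simps)
  also have "\<dots> \<le> \<kappa> * \<sigma>\<^sup>2 / S * \<delta>" using z2 \<kappa> S0 by (intro mult_left_mono) auto
  finally show ?thesis by (simp add: S0 S_def[symmetric] s_def[symmetric] r_def[symmetric] distrib_right)
qed

end

section \<open>Uniformity over the moderate deviation range\<close>

abbreviation md_range :: "nat \<Rightarrow> real \<Rightarrow> real" where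
  "md_range n \<delta> \<equiv> min (inverse \<delta>) (real n powr (1/4) * sqrt \<delta>)"

text \<open>The error bound of the theorem without its constant.\<close>
definition md_error :: "nat \<Rightarrow> real \<Rightarrow> real \<Rightarrow> real" where
  "md_error n \<delta> z = (1 + z ^ 3) / sqrt (real n) + (1 + z) * \<delta>
      + 2 * max z 1 * sqrt (2 * pi) * exp (z\<^sup>2 / 2 - sqrt (real n) * \<delta>)"

lemma md_error_ge:
  assumes "0 \<le> z" "0 \<le> \<delta>"
  shows "(1 + z ^ 3) / sqrt (real n) \<le> md_error n \<delta> z" "(1 + z) * \<delta> \<le> md_error n \<delta> z"
    and "2 * max z 1 * sqrt (2 * pi) * exp (z\<^sup>2 / 2 - sqrt (real n) * \<delta>) \<le> md_error n \<delta> z"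
proof -
  have "0 \<le> (1 + z ^ 3) / sqrt (real n)" "0 \<le> (1 + z) * \<delta>"
    "0 \<le> 2 * max z 1 * sqrt (2 * pi) * exp (z\<^sup>2 / 2 - sqrt (real n) * \<delta>)"
    using assms by auto
  then show "(1 + z ^ 3) / sqrt (real n) \<le> md_error n \<delta> z" "(1 + z) * \<delta> \<le> md_error n \<delta> z"
    "2 * max z 1 * sqrt (2 * pi) * exp (z\<^sup>2 / 2 - sqrt (real n) * \<delta>) \<le> md_error n \<delta> z"
    unfolding md_error_def by linarith+
qed

text \<open>The two constraints on \<open>z\<close> give \<open>z \<delta> \<le> \<epsilon>\<close> and
  \<open>z\<^sup>2 \<le> sqrt n \<delta>\<close>; their product is the cubic range
  \<open>z\<^sup>3 \<le> \<epsilon> sqrt n\<close> of the moderate deviation estimate.\<close>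
lemma range_consequences:
  fixes n :: nat and \<delta> z \<epsilon> :: real
  assumes n: "0 < n" and \<delta>: "0 < \<delta>" and z: "0 \<le> z" and \<epsilon>: "0 < \<epsilon>" "\<epsilon> \<le> 1"
    and le: "z \<le> \<epsilon> * md_range n \<delta>"
  shows "z * \<delta> \<le> 1" "z\<^sup>2 \<le> sqrt (real n) * \<delta>" "z ^ 3 \<le> \<epsilon> * sqrt (real n)"
proof -
  define r where "r = sqrt (real n)"
  have r: "0 < r" using n by (simp add: r_def)
  have q2: "(real n powr (1/4))\<^sup>2 = r"
  proof -
    have "(real n powr (1/4))\<^sup>2 = real n powr (1/4 + 1/4)" unfolding power2_eq_square powr_add ..
    then show ?thesis using n by (simp add: r_def powr_half_sqrt)
  qed
  have m1: "z \<le> \<epsilon> * inverse \<delta>"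
    using le \<epsilon> by (meson order_trans min.cobounded1 mult_left_mono less_imp_le)
  then have e1: "z * \<delta> \<le> \<epsilon>" using \<delta> by (simp add: field_simps)
  then show "z * \<delta> \<le> 1" using \<epsilon> by simp
  have "z \<le> \<epsilon> * (real n powr (1/4) * sqrt \<delta>)"
    using le \<epsilon> by (meson order_trans min.cobounded2 mult_left_mono less_imp_le)
  also have "\<dots> \<le> real n powr (1/4) * sqrt \<delta>" using \<epsilon> \<delta> by (intro mult_left_le_one_le) auto
  finally have "z\<^sup>2 \<le> (real n powr (1/4) * sqrt \<delta>)\<^sup>2" using z by (intro power_mono) auto
  also have "\<dots> = r * \<delta>" using q2 \<delta> by (simp add: power_mult_distrib)
  finally have e2: "z\<^sup>2 \<le> r * \<delta>" .
  then show "z\<^sup>2 \<le> sqrt (real n) * \<delta>" by (simp add: r_def)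
  have "z ^ 3 = z * z\<^sup>2" by (simp add: power2_eq_square power3_eq_cube)
  also have "\<dots> \<le> z * (r * \<delta>)" using e2 z by (rule mult_left_mono)
  also have "\<dots> = r * (z * \<delta>)" by simp
  also have "\<dots> \<le> r * \<epsilon>" using e1 r by (intro mult_left_mono) auto
  finally show "z ^ 3 \<le> \<epsilon> * sqrt (real n)" by (simp add: r_def mult.commute)
qed

lemma add_cube_le: "0 \<le> a \<Longrightarrow> 0 \<le> b \<Longrightarrow> (a + b) ^ 3 \<le> 4 * (a ^ 3 + b ^ 3)" for a b :: real
proof -
  assume ab: "0 \<le> a" "0 \<le> b"
  have "4 * (a ^ 3 + b ^ 3) - (a + b) ^ 3 = 3 * ((a + b) * (a - b)\<^sup>2)"
    by (simp add: power2_eq_square power3_eq_cube algebra_simps)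
  moreover have "0 \<le> (a + b) * (a - b)\<^sup>2" using ab by simp
  ultimately show ?thesis by linarith
qed

text \<open>The estimate at fixed sample size applies once \<open>n\<close> is large and
  \<open>K \<delta>\<^sub>n \<le> 1\<close>. In the remaining cases the tail ratio is bounded, because
  \<open>z\<close> is: for the finitely many small \<open>n\<close> by \<open>a n\<close>, and the
  bound is at least \<open>1 / sqrt n\<close>; for \<open>\<delta>\<^sub>n > 1 / K\<close> by
  \<open>K\<close>, and the bound is at least \<open>\<delta>\<^sub>n\<close>.\<close>
lemma (in iid_bounded_density) hodges_lehmann_moderate_deviation:
  fixes a \<delta> :: "nat \<Rightarrow> real" and \<theta> u' \<kappa> t1 :: real
  assumes u: "\<And>t. 0 \<le> t \<Longrightarrow> t \<le> t1 \<Longrightarrow> \<bar>U t - 1 / 2 - u' * t\<bar> \<le> \<kappa> * t\<^sup>2"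
    and u': "0 < u'" and t1: "0 < t1" and \<kappa>: "0 \<le> \<kappa>" and S2: "0 < proj_var 0"
    and \<delta>: "\<And>n. n \<ge> 1 \<Longrightarrow> \<delta> n > 0"
    and \<delta>_lim: "filterlim (\<lambda>n. sqrt (real n) * \<delta> n) at_top sequentially"
    and a: "a \<in> o(\<lambda>n. md_range n (\<delta> n))"
  defines "\<sigma> \<equiv> 2 * sqrt (proj_var 0) / u'"
  shows "\<exists>C>0. \<forall>n\<ge>2. \<forall>z. 0 < z \<and> z \<le> a n \<longrightarrow>
     \<bar>prob {\<omega> \<in> space M. \<theta> + \<sigma> * z / sqrt (real n) < hodges_lehmann n (\<lambda>i. \<theta> + \<xi> i \<omega>)} / normal_tail z - 1\<bar>
       \<le> C * md_error n (\<delta> n) z"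
proof -
  define S where "S = sqrt (proj_var 0)"
  have S: "0 < S" "S\<^sup>2 = proj_var 0" using S2 by (auto simp: S_def)
  have \<sigma>: "0 < \<sigma>" using S u' by (simp add: \<sigma>_def S_def)
  define t0 where "t0 = min t1 (3 / 4 * proj_var 0 / (8 * B + 1))"
  have t0: "0 < t0" using t1 S2 B_nonneg by (simp add: t0_def)
  have t0B: "8 * B * t \<le> 3 / 4 * proj_var 0" if "0 \<le> t" "t \<le> t0" for t
  proof -
    have "8 * B * t \<le> (8 * B + 1) * t" using that by (intro mult_right_mono) auto
    also have "\<dots> \<le> (8 * B + 1) * (3 / 4 * proj_var 0 / (8 * B + 1))"
      using that B_nonneg by (intro mult_left_mono) (auto simp: t0_def)
    also have "\<dots> = 3 / 4 * proj_var 0"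
    proof -
      have "8 * B + 1 \<noteq> 0" using B_nonneg by simp
      moreover have "w * (k / w) = k" if "w \<noteq> 0" for w k :: real using that by simp
      ultimately show ?thesis by blast
    qed
    finally show ?thesis .
  qed
  define D where "D = 16 * B * \<sigma> / proj_var 0 + \<kappa> * \<sigma>\<^sup>2 / S"
  \<comment> \<open>Of the 44, the degenerate part takes 40 and the window of Stein's method 4; both use
    that the standard deviation at \<open>t\<close> is at least \<open>S / 2\<close>.\<close>
  define K where "K = D + 44 / S"
  have D: "0 \<le> D" using B_nonneg \<sigma> S S2 \<kappa> by (simp add: D_def)
  have K: "0 < K" using D S by (simp add: K_def add_nonneg_pos)
  \<comment> \<open>Small enough to keep \<open>t\<close> below \<open>t0\<close> and the cubic condition of the
    moderate deviation estimate satisfied.\<close>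
  define \<epsilon> where "\<epsilon> = min 1 (min (t0 / (2 * \<sigma>)) (S / 16))"
  have \<epsilon>: "0 < \<epsilon>" "\<epsilon> \<le> 1" "\<epsilon> \<le> t0 / (2 * \<sigma>)" "\<epsilon> \<le> S / 16" using t0 \<sigma> S by (auto simp: \<epsilon>_def)
  have "\<forall>\<^sub>F n in sequentially. norm (a n) \<le> \<epsilon> * norm (md_range n (\<delta> n))"
    using landau_o.smallD[OF a \<epsilon>(1)] .
  moreover have "\<forall>\<^sub>F n in sequentially. 1 \<le> sqrt (real n) * \<delta> n"
    using \<delta>_lim by (simp add: filterlim_at_top)
  moreover have "\<forall>\<^sub>F n in sequentially. 8 / \<epsilon> \<le> sqrt (real n)"
  proof -
    have "filterlim (\<lambda>n. sqrt (real n)) at_top sequentially" by real_asymp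
    then show ?thesis by (simp add: filterlim_at_top)
  qed
  moreover have "\<forall>\<^sub>F n in sequentially. 2 \<le> n" by (rule eventually_ge_at_top)
  ultimately have "\<forall>\<^sub>F n in sequentially. norm (a n) \<le> \<epsilon> * norm (md_range n (\<delta> n))
     \<and> 1 \<le> sqrt (real n) * \<delta> n \<and> 8 / \<epsilon> \<le> sqrt (real n) \<and> 2 \<le> n"
    by eventually_elim blast
  then obtain N where N: "\<And>n. n \<ge> N \<Longrightarrow> norm (a n) \<le> \<epsilon> * norm (md_range n (\<delta> n))
     \<and> 1 \<le> sqrt (real n) * \<delta> n \<and> 8 / \<epsilon> \<le> sqrt (real n) \<and> 2 \<le> n"
    by (auto simp: eventually_sequentially)
  define C1 where "C1 = 16004 * exp K * K + 256000 / S + 8"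
  define C2 where "C2 = (1 + 1 / normal_tail K) * K"
  define C3 where "C3 = (\<Sum>n<N. (1 + 1 / normal_tail (a n)) * sqrt (real n))"
  have C: "0 < C1" "0 \<le> C2" "0 \<le> C3"
    using K S normal_tail_nonneg by (auto simp: C1_def C2_def C3_def intro!: sum_nonneg add_pos_nonneg)
  define err where "err n z = \<bar>prob {\<omega> \<in> space M. \<theta> + \<sigma> * z / sqrt (real n) < hodges_lehmann n (\<lambda>i. \<theta> + \<xi> i \<omega>)} / normal_tail z - 1\<bar>" for n z
  have main: "err n z \<le> (C1 + C2 + C3) * md_error n (\<delta> n) z" if n: "2 \<le> n" and z: "0 < z" "z \<le> a n" for n z
  proof -
    have \<delta>n: "0 < \<delta> n" using \<delta> n by simp
    define r where "r = sqrt (real n)"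
    have r: "0 < r" using n by (simp add: r_def)
    define m where "m = md_error n (\<delta> n) z"
    note ge = md_error_ge[of z "\<delta> n" n, folded m_def r_def]
    have m0: "0 \<le> m" using ge(2) z \<delta>n by (smt (verit) mult_nonneg_nonneg)
    have one: "err n z \<le> c * m \<Longrightarrow> c \<le> C1 + C2 + C3 \<Longrightarrow> err n z \<le> (C1 + C2 + C3) * m" for c
      using m0 by (meson mult_right_mono order_trans)
    show ?thesis unfolding m_def[symmetric]
    proof (cases "n < N")
      case True
      have "err n z \<le> 1 + 1 / normal_tail (a n)" unfolding err_def by (rule tail_ratio_trivial_bound[OF z(2)])
      also have "\<dots> = (1 + 1 / normal_tail (a n)) * r * (1 / r)" using r by simp
      also have "\<dots> \<le> C3 * m"
      proof (rule mult_mono)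
        show "(1 + 1 / normal_tail (a n)) * r \<le> C3"
          unfolding C3_def r_def using True normal_tail_nonneg
          by (intro member_le_sum[where f = "\<lambda>n. (1 + 1 / normal_tail (a n)) * sqrt (real n)"]) auto
        have "1 / r \<le> (1 + z ^ 3) / r" using r z by (intro divide_right_mono) auto
        then show "1 / r \<le> m" using ge(1) z \<delta>n by linarith
      qed (use C r in auto)
      finally show "err n z \<le> (C1 + C2 + C3) * m" using C by (intro one) auto
    next
      case False
      with N[of n] have Nn: "\<bar>a n\<bar> \<le> \<epsilon> * \<bar>md_range n (\<delta> n)\<bar>"
        "1 \<le> r * \<delta> n" "8 / \<epsilon> \<le> r" by (auto simp: r_def)
      have "z \<le> \<epsilon> * md_range n (\<delta> n)"
        using Nn(1) z \<delta>n by (simp add: abs_of_nonneg)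
      from range_consequences[OF _ \<delta>n _ \<epsilon>(1,2) this] n z
      have z\<delta>: "z * \<delta> n \<le> 1" and z2: "z\<^sup>2 \<le> r * \<delta> n" and z3: "z ^ 3 \<le> \<epsilon> * r" by (auto simp: r_def)
      show "err n z \<le> (C1 + C2 + C3) * m"
      proof (cases "K * \<delta> n \<le> 1")
        case False
        have "z * \<delta> n \<le> K * \<delta> n" using z\<delta> False by linarith
        then have "z \<le> K" using \<delta>n by simp
        then have "err n z \<le> 1 + 1 / normal_tail K" unfolding err_def by (rule tail_ratio_trivial_bound)
        also have "\<dots> = (1 + 1 / normal_tail K) * 1" by simp
        also have "\<dots> \<le> (1 + 1 / normal_tail K) * (K * \<delta> n)"
          using False normal_tail_nonneg[of K] by (intro mult_left_mono) auto
        also have "\<dots> = C2 * (1 * \<delta> n)" by (simp add: C2_def)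
        also have "\<dots> \<le> C2 * ((1 + z) * \<delta> n)" using C z \<delta>n by (intro mult_left_mono mult_right_mono) auto
        also have "\<dots> \<le> C2 * m" using C ge(2) z \<delta>n by (intro mult_left_mono) auto
        finally show ?thesis using C by (intro one) auto
      next
        case True
        define t where "t = \<sigma> * z / r"
        have r\<epsilon>: "1 / r \<le> \<epsilon> / 8" using Nn(3) r \<epsilon>(1) by (simp add: field_simps)
        have "z \<le> 1 + z ^ 3"
        proof (cases "z \<le> 1")
          case False
          then have "z \<le> z ^ 3" by (intro self_le_power) auto
          then show ?thesis by simp
        qed (use z in \<open>simp add: add_increasing2\<close>)
        then have "z / r \<le> (1 + z ^ 3) / r" using r by (intro divide_right_mono) auto
        also have "\<dots> \<le> 1 / r + \<epsilon>" using z3 r by (simp add: add_divide_distrib divide_le_eq)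
        also have "\<dots> \<le> 2 * \<epsilon>" using r\<epsilon> \<epsilon>(1) by argo
        finally have "\<sigma> * (z / r) \<le> \<sigma> * (2 * \<epsilon>)" using \<sigma> by (intro mult_left_mono) auto
        also have "\<dots> \<le> t0" using \<epsilon>(3) \<sigma> by (simp add: field_simps)
        finally have tt0: "t \<le> t0" by (simp add: t_def)
        have t: "0 \<le> t" using \<sigma> z r by (simp add: t_def)
        note small = t0B[OF t tt0]
        define s where "s = sqrt (proj_var t)"
        have s: "S / 2 \<le> s" using proj_var_sqrt_close(1)[OF S2 t small] by (simp add: S_def s_def)
        then have s0: "0 < s" using S by linarith
        then have s2t: "0 < proj_var t" by (simp add: s_def)
        have inv: "1 / s \<le> 2 / S" using s S s0 by (simp add: field_simps)
        define x where "x = sqrt (real n) * (U t - 1 / 2) / (2 * sqrt (proj_var t))"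
        define d where "d = 1 / (sqrt (real n) * sqrt (proj_var t))"
        have d_le: "d \<le> 2 / S * (1 / r)"
        proof -
          have "d = 1 / s * (1 / r)" by (simp add: d_def s_def r_def)
          also have "\<dots> \<le> 2 / S * (1 / r)" using inv r by (intro mult_right_mono) auto
          finally show ?thesis .
        qed
        have d0: "0 \<le> d" using r s0 by (simp add: d_def s_def r_def)
        have xz: "\<bar>x - z\<bar> \<le> D * \<delta> n"
          unfolding x_def D_def S_def
          by (rule threshold_close[where u' = u' and z = z])
             (use u[of t] t tt0 u' S2 n z small z2 \<kappa> in \<open>auto simp: t_def r_def \<sigma>_def t0_def\<close>)
        have dev: "\<bar>x - z\<bar> + 20 * \<delta> n / sqrt (proj_var t) + 2 * d \<le> K * \<delta> n"
        proof -
          have "20 * \<delta> n / sqrt (proj_var t) = 20 * \<delta> n * (1 / s)" by (simp add: s_def)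
          also have "\<dots> \<le> 20 * \<delta> n * (2 / S)" using inv \<delta>n by (intro mult_left_mono) auto
          also have "\<dots> = 40 / S * \<delta> n" by simp
          finally have 1: "20 * \<delta> n / sqrt (proj_var t) \<le> 40 / S * \<delta> n" .
          have "1 / r \<le> \<delta> n" using Nn(2) r by (simp add: field_simps)
          then have "2 / S * (1 / r) \<le> 2 / S * \<delta> n" using S by (intro mult_left_mono) auto
          then have 2: "d \<le> 2 / S * \<delta> n" using d_le by linarith
          have 3: "K * \<delta> n = D * \<delta> n + 40 / S * \<delta> n + 2 * (2 / S * \<delta> n)" by (simp add: K_def algebra_simps)
          show ?thesis unfolding 3 using xz 1 2 by linarith
        qed
        have cube2: "(2 + z) ^ 3 \<le> 32 + 4 * z ^ 3"
          using add_cube_le[of 2 z] z by simp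
        moreover have "0 \<le> z ^ 3" using z by simp
        ultimately have cube1: "(2 + z) ^ 3 \<le> 32 * (1 + z ^ 3)" by argo
        have dz: "d * (2 + z) ^ 3 \<le> 1"
        proof -
          have "d * (2 + z) ^ 3 \<le> 2 / S * (1 / r) * (32 + 4 * (\<epsilon> * r))"
            using d_le cube2 z3 d0 z r S by (intro mult_mono) auto
          also have "\<dots> = 64 / S * (1 / r) + 8 / S * \<epsilon>" using r S by (simp add: field_simps)
          also have "\<dots> \<le> 64 / S * (\<epsilon> / 8) + 8 / S * \<epsilon>" using r\<epsilon> S by (intro add_right_mono mult_left_mono) auto
          also have "\<dots> = 16 / S * \<epsilon>" by simp
          also have "\<dots> \<le> 1" using \<epsilon>(4) S by (simp add: field_simps)
          finally show ?thesis .
        qed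
        have "err n z \<le> 16004 * exp K * K * ((1 + z) * \<delta> n) + 4000 * d * (2 + z) ^ 3
            + 4 * exp (- sqrt (real n) * \<delta> n) / normal_tail z"
          unfolding err_def r_def[symmetric] t_def[symmetric]
          using hodges_lehmann_tail_ratio[OF n s2t z(1) \<delta>n less_imp_le[OF K], folded x_def d_def, OF dev True z\<delta> dz]
          by (simp add: r_def)
        also have "4000 * d * (2 + z) ^ 3 \<le> 256000 / S * m"
        proof -
          have "4000 * d * (2 + z) ^ 3 \<le> 4000 * (2 / S * (1 / r)) * (32 * (1 + z ^ 3))"
            using d_le cube1 d0 z r S by (intro mult_mono) auto
          also have "\<dots> = 256000 / S * ((1 + z ^ 3) / r)" by simp
          also have "\<dots> \<le> 256000 / S * m" using ge(1) z \<delta>n S by (intro mult_left_mono) auto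
          finally show ?thesis .
        qed
        also have "4 * exp (- sqrt (real n) * \<delta> n) / normal_tail z \<le> 8 * m"
        proof -
          have "4 * exp (- r * \<delta> n) * (1 / normal_tail z) \<le>
              4 * exp (- r * \<delta> n) * (4 * max z 1 * sqrt (2 * pi) * exp (z\<^sup>2 / 2))"
            using z by (intro mult_left_mono inverse_normal_tail_le) auto
          also have "\<dots> = 8 * (2 * max z 1 * sqrt (2 * pi) * (exp (z\<^sup>2 / 2) * exp (- r * \<delta> n)))" by simp
          also have "exp (z\<^sup>2 / 2) * exp (- r * \<delta> n) = exp (z\<^sup>2 / 2 - r * \<delta> n)" by (simp flip: exp_add)
          also have "8 * (2 * max z 1 * sqrt (2 * pi) * exp (z\<^sup>2 / 2 - r * \<delta> n)) \<le> 8 * m"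
            using ge(3) z \<delta>n by simp
          finally show ?thesis by (simp add: r_def)
        qed
        also have "16004 * exp K * K * ((1 + z) * \<delta> n) \<le> 16004 * exp K * K * m"
          using ge(2) z \<delta>n K by (intro mult_left_mono) auto
        finally have "err n z \<le> C1 * m" by (simp add: C1_def algebra_simps)
        then show ?thesis using C by (intro one) auto
      qed
    qed
  qed
  have "0 < C1 + C2 + C3" using C by simp
  then show ?thesis using main unfolding err_def by (intro exI[of _ "C1 + C2 + C3"]) blast
qed

lemma powr_sixth:
  fixes x :: real
  assumes x: "0 < x"
  shows "(x powr (1/6)) ^ 3 = sqrt x" "(x powr (1/6))\<^sup>2 = x powr (1/3)" "x powr (-1/6) = 1 / x powr (1/6)"
proof -
  have pw: "(x powr (1/6)) ^ k = x powr (1/6 * real k)" for k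
    using x powr_realpow[of "x powr (1/6)" k] by (simp add: powr_powr)
  show "(x powr (1/6)) ^ 3 = sqrt x" using x pw[of 3] by (simp add: powr_half_sqrt)
  show "(x powr (1/6))\<^sup>2 = x powr (1/3)" using pw[of 2] by simp
  show "x powr (-1/6) = 1 / x powr (1/6)" using powr_minus_divide[of x "1/6"] by simp
qed

text \<open>Put \<open>q = n\<^sup>1\<^sup>/\<^sup>6\<close> and \<open>z \<le> e q\<close>. The first two
  terms are at most a multiple of \<open>e\<close> plus null sequences, and in the exponent
  \<open>z\<^sup>2 / 2\<close> takes away at most half of
  \<open>sqrt n \<delta>\<^sub>n \<ge> c1 q\<^sup>2\<close>.\<close>
lemma md_error_vanishes:
  fixes \<delta> a :: "nat \<Rightarrow> real"
  assumes \<delta>: "\<And>n. n \<ge> 1 \<Longrightarrow> \<delta> n > 0" and \<delta>_eq: "\<delta> \<in> \<Theta>(\<lambda>n. real n powr (-1/6))"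
    and a: "a \<in> o(\<lambda>n. real n powr (1/6))" and C: "0 < C" and \<epsilon>: "0 < (\<epsilon>::real)"
  shows "\<forall>\<^sub>F n in sequentially. \<forall>z. 0 < z \<and> z \<le> a n \<longrightarrow> C * md_error n (\<delta> n) z < \<epsilon>"
proof -
  from \<delta>_eq obtain c1 where c1: "0 < c1" "\<forall>\<^sub>F n in sequentially. norm (\<delta> n) \<ge> c1 * norm (real n powr (-1/6))"
    by (auto elim!: landau_omega.bigE simp: bigtheta_def)
  from \<delta>_eq obtain c2 where c2: "0 < c2" "\<forall>\<^sub>F n in sequentially. norm (\<delta> n) \<le> c2 * norm (real n powr (-1/6))"
    by (auto elim!: landau_o.bigE simp: bigtheta_def)
  define e where "e = min 1 (min c1 (\<epsilon> / (4 * C * (1 + c2))))"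
  have e: "0 < e" "e \<le> 1" "e \<le> c1"
    using c1(1) c2(1) C \<epsilon> by (simp_all add: e_def)
  have eC: "C * (e * (1 + c2)) \<le> \<epsilon> / 4"
  proof -
    have "e \<le> \<epsilon> / (4 * C * (1 + c2))" by (simp add: e_def)
    moreover have "0 < 4 * C * (1 + c2)" using C c2(1) by simp
    ultimately have "e * (4 * C * (1 + c2)) \<le> \<epsilon>" by (simp only: pos_le_divide_eq)
    then show ?thesis by (simp add: mult_ac)
  qed
  define R where "R n = C * (1 / sqrt (real n) + c2 * real n powr (-1/6)
     + 2 * (1 + real n powr (1/6)) * sqrt (2 * pi) * exp (- (c1 / 2) * real n powr (1/3)))" for n
  have "R \<longlonglongrightarrow> 0" unfolding R_def using c1(1) by real_asymp
  then have "\<forall>\<^sub>F n in sequentially. R n < \<epsilon> / 4" using \<epsilon> by (intro order_tendstoD) auto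
  moreover have "\<forall>\<^sub>F n in sequentially. norm (a n) \<le> e * norm (real n powr (1/6))"
    using landau_o.smallD[OF a e(1)] .
  ultimately show ?thesis
    using c1(2) c2(2) eventually_ge_at_top[of 1]
  proof eventually_elim
    case (elim n)
    define q where "q = real n powr (1/6)"
    have n: "0 < real n" using elim by simp
    have q: "0 < q" using n by (simp add: q_def)
    note q3 = powr_sixth[OF n, folded q_def]
    have \<delta>n: "0 < \<delta> n" "c1 / q \<le> \<delta> n" "\<delta> n \<le> c2 / q"
      using elim(3-5) \<delta>[of n] q unfolding q3(3) by auto
    show ?case
    proof (intro allI impI)
      fix z assume z: "0 < z \<and> z \<le> a n"
      then have zq: "0 < z" "z \<le> e * q" using elim by (auto simp: q_def)
      then have zq1: "z \<le> q" using e q by (smt (verit) mult_left_le_one_le)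
      have "z ^ 3 \<le> (e * q) ^ 3" using zq by (intro power_mono) auto
      also have "\<dots> = e ^ 3 * q ^ 3" by (simp add: power_mult_distrib)
      also have "\<dots> \<le> e * q ^ 3" using e q by (intro mult_right_mono) (auto simp: power_le_one_iff power3_eq_cube mult_le_one intro!: mult_left_le)
      finally have "(1 + z ^ 3) / q ^ 3 \<le> (1 + e * q ^ 3) / q ^ 3" using q by (intro divide_right_mono) auto
      also have "\<dots> = 1 / q ^ 3 + e" using q by (simp add: add_divide_distrib)
      finally have b1: "(1 + z ^ 3) / q ^ 3 \<le> 1 / q ^ 3 + e" .
      have "(1 + z) * \<delta> n \<le> (1 + e * q) * (c2 / q)" using zq \<delta>n q c2 e by (intro mult_mono) auto
      also have "\<dots> = c2 * (1 / q) + c2 * e" using q by (simp add: field_simps)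
      finally have b2: "(1 + z) * \<delta> n \<le> c2 * (1 / q) + c2 * e" .
      have "z\<^sup>2 \<le> (e * q)\<^sup>2" using zq by (intro power_mono) auto
      also have "\<dots> = (e * e) * q\<^sup>2" by (simp add: power2_eq_square)
      also have "\<dots> \<le> (1 * c1) * q\<^sup>2" using e q by (intro mult_right_mono mult_mono) auto
      finally have "z\<^sup>2 / 2 \<le> c1 / 2 * q\<^sup>2" by simp
      moreover have "c1 * q\<^sup>2 \<le> q ^ 3 * \<delta> n"
      proof -
        have "c1 * q\<^sup>2 = q ^ 3 * (c1 / q)" using q by (simp add: power2_eq_square power3_eq_cube)
        also have "\<dots> \<le> q ^ 3 * \<delta> n" using \<delta>n q by (intro mult_left_mono) auto
        finally show ?thesis .
      qed
      ultimately have "z\<^sup>2 / 2 - q ^ 3 * \<delta> n \<le> - (c1 / 2) * q\<^sup>2" by argo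
      then have "2 * max z 1 * sqrt (2 * pi) * exp (z\<^sup>2 / 2 - q ^ 3 * \<delta> n) \<le>
          2 * (1 + q) * sqrt (2 * pi) * exp (- (c1 / 2) * q\<^sup>2)"
        using zq zq1 q by (intro mult_mono) auto
      with b1 b2 have "md_error n (\<delta> n) z \<le> (1 / q ^ 3 + e) + (c2 * (1 / q) + c2 * e)
          + 2 * (1 + q) * sqrt (2 * pi) * exp (- (c1 / 2) * q\<^sup>2)"
        unfolding md_error_def q3(1)[symmetric] by linarith
      also have "\<dots> = e * (1 + c2) + (1 / q ^ 3 + c2 * (1 / q) + 2 * (1 + q) * sqrt (2 * pi) * exp (- (c1 / 2) * q\<^sup>2))"
        by (simp add: algebra_simps)
      finally have "C * md_error n (\<delta> n) z \<le> C * (e * (1 + c2) + (1 / q ^ 3 + c2 * (1 / q) + 2 * (1 + q) * sqrt (2 * pi) * exp (- (c1 / 2) * q\<^sup>2)))"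
        using C by (intro mult_left_mono) auto
      also have "\<dots> = C * (e * (1 + c2)) + R n"
        unfolding R_def q3(3) q3(1)[symmetric] q3(2)[symmetric] q_def[symmetric] by (simp only: distrib_left)
      also have "\<dots> < \<epsilon>" using eC elim(1) \<epsilon> by linarith
      finally show "C * md_error n (\<delta> n) z < \<epsilon>" .
    qed
  qed
qed

text \<open>For \<open>\<delta>\<^sub>n\<close> of order \<open>n\<^sup>-\<^sup>1\<^sup>/\<^sup>6\<close>
  both constraints in the minimum are of order \<open>n\<^sup>1\<^sup>/\<^sup>6\<close>.\<close>
lemma range_of_rate:
  fixes \<delta> :: "nat \<Rightarrow> real"
  assumes \<delta>: "\<And>n. n \<ge> 1 \<Longrightarrow> \<delta> n > 0" and \<delta>_eq: "\<delta> \<in> \<Theta>(\<lambda>n. real n powr (-1/6))"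
  shows "(\<lambda>n. real n powr (1/6)) \<in> O(\<lambda>n. md_range n (\<delta> n))"
proof -
  from \<delta>_eq obtain c1 where c1: "0 < c1" "\<forall>\<^sub>F n in sequentially. norm (\<delta> n) \<ge> c1 * norm (real n powr (-1/6))"
    by (auto elim!: landau_omega.bigE simp: bigtheta_def)
  from \<delta>_eq obtain c2 where c2: "0 < c2" "\<forall>\<^sub>F n in sequentially. norm (\<delta> n) \<le> c2 * norm (real n powr (-1/6))"
    by (auto elim!: landau_o.bigE simp: bigtheta_def)
  define c where "c = min (1 / c2) (sqrt c1)"
  have c: "0 < c" using c1 c2 by (simp add: c_def)
  show ?thesis
  proof (rule landau_o.bigI[of "1 / c"])
    show "\<forall>\<^sub>F n in sequentially. norm (real n powr (1/6)) \<le> 1 / c * norm (md_range n (\<delta> n))"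
      using c1(2) c2(2) eventually_ge_at_top[of 1]
    proof eventually_elim
      case (elim n)
      define q where "q = real n powr (1/6)"
      have n: "0 < real n" using elim by simp
      have q: "0 < q" using n by (simp add: q_def)
      note qi = powr_sixth(3)[OF n, folded q_def]
      have \<delta>n: "0 < \<delta> n" "c1 / q \<le> \<delta> n" "\<delta> n \<le> c2 / q"
        using elim \<delta>[of n] q unfolding qi by auto
      have "1 / c2 * q \<le> inverse (\<delta> n)"
        using \<delta>n q c2 by (simp add: field_simps)
      moreover have "sqrt c1 * q \<le> real n powr (1/4) * sqrt (\<delta> n)"
      proof -
        have "(real n powr (1/4))\<^sup>2 = q ^ 3"
        proof -
          have "(real n powr (1/4))\<^sup>2 = real n powr (1/4 + 1/4)" unfolding power2_eq_square powr_add ..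
          then show ?thesis using n powr_sixth(1)[OF n, folded q_def] by (simp add: powr_half_sqrt)
        qed
        then have "real n powr (1/4) = sqrt (q ^ 3)" by (metis powr_ge_zero real_sqrt_unique)
        then have "real n powr (1/4) * sqrt (\<delta> n) = sqrt (q ^ 3 * \<delta> n)" by (simp add: real_sqrt_mult)
        moreover have "sqrt c1 * q = sqrt (c1 * q\<^sup>2)" using q by (simp add: real_sqrt_mult)
        moreover have "c1 * q\<^sup>2 \<le> q ^ 3 * \<delta> n"
        proof -
          have "c1 * q\<^sup>2 = q ^ 3 * (c1 / q)" using q by (simp add: power2_eq_square power3_eq_cube)
          also have "\<dots> \<le> q ^ 3 * \<delta> n" using \<delta>n q by (intro mult_left_mono) auto
          finally show ?thesis .
        qed
        ultimately show ?thesis by (simp only: real_sqrt_le_mono)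
      qed
      moreover have "c * q \<le> 1 / c2 * q" "c * q \<le> sqrt c1 * q"
        using q by (auto simp only: c_def intro!: mult_right_mono)
      ultimately have "c * q \<le> md_range n (\<delta> n)" by linarith
      then have "q \<le> 1 / c * md_range n (\<delta> n)"
        using c by (simp add: field_simps)
      also have "\<dots> \<le> 1 / c * norm (md_range n (\<delta> n))"
        using c by (intro mult_left_mono) auto
      finally show ?case using q by (simp add: q_def)
    qed
  qed (use c in simp)
qed

lemma taylor_quadratic:
  fixes U :: "real \<Rightarrow> real"
  assumes d1: "\<And>d. \<bar>d\<bar> \<le> c \<Longrightarrow> U differentiable (at (\<theta> + d))"
    and d2: "\<And>d. \<bar>d\<bar> \<le> c \<Longrightarrow> deriv U differentiable (at (\<theta> + d))"
    and bd: "\<And>d. \<bar>d\<bar> \<le> c \<Longrightarrow> \<bar>deriv (deriv U) (\<theta> + d)\<bar> \<le> \<kappa>"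
    and t: "0 \<le> t" "t \<le> c"
  shows "\<bar>U (\<theta> + t) - U \<theta> - deriv U \<theta> * t\<bar> \<le> \<kappa> * t\<^sup>2"
proof (cases "t = 0")
  case False
  then have t0: "0 < t" using t by simp
  have D1: "(U has_real_derivative deriv U x) (at x)" if "\<theta> \<le> x" "x \<le> \<theta> + t" for x
    using d1[of "x - \<theta>"] that t by (simp add: DERIV_deriv_iff_real_differentiable)
  have D2: "(deriv U has_real_derivative deriv (deriv U) x) (at x)" if "\<theta> \<le> x" "x \<le> \<theta> + t" for x
    using d2[of "x - \<theta>"] that t by (simp add: DERIV_deriv_iff_real_differentiable)
  obtain y where y: "\<theta> < y" "y < \<theta> + t" "U (\<theta> + t) - U \<theta> = (\<theta> + t - \<theta>) * deriv U y"
    using MVT2[of \<theta> "\<theta> + t" U "deriv U"] t0 D1 by auto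
  obtain w where w: "\<theta> < w" "w < y" "deriv U y - deriv U \<theta> = (y - \<theta>) * deriv (deriv U) w"
    using MVT2[of \<theta> y "deriv U" "deriv (deriv U)"] y D2 by auto
  have "U (\<theta> + t) - U \<theta> - deriv U \<theta> * t = t * (deriv U y - deriv U \<theta>)"
    using y(3) by (simp add: algebra_simps)
  also have "\<bar>\<dots>\<bar> = t * ((y - \<theta>) * \<bar>deriv (deriv U) w\<bar>)"
    unfolding w(3) using t0 y by (simp add: abs_mult)
  also have "\<dots> \<le> t * (t * \<kappa>)"
    using bd[of "w - \<theta>"] w y t by (intro mult_left_mono mult_mono) auto
  finally show ?thesis by (simp add: power2_eq_square mult_ac)
qed simp

theorem theorem2p3:
  fixes M :: "'a measure"
    and \<xi> X :: "nat \<Rightarrow> 'a \<Rightarrow> real"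
    and f F U :: "real \<Rightarrow> real"
    and \<theta> \<sigma> c0 \<kappa>0 c1 \<kappa>1 :: real
    and \<delta> :: "nat \<Rightarrow> real"
  assumes M: "prob_space M"
    and indep: "prob_space.indep_vars M (\<lambda>_. borel) \<xi> {1..}"
    and density: "\<And>i. i \<ge> 1 \<Longrightarrow> distributed M lborel (\<xi> i) (\<lambda>t. ennreal (f t))"
    and F_def: "F = (\<lambda>t. measure M {\<omega> \<in> space M. \<xi> 1 \<omega> \<le> t})"
    and F_deriv: "AE t in lborel. (F has_real_derivative f t) (at t)"
    and pseudomedian: "lower_median (walsh_cdf M \<xi>) = 0"
    and X_def: "X = (\<lambda>i \<omega>. \<theta> + \<xi> i \<omega>)"
    and U_def: "U = walsh_cdf M X"
    and \<sigma>_def: "\<sigma> = sqrt (4 * prob_space.variance M (\<lambda>\<omega>. F (- \<xi> 1 \<omega>)) / (deriv U \<theta>)\<^sup>2)"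
    and pos: "c0 > 0" "\<kappa>0 > 0" "c1 > 0" "\<kappa>1 > 0"
    and U': "\<And>d. \<bar>d\<bar> \<le> c0 \<Longrightarrow> U differentiable (at (\<theta> + d)) \<and> deriv U (\<theta> + d) \<ge> \<kappa>0"
    and U'': "\<And>d. \<bar>d\<bar> \<le> c1 \<Longrightarrow>
        U differentiable (at (\<theta> + d)) \<and> deriv U differentiable (at (\<theta> + d)) \<and>
        \<bar>deriv (deriv U) (\<theta> + d)\<bar> \<le> \<kappa>1"
    and f_bounded: "bdd_above (range (\<lambda>t. \<bar>f t\<bar>))"
    and \<delta>_pos: "\<And>n. n \<ge> 1 \<Longrightarrow> \<delta> n > 0"
    and \<delta>_lim: "filterlim (\<lambda>n. sqrt (real n) * \<delta> n) at_top sequentially"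
  shows
    "(\<forall>a :: nat \<Rightarrow> real.
        a \<in> o(\<lambda>n. min (inverse (\<delta> n)) (real n powr (1/4) * sqrt (\<delta> n))) \<longrightarrow>
        (\<exists>C > 0. \<forall>n \<ge> 2. \<forall>z. 0 < z \<and> z \<le> a n \<longrightarrow>
           hl_tail_error M X \<theta> \<sigma> n z \<le>
             C * ((1 + z ^ 3) / sqrt (real n) + (1 + z) * \<delta> n
                  + 2 * max z 1 * sqrt (2 * pi) * exp (z\<^sup>2 / 2 - sqrt (real n) * \<delta> n))))
     \<and>
     (\<delta> \<in> \<Theta>(\<lambda>n. real n powr (-1/6)) \<longrightarrow>
        (\<forall>a :: nat \<Rightarrow> real. a \<in> o(\<lambda>n. real n powr (1/6)) \<longrightarrow>
           (\<forall>\<epsilon> > 0. eventually (\<lambda>n. \<forall>z. 0 < z \<and> z \<le> a n \<longrightarrow>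
              hl_tail_error M X \<theta> \<sigma> n z < \<epsilon>) sequentially)))"
proof -
  from f_bounded obtain B where B: "\<And>t. \<bar>f t\<bar> \<le> B" by (auto simp: bdd_above_def)
  interpret prob_space M by fact
  interpret R: iid_bounded_density M \<xi> f B
  proof
    show "indep_vars (\<lambda>_. borel) \<xi> {1..}" by fact
    show "distributed M lborel (\<xi> i) (\<lambda>t. ennreal (f t))" if "1 \<le> i" for i using density that .
    show "f t \<le> B" for t using B[of t] by simp
  qed
  have half: "walsh_cdf M \<xi> 0 = 1 / 2" by (rule R.walsh_half[OF pseudomedian])
  have UX: "U (\<theta> + t) = walsh_cdf M \<xi> t" for t
    unfolding U_def walsh_cdf_def X_def by (intro arg_cong[where f = "measure M"]) auto
  define u' where "u' = deriv U \<theta>"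
  have u': "0 < u'" using U'[of 0] pos by (simp add: u'_def)
  have DU: "(U has_real_derivative u') (at \<theta>)"
    using U'[of 0] pos by (simp add: u'_def DERIV_deriv_iff_real_differentiable)
  have "((\<lambda>t. U (\<theta> + t)) has_real_derivative u') (at 0)"
    using DERIV_shift[of U u' 0 \<theta>] DU by (simp add: add.commute)
  then have "(walsh_cdf M \<xi> has_real_derivative u') (at 0)" by (simp add: UX)
  from R.proj_var_pos[OF half this u'] have S2: "0 < R.proj_var 0" .
  have taylor: "\<bar>walsh_cdf M \<xi> t - 1 / 2 - u' * t\<bar> \<le> \<kappa>1 * t\<^sup>2" if "0 \<le> t" "t \<le> c1" for t
    using taylor_quadratic[of c1 U \<theta> \<kappa>1 t] U'' that UX[of t] UX[of 0] by (simp add: u'_def half)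
  have FR: "F = R.F"
    unfolding F_def R.F_def R.\<nu>_def using R.rv[of 1]
    by (auto simp: measure_distr fun_eq_iff intro!: arg_cong[where f = "measure M"])
  have "variance (\<lambda>\<omega>. F (- \<xi> 1 \<omega>)) = R.proj_var 0"
  proof -
    have "expectation (\<lambda>\<omega>. F (- \<xi> 1 \<omega>)) = walsh_cdf M \<xi> 0"
      unfolding FR R.walsh_eq using R.integral_xi[of 1 "\<lambda>x. R.F (- x)"] by simp
    then show ?thesis
      unfolding FR R.proj_var_def using R.integral_xi[of 1 "\<lambda>x. (R.F (- x) - walsh_cdf M \<xi> 0)\<^sup>2"] by simp
  qed
  then have \<sigma>: "\<sigma> = 2 * sqrt (R.proj_var 0) / u'"
    using u' by (simp add: \<sigma>_def u'_def real_sqrt_divide real_sqrt_mult)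
  have \<sigma>_pos: "0 < \<sigma>" using S2 u' by (simp add: \<sigma>)
  have err: "hl_tail_error M X \<theta> \<sigma> n z = \<bar>prob {\<omega> \<in> space M. \<theta> + (2 * sqrt (R.proj_var 0) / u') * z / sqrt (real n)
      < hodges_lehmann n (\<lambda>i. \<theta> + \<xi> i \<omega>)} / normal_tail z - 1\<bar>" if n: "n \<ge> 2" for n z
  proof -
    have "sqrt (real n) * (h - \<theta>) / \<sigma> > z \<longleftrightarrow> \<theta> + \<sigma> * z / sqrt (real n) < h" for h
    proof -
      have r: "0 < sqrt (real n)" using n by simp
      have "sqrt (real n) * (h - \<theta>) / \<sigma> > z \<longleftrightarrow> \<sigma> * z < (h - \<theta>) * sqrt (real n)"
        using \<sigma>_pos by (simp add: pos_less_divide_eq mult.commute)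
      also have "\<dots> \<longleftrightarrow> \<sigma> * z / sqrt (real n) < h - \<theta>" using r by (simp only: pos_divide_less_eq)
      also have "\<dots> \<longleftrightarrow> \<theta> + \<sigma> * z / sqrt (real n) < h" by linarith
      finally show ?thesis .
    qed
    then show ?thesis unfolding hl_tail_error_def normal_tail_def X_def \<sigma>[symmetric] by simp
  qed
  have part1: "\<exists>C>0. \<forall>n\<ge>2. \<forall>z. 0 < z \<and> z \<le> a n \<longrightarrow> hl_tail_error M X \<theta> \<sigma> n z \<le> C * md_error n (\<delta> n) z"
    if a: "a \<in> o(\<lambda>n. md_range n (\<delta> n))" for a
    using R.hodges_lehmann_moderate_deviation[OF taylor u' pos(3) less_imp_le[OF pos(4)] S2 \<delta>_pos \<delta>_lim a, of \<theta>]
    by (simp add: err)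
  have part2: "\<forall>\<^sub>F n in sequentially. \<forall>z. 0 < z \<and> z \<le> a n \<longrightarrow> hl_tail_error M X \<theta> \<sigma> n z < \<epsilon>"
    if \<delta>_eq: "\<delta> \<in> \<Theta>(\<lambda>n. real n powr (-1/6))" and a: "a \<in> o(\<lambda>n. real n powr (1/6))" and \<epsilon>: "\<epsilon> > 0" for a \<epsilon>
  proof -
    have "a \<in> o(\<lambda>n. md_range n (\<delta> n))"
      by (rule landau_o.small_big_trans[OF a range_of_rate[OF \<delta>_pos \<delta>_eq]])
    from part1[OF this] obtain C where C: "0 < C"
      "\<And>n z. n \<ge> 2 \<Longrightarrow> 0 < z \<Longrightarrow> z \<le> a n \<Longrightarrow> hl_tail_error M X \<theta> \<sigma> n z \<le> C * md_error n (\<delta> n) z" by blast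
    have "\<forall>\<^sub>F n in sequentially. \<forall>z. 0 < z \<and> z \<le> a n \<longrightarrow> C * md_error n (\<delta> n) z < \<epsilon>"
      by (rule md_error_vanishes[OF _ \<delta>_eq a C(1) \<epsilon>]) (rule \<delta>_pos)
    then show ?thesis
      using eventually_ge_at_top[of 2]
    proof eventually_elim
      case (elim n)
      show ?case
      proof (intro allI impI)
        fix z assume z: "0 < z \<and> z \<le> a n"
        have "hl_tail_error M X \<theta> \<sigma> n z \<le> C * md_error n (\<delta> n) z" using C(2) elim(2) z by blast
        also have "\<dots> < \<epsilon>" using elim(1) z by blast
        finally show "hl_tail_error M X \<theta> \<sigma> n z < \<epsilon>" .
      qed
    qed
  qed
  show ?thesis
    by (intro conjI allI impI; (rule part1[unfolded md_error_def] part2; assumption))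
qed

end
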